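(* As a super ($\mathbb Z/2$-graded) algebra, with $\mathbb Z/2$-grading given by the parity of the number of vertices and with disjoint union product, $\mathcal G$ is a Batalin-Vilkovisky algebra with respect to the operator $\partial_H$. That is, $\mathcal G$ is graded commutative and associative, $\partial_H$ is odd, $\partial_H^2=0$, and $\Delta=\partial_H$ satisfies, for all homogeneous $u,v,w\in\mathcal G$, $$\Delta(uvw)=\Delta(uv)w+(-1)^{|u|}u\Delta(vw)+(-1)^{(|u|-1)|v|}v\Delta(uw)-(\Delta u)vw-(-1)^{|u|}u(\Delta v)w-(-1)^{|u|+|v|}uv(\Delta w).$$
   Context: Graphs. A graph is a finite 1-dimensional CW complex (not necessarily connected, multiple edges allowed, the empty graph allowed) all of whose vertices have valence at least 3. A labelling of a graph is a numbering $1,2,\dots$ of its vertices together with an arrow on each edge. An orientation is an equivalence class of labellings: reversing the arrow on one edge, or switching the numbers of two vertices, changes the orientation to the opposite one. $\mathcal G$ is the vector space, over a fixed field of characteristic zero, of linear combinations of (isomorphism classes of) oriented graphs modulo $(X,or)=-(X,-or)$; here $|X|$ is the number of vertices of $X$ modulo 2. A graph with a loop is zero in $\mathcal G$, so graphs may be assumed loopless. The orientation is suppressed from the notation. Collapse. For a (non-loop) edge $e$ of $X$, $X_e$ is obtained by collapsing $e$ to a point. Induced orientation: represent the orientation of $X$ by a labelling in which the initial vertex of $e$ is 1 and the terminal vertex is 2; in $X_e$ the vertex resulting from the collapse is numbered 1, the numbers of all other vertices are reduced by one, and arrows on uncontracted edges are unchanged. Half-edges. Each half-edge $h$ begins at a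 vertex $v(h)$, lies in an edge $e(h)$, and has a complementary half-edge $\bar h$ with $e(h)=h\cup\bar h$. For distinct half-edges $h,k$ with $k\ne\bar h$, $X\langle hk\rangle$ is obtained by cutting $e(h)$ and $e(k)$ at their midpoints and gluing $h$ to $k$ and $\bar h$ to $\bar k$; orientation: represent the orientation of $X$ so that $h$ is the initial half-edge of $e(h)$ and $k$ is the terminal half-edge of $e(k)$; in $X\langle hk\rangle$ the edge $h\cup k$ is directed from $h$ to $k$ and the edge $\bar h\cup\bar k$ from $\bar k$ to $\bar h$, all else unchanged. If $v(h)\ne v(k)$, $X_{hk}:=(X\langle hk\rangle)_{h\cup k}$; if $v(h)=v(k)$, $X_{hk}:=0$. $\partial_H X=\sum X_{hk}$, sum over all unordered pairs $\{h,k\}$ of distinct half-edges of $X$ with $k\neq\bar h$, extended linearly. Product. If $X$ has vertices numbered $1,\dots,x$ and $Y$ has vertices numbered $1,\dots,y$, then $X\cdot Y$ is the disjoint union with the vertex numbers of $Y$ shifted to $x+1,\dots,x+y$ (arrows unchanged), extended bilinearly. *)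

theory Defs
  imports
    Complex_Main
    "HOL-Combinatorics.Permutations"
    "HOL-Library.Poly_Mapping"
    "HOL-Library.Z2"
begin

section \<open>Labelled graphs\<close>

text \<open>
  A labelled graph is recorded by its set of half-edges, the vertex \<open>vtx h\<close> at which a half-edge
  begins, the complementary half-edge \<open>opp h\<close>, and the set \<open>ini\<close> of half-edges that are initial
  with respect to the arrow on their edge.  The numbering of the vertices is built in: the vertices
  are the numbers \<open>1, \<dots>, nv\<close>.  Loops and multiple edges are allowed, the graph
  need not be connected and may be empty.  Values of \<open>vtx\<close> and \<open>opp\<close> outside \<open>halves\<close> carry no
  meaning.
\<close>

record graph_data =
  nv :: nat
  halves :: "nat set"
  vtx :: "nat \<Rightarrow> nat"
  opp :: "nat \<Rightarrow> nat"
  ini :: "nat set"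

definition labelled_graph :: "graph_data \<Rightarrow> bool" where
  "labelled_graph X \<longleftrightarrow>
     finite (halves X) \<and>
     (\<forall>h\<in>halves X. vtx X h \<in> {1..nv X}) \<and>
     (\<forall>h\<in>halves X. opp X h \<in> halves X \<and> opp X h \<noteq> h \<and> opp X (opp X h) = h) \<and>
     ini X \<subseteq> halves X \<and>
     (\<forall>h\<in>halves X. opp X h \<in> ini X \<longleftrightarrow> h \<notin> ini X) \<and>
     (\<forall>i\<in>{1..nv X}. card {h \<in> halves X. vtx X h = i} \<ge> 3)"

definition labelled_iso :: "graph_data \<Rightarrow> graph_data \<Rightarrow> bool" where
  "labelled_iso X Y \<longleftrightarrow> nv X = nv Y \<and>
     (\<exists>f. bij_betw f (halves X) (halves Y) \<and>
          (\<forall>h\<in>halves X. vtx Y (f h) = vtx X h \<and> opp Y (f h) = f (opp X h) \<and>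
                        (f h \<in> ini Y \<longleftrightarrow> h \<in> ini X)))"

definition reverse_arrow :: "nat \<Rightarrow> graph_data \<Rightarrow> graph_data" where
  "reverse_arrow h X = X\<lparr>ini := (ini X - {h, opp X h}) \<union> ({h, opp X h} - ini X)\<rparr>"

definition renumber :: "(nat \<Rightarrow> nat) \<Rightarrow> graph_data \<Rightarrow> graph_data" where
  "renumber p X = X\<lparr>vtx := p \<circ> vtx X\<rparr>"

definition empty_graph :: graph_data where
  "empty_graph = \<lparr>nv = 0, halves = {}, vtx = id, opp = id, ini = {}\<rparr>"

text \<open>Disjoint union, the half-edges of the two factors being tagged by parity.\<close>

definition disjoint_union :: "graph_data \<Rightarrow> graph_data \<Rightarrow> graph_data" where
  "disjoint_union X Y =
     \<lparr>nv = nv X + nv Y,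
      halves = (\<lambda>h. 2 * h) ` halves X \<union> (\<lambda>h. 2 * h + 1) ` halves Y,
      vtx = (\<lambda>h. if even h then vtx X (h div 2) else nv X + vtx Y (h div 2)),
      opp = (\<lambda>h. if even h then 2 * opp X (h div 2) else 2 * opp Y (h div 2) + 1),
      ini = (\<lambda>h. 2 * h) ` ini X \<union> (\<lambda>h. 2 * h + 1) ` ini Y\<rparr>"

text \<open>
  Cutting \<open>e(h)\<close> and \<open>e(k)\<close> and regluing.  The description of the new arrows
  is valid for a labelling in which \<open>h\<close> is initial and \<open>k\<close> is terminal; the factor
  \<open>arrow_sign X h k\<close> is the cost of passing to such a labelling by reversing the arrows on \<open>e(h)\<close>
  and \<open>e(k)\<close> if necessary.
\<close>

definition arrow_sign :: "graph_data \<Rightarrow> nat \<Rightarrow> nat \<Rightarrow> int" where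
  "arrow_sign X h k = (if h \<in> ini X then 1 else - 1) * (if k \<notin> ini X then 1 else - 1)"

definition cut_glue :: "graph_data \<Rightarrow> nat \<Rightarrow> nat \<Rightarrow> graph_data" where
  "cut_glue X h k =
     X\<lparr>opp := (opp X)(h := k, k := h, opp X h := opp X k, opp X k := opp X h),
       ini := (ini X - {h, opp X h, k, opp X k}) \<union> {h, opp X k}\<rparr>"

text \<open>
  Collapse of the edge with initial half-edge \<open>h\<close>.  The product of (at most) two transpositions
  \<open>to_front a b\<close> moves \<open>a\<close> to \<open>1\<close> and \<open>b\<close> to \<open>2\<close>; applied to the end points \<open>a, b\<close> of the edge it
  leads to a labelling as required in the definition of the induced orientation, at the cost of the
  factor \<open>collapse_sign X h\<close>.
\<close>

definition to_front :: "nat \<Rightarrow> nat \<Rightarrow> nat \<Rightarrow> nat" where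
  "to_front a b = transpose 2 (transpose 1 a b) \<circ> transpose 1 a"

definition collapse_sign :: "graph_data \<Rightarrow> nat \<Rightarrow> int" where
  "collapse_sign X h = sign (to_front (vtx X h) (vtx X (opp X h)))"

definition collapse :: "graph_data \<Rightarrow> nat \<Rightarrow> graph_data" where
  "collapse X h =
     \<lparr>nv = nv X - 1,
      halves = halves X - {h, opp X h},
      vtx = (\<lambda>x. let i = to_front (vtx X h) (vtx X (opp X h)) (vtx X x)
                 in if i \<le> 2 then 1 else i - 1),
      opp = opp X,
      ini = ini X - {h}\<rparr>"

lemma labelled_graphI:
  assumes "finite (halves X)"
    and "\<And>h. h \<in> halves X \<Longrightarrow> vtx X h \<in> {1..nv X}"
    and "\<And>h. h \<in> halves X \<Longrightarrow> opp X h \<in> halves X"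
    and "\<And>h. h \<in> halves X \<Longrightarrow> opp X h \<noteq> h"
    and "\<And>h. h \<in> halves X \<Longrightarrow> opp X (opp X h) = h"
    and "ini X \<subseteq> halves X"
    and "\<And>h. h \<in> halves X \<Longrightarrow> opp X h \<in> ini X \<longleftrightarrow> h \<notin> ini X"
    and "\<And>i. i \<in> {1..nv X} \<Longrightarrow> card {h \<in> halves X. vtx X h = i} \<ge> 3"
  shows "labelled_graph X"
  unfolding labelled_graph_def by (intro conjI ballI) (rule assms; assumption)+

lemma labelled_graphD:
  assumes "labelled_graph X"
  shows "finite (halves X)"
    and "\<And>h. h \<in> halves X \<Longrightarrow> vtx X h \<in> {1..nv X}"
    and "\<And>h. h \<in> halves X \<Longrightarrow> opp X h \<in> halves X"
    and "\<And>h. h \<in> halves X \<Longrightarrow> opp X h \<noteq> h"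
    and "\<And>h. h \<in> halves X \<Longrightarrow> opp X (opp X h) = h"
    and "ini X \<subseteq> halves X"
    and "\<And>h. h \<in> halves X \<Longrightarrow> opp X h \<in> ini X \<longleftrightarrow> h \<notin> ini X"
    and "\<And>i. i \<in> {1..nv X} \<Longrightarrow> card {h \<in> halves X. vtx X h = i} \<ge> 3"
proof -
  have *: "finite (halves X)"
    "\<forall>h\<in>halves X. vtx X h \<in> {1..nv X}"
    "\<forall>h\<in>halves X. opp X h \<in> halves X \<and> opp X h \<noteq> h \<and> opp X (opp X h) = h"
    "ini X \<subseteq> halves X"
    "\<forall>h\<in>halves X. opp X h \<in> ini X \<longleftrightarrow> h \<notin> ini X"
    "\<forall>i\<in>{1..nv X}. card {h \<in> halves X. vtx X h = i} \<ge> 3"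
    by (insert assms[unfolded labelled_graph_def]) (elim conjE, assumption)+
  show "finite (halves X)" "ini X \<subseteq> halves X" by fact+
  show "vtx X h \<in> {1..nv X}" if "h \<in> halves X" for h using *(2) that by (rule bspec)
  show "opp X h \<in> halves X" if "h \<in> halves X" for h
    using bspec[OF *(3) that] by (elim conjE)
  show "opp X h \<noteq> h" if "h \<in> halves X" for h
    using bspec[OF *(3) that] by (elim conjE)
  show "opp X (opp X h) = h" if "h \<in> halves X" for h
    using bspec[OF *(3) that] by (elim conjE)
  show "opp X h \<in> ini X \<longleftrightarrow> h \<notin> ini X" if "h \<in> halves X" for h
    using *(5) that by (rule bspec)
  show "card {h \<in> halves X. vtx X h = i} \<ge> 3" if "i \<in> {1..nv X}" for i
    using *(6) that by (rule bspec)
qed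

lemma labelled_graph_empty: "labelled_graph empty_graph"
  by (rule labelled_graphI) (auto simp: empty_graph_def)

lemma labelled_graph_reverse:
  assumes "labelled_graph X" "h \<in> halves X"
  shows "labelled_graph (reverse_arrow h X)"
proof -
  note D = labelled_graphD[OF assms(1)]
  show ?thesis
  proof (rule labelled_graphI)
    show "ini (reverse_arrow h X) \<subseteq> halves (reverse_arrow h X)"
      using D(3,6) assms(2) by (auto simp: reverse_arrow_def)
    fix k assume "k \<in> halves (reverse_arrow h X)"
    then have k: "k \<in> halves X" by (simp add: reverse_arrow_def)
    have "opp X k = h \<longleftrightarrow> k = opp X h" "opp X k = opp X h \<longleftrightarrow> k = h"
      using D(5) k assms(2) by metis+
    then show "opp (reverse_arrow h X) k \<in> ini (reverse_arrow h X) \<longleftrightarrow> k \<notin> ini (reverse_arrow h X)"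
      using D(7)[OF k] D(7)[OF assms(2)] D(4)[OF k] D(4)[OF assms(2)]
      by (auto simp: reverse_arrow_def)
  qed (simp_all add: reverse_arrow_def D(1-5) D(8)[simplified] D(2)[simplified])
qed

lemma labelled_graph_renumber:
  assumes "labelled_graph X" "p permutes {1..nv X}"
  shows "labelled_graph (renumber p X)"
proof -
  note D = labelled_graphD[OF assms(1)]
  show ?thesis
  proof (rule labelled_graphI)
    fix i assume "i \<in> {1..nv (renumber p X)}"
    then have i: "i \<in> {1..nv X}" by (simp add: renumber_def)
    have "{h \<in> halves (renumber p X). vtx (renumber p X) h = i} = {h \<in> halves X. vtx X h = inv p i}"
      using permutes_inverses[OF assms(2)] by (auto simp: renumber_def)
    moreover have "inv p i \<in> {1..nv X}"
      using i permutes_in_image[OF permutes_inv[OF assms(2)]] by blast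
    ultimately show "card {h \<in> halves (renumber p X). vtx (renumber p X) h = i} \<ge> 3"
      using D(8) by simp
  next
    fix h assume "h \<in> halves (renumber p X)"
    then show "vtx (renumber p X) h \<in> {1..nv (renumber p X)}"
      using D(2) permutes_in_image[OF assms(2)] by (simp add: renumber_def)
  qed (simp_all add: renumber_def D(1,3-7))
qed

lemma disjoint_union_simps [simp]:
  "nv (disjoint_union X Y) = nv X + nv Y"
  "vtx (disjoint_union X Y) (2 * h) = vtx X h"
  "vtx (disjoint_union X Y) (Suc (2 * h)) = nv X + vtx Y h"
  "opp (disjoint_union X Y) (2 * h) = 2 * opp X h"
  "opp (disjoint_union X Y) (Suc (2 * h)) = Suc (2 * opp Y h)"
  "2 * h \<in> halves (disjoint_union X Y) \<longleftrightarrow> h \<in> halves X"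
  "Suc (2 * h) \<in> halves (disjoint_union X Y) \<longleftrightarrow> h \<in> halves Y"
  "2 * h \<in> ini (disjoint_union X Y) \<longleftrightarrow> h \<in> ini X"
  "Suc (2 * h) \<in> ini (disjoint_union X Y) \<longleftrightarrow> h \<in> ini Y"
proof -
  have mem: "2 * h \<in> (\<lambda>h. 2 * h) ` A \<longleftrightarrow> h \<in> A" "2 * h \<notin> (\<lambda>h. Suc (2 * h)) ` A"
      "Suc (2 * h) \<in> (\<lambda>h. Suc (2 * h)) ` A \<longleftrightarrow> h \<in> A" "Suc (2 * h) \<notin> (\<lambda>h. 2 * h) ` A"
      for h :: nat and A
    by (auto simp: image_iff) presburger+
  show "2 * h \<in> halves (disjoint_union X Y) \<longleftrightarrow> h \<in> halves X"
    "Suc (2 * h) \<in> halves (disjoint_union X Y) \<longleftrightarrow> h \<in> halves Y"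
    "2 * h \<in> ini (disjoint_union X Y) \<longleftrightarrow> h \<in> ini X"
    "Suc (2 * h) \<in> ini (disjoint_union X Y) \<longleftrightarrow> h \<in> ini Y"
    by (simp_all add: disjoint_union_def mem)
qed (simp_all add: disjoint_union_def)

lemma halves_disjoint_union:
  "halves (disjoint_union X Y) = (\<lambda>h. 2 * h) ` halves X \<union> (\<lambda>h. Suc (2 * h)) ` halves Y"
  "ini (disjoint_union X Y) = (\<lambda>h. 2 * h) ` ini X \<union> (\<lambda>h. Suc (2 * h)) ` ini Y"
  by (simp_all add: disjoint_union_def)

lemma halves_disjoint_unionE:
  assumes "h \<in> halves (disjoint_union X Y)"
  obtains a where "h = 2 * a" "a \<in> halves X" | b where "h = Suc (2 * b)" "b \<in> halves Y"
  using assms unfolding halves_disjoint_union by blast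

lemma labelled_graph_union:
  assumes "labelled_graph X" "labelled_graph Y"
  shows "labelled_graph (disjoint_union X Y)"
proof -
  note D = labelled_graphD[OF assms(1)] and E = labelled_graphD[OF assms(2)]
  let ?U = "disjoint_union X Y"
  have inj: "inj_on (\<lambda>h::nat. 2 * h) A" "inj_on (\<lambda>h::nat. Suc (2 * h)) A" for A
    by (auto simp: inj_on_def)
  show ?thesis
  proof (rule labelled_graphI)
    fix i assume i: "i \<in> {1..nv ?U}"
    show "card {h \<in> halves ?U. vtx ?U h = i} \<ge> 3"
    proof (cases "i \<le> nv X")
      case True
      have "{h \<in> halves ?U. vtx ?U h = i} = (\<lambda>h. 2 * h) ` {h \<in> halves X. vtx X h = i}"
      proof (intro equalityI subsetI)
        fix h assume "h \<in> {h \<in> halves ?U. vtx ?U h = i}"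
        then have h: "h \<in> halves ?U" "vtx ?U h = i" by auto
        from h(1) show "h \<in> (\<lambda>h. 2 * h) ` {h \<in> halves X. vtx X h = i}"
        proof (cases rule: halves_disjoint_unionE)
          case (2 b)
          then show ?thesis using h(2) E(2)[of b] True by simp
        qed (use h in auto)
      qed auto
      then show ?thesis using D(8)[of i] i True by (simp add: card_image inj)
    next
      case False
      have "{h \<in> halves ?U. vtx ?U h = i} = (\<lambda>h. Suc (2 * h)) ` {h \<in> halves Y. vtx Y h = i - nv X}"
      proof (intro equalityI subsetI)
        fix h assume "h \<in> {h \<in> halves ?U. vtx ?U h = i}"
        then have h: "h \<in> halves ?U" "vtx ?U h = i" by auto
        from h(1) show "h \<in> (\<lambda>h. Suc (2 * h)) ` {h \<in> halves Y. vtx Y h = i - nv X}"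
        proof (cases rule: halves_disjoint_unionE)
          case (1 a)
          then show ?thesis using h(2) D(2)[of a] False by simp
        qed (use h in auto)
      qed (use False in auto)
      moreover have "i - nv X \<in> {1..nv Y}" using i False by auto
      ultimately show ?thesis using E(8)[of "i - nv X"] by (simp add: card_image inj)
    qed
  next
    fix h assume "h \<in> halves ?U"
    then have "vtx ?U h \<in> {1..nv ?U} \<and> opp ?U h \<in> halves ?U \<and> opp ?U h \<noteq> h \<and> opp ?U (opp ?U h) = h
        \<and> (opp ?U h \<in> ini ?U \<longleftrightarrow> h \<notin> ini ?U)"
    proof (cases rule: halves_disjoint_unionE)
      case (1 a)
      then show ?thesis using D(2-5)[of a] D(7)[of a] by simp
    next
      case (2 b)
      then show ?thesis using E(2-5)[of b] E(7)[of b] by simp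
    qed
    then show "vtx ?U h \<in> {1..nv ?U}" "opp ?U h \<in> halves ?U" "opp ?U h \<noteq> h"
      "opp ?U (opp ?U h) = h" "opp ?U h \<in> ini ?U \<longleftrightarrow> h \<notin> ini ?U"
      by blast+
  next
    show "finite (halves ?U)" using D(1) E(1) by (simp add: halves_disjoint_union)
    show "ini ?U \<subseteq> halves ?U" using D(6) E(6) by (auto simp: halves_disjoint_union)
  qed
qed

lemma labelled_graph_cut_glue:
  assumes "labelled_graph X" "h \<in> halves X" "k \<in> halves X" "h \<noteq> k" "k \<noteq> opp X h"
  shows "labelled_graph (cut_glue X h k)"
proof -
  note D = labelled_graphD[OF assms(1)]
  have ne: "opp X h \<noteq> h" "opp X k \<noteq> k" "opp X h \<noteq> opp X k" "opp X k \<noteq> h"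
    using D(4,5) assms by metis+
  have iff: "opp X x = h \<longleftrightarrow> x = opp X h" "opp X x = k \<longleftrightarrow> x = opp X k"
      "opp X x = opp X h \<longleftrightarrow> x = h" "opp X x = opp X k \<longleftrightarrow> x = k" if "x \<in> halves X" for x
    using D(5) assms that by metis+
  let ?Y = "cut_glue X h k"
  have sel: "halves ?Y = halves X" "nv ?Y = nv X" "vtx ?Y = vtx X"
      "ini ?Y = (ini X - {h, opp X h, k, opp X k}) \<union> {h, opp X k}"
      "opp ?Y h = k" "opp ?Y k = h" "opp ?Y (opp X h) = opp X k" "opp ?Y (opp X k) = opp X h"
      "\<And>x. x \<notin> {h, k, opp X h, opp X k} \<Longrightarrow> opp ?Y x = opp X x"
    using assms(4,5) ne by (auto simp: cut_glue_def)
  have oh: "opp X h \<in> halves X" "opp X k \<in> halves X" using D(3) assms by auto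
  show ?thesis
  proof (rule labelled_graphI)
    fix x assume "x \<in> halves ?Y"
    then have x: "x \<in> halves X" by (simp add: sel)
    show "opp ?Y x \<in> halves ?Y"
      using assms(2,3) oh D(3)[OF x] sel by (cases "x \<in> {h, k, opp X h, opp X k}") auto
    show "opp ?Y x \<noteq> x"
    proof (cases "x \<in> {h, k, opp X h, opp X k}")
      case True
      then have "x = h \<or> x = k \<or> x = opp X h \<or> x = opp X k" by simp
      then show ?thesis
        by (elim disjE) (simp_all add: sel(5-8) assms(4) assms(4)[symmetric] ne ne[symmetric])
    next
      case False
      then show ?thesis using sel(9) D(4)[OF x] by simp
    qed
    show "opp ?Y (opp ?Y x) = x"
    proof (cases "x \<in> {h, k, opp X h, opp X k}")
      case True
      then have "x = h \<or> x = k \<or> x = opp X h \<or> x = opp X k" by simp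
      then show ?thesis by (elim disjE) (simp_all add: sel(5-8))
    next
      case False
      then have "opp X x \<notin> {h, k, opp X h, opp X k}" using iff[OF x] by blast
      then show ?thesis using sel(9) False D(5)[OF x] by simp
    qed
    show "opp ?Y x \<in> ini ?Y \<longleftrightarrow> x \<notin> ini ?Y"
    proof (cases "x \<in> {h, k, opp X h, opp X k}")
      case True
      then have "x = h \<or> x = k \<or> x = opp X h \<or> x = opp X k" by simp
      then show ?thesis
        by (elim disjE)
          (simp_all add: sel(4-8) assms(4,5) assms(4,5)[symmetric] ne ne[symmetric])
    next
      case False
      then have "opp X x \<notin> {h, k, opp X h, opp X k}" using iff[OF x] by blast
      then show ?thesis using sel(4,9) False D(7)[OF x] by simp
    qed
  next
    show "ini ?Y \<subseteq> halves ?Y" using D(6) assms(2) oh by (auto simp: sel)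
  qed (simp_all add: sel D(1) D(8)[simplified] D(2)[simplified])
qed

lemma to_front:
  assumes "a \<noteq> b" "a \<ge> 1" "b \<ge> 1"
  shows "to_front a b a = 1" "to_front a b b = 2"
  using assms by (auto simp: to_front_def transpose_def)

lemma to_front_permutes:
  assumes "a \<in> {1..n}" "b \<in> {1..n}" "a \<noteq> b"
  shows "to_front a b permutes {1..n}"
proof -
  have "n \<ge> 2" using assms by auto
  then show ?thesis unfolding to_front_def
    using assms by (intro permutes_compose permutes_swap_id) (auto simp: transpose_def)
qed

lemma labelled_graph_collapse:
  assumes "labelled_graph X" "h \<in> ini X" "vtx X h \<noteq> vtx X (opp X h)"
  shows "labelled_graph (collapse X h)"
proof -
  note D = labelled_graphD[OF assms(1)]
  have h: "h \<in> halves X" using D(6) assms by auto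
  define p where "p = to_front (vtx X h) (vtx X (opp X h))"
  have n2: "nv X \<ge> 2" using D(2)[OF h] D(2)[OF D(3)[OF h]] assms(3) by auto
  have p: "p permutes {1..nv X}"
    unfolding p_def using to_front_permutes D(2)[OF h] D(2)[OF D(3)[OF h]] assms(3) by blast
  have p12: "p (vtx X h) = 1" "p (vtx X (opp X h)) = 2"
    unfolding p_def using to_front[OF assms(3)] D(2)[OF h] D(2)[OF D(3)[OF h]] by auto
  have sel: "halves (collapse X h) = halves X - {h, opp X h}" "nv (collapse X h) = nv X - 1"
      "opp (collapse X h) = opp X" "ini (collapse X h) = ini X - {h}"
      "vtx (collapse X h) x = (if p (vtx X x) \<le> 2 then 1 else p (vtx X x) - 1)" for x
    by (simp_all add: collapse_def p_def Let_def)
  have pv: "p (vtx X x) \<in> {1..nv X}" if "x \<in> halves X" for x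
    using D(2)[OF that] permutes_in_image[OF p] by blast
  have iff: "opp X x = h \<longleftrightarrow> x = opp X h" "opp X x = opp X h \<longleftrightarrow> x = h" if "x \<in> halves X" for x
    using D(5) h that by metis+
  have val: "card {x \<in> halves X. p (vtx X x) = i} \<ge> 3" if "i \<in> {1..nv X}" for i
  proof -
    have "{x \<in> halves X. p (vtx X x) = i} = {x \<in> halves X. vtx X x = inv p i}"
      using permutes_inverses[OF p] by auto
    moreover have "inv p i \<in> {1..nv X}"
      using that permutes_in_image[OF permutes_inv[OF p]] by blast
    ultimately show ?thesis using D(8) by simp
  qed
  show ?thesis
  proof (rule labelled_graphI)
    fix i assume i: "i \<in> {1..nv (collapse X h)}"
    show "card {x \<in> halves (collapse X h). vtx (collapse X h) x = i} \<ge> 3"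
    proof (cases "i = 1")
      case False
      have "{x \<in> halves (collapse X h). vtx (collapse X h) x = i}
          = {x \<in> halves X. p (vtx X x) = Suc i}"
        using False i by (auto simp: sel p12 split: if_splits)
      moreover have "Suc i \<in> {1..nv X}" using i n2 by (auto simp: sel)
      ultimately show ?thesis using val[of "Suc i"] by simp
    next
      case True
      let ?A = "\<lambda>i. {x \<in> halves X. p (vtx X x) = i}"
      have "{x \<in> halves (collapse X h). vtx (collapse X h) x = i} = (?A 1 - {h}) \<union> (?A 2 - {opp X h})"
        proof (intro set_eqI)
        fix x
        show "x \<in> {x \<in> halves (collapse X h). vtx (collapse X h) x = i}
            \<longleftrightarrow> x \<in> (?A 1 - {h}) \<union> (?A 2 - {opp X h})"
        proof (cases "x \<in> halves X")
          case x: True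
          have "x \<noteq> h" if "p (vtx X x) = 2" using that p12 by auto
          moreover have "x \<noteq> opp X h" if "p (vtx X x) = 1" using that p12 by auto
          moreover have "p (vtx X x) \<ge> 1" using pv[OF x] by simp
          ultimately show ?thesis using x unfolding sel True by auto
        qed (simp add: sel)
      qed
      moreover have "card ((?A 1 - {h}) \<union> (?A 2 - {opp X h})) = card (?A 1 - {h}) + card (?A 2 - {opp X h})"
        using D(1) by (intro card_Un_disjoint) auto
      moreover have "card (?A 1 - {h}) \<ge> 2" "card (?A 2 - {opp X h}) \<ge> 2"
        using val[of 1] val[of 2] n2 h D(3)[OF h] p12 D(1) by (auto simp: card_Diff_singleton)
      ultimately show ?thesis by simp
    qed
  next
    fix x assume x: "x \<in> halves (collapse X h)"
    then show "vtx (collapse X h) x \<in> {1..nv (collapse X h)}"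
      using pv[of x] n2 by (auto simp: sel)
  next
    show "ini (collapse X h) \<subseteq> halves (collapse X h)"
      using D(6) D(7)[OF h] assms(2) by (auto simp: sel)
  qed (use D h assms(2) in \<open>auto simp: sel iff\<close>)
qed

typedef lgraph = "{X. labelled_graph X}"
  using labelled_graph_empty by blast

section \<open>The vector space of oriented graphs\<close>

text \<open>The free vector space \<open>lgraph \<Rightarrow>\<^sub>0 'k\<close> on labelled graphs.\<close>

lift_definition fscale :: "'k::field \<Rightarrow> ('a \<Rightarrow>\<^sub>0 'k) \<Rightarrow> ('a \<Rightarrow>\<^sub>0 'k)"
  is "\<lambda>c f x. c * f x"
  by (erule rev_finite_subset) auto

lemma lookup_fscale [simp]: "Poly_Mapping.lookup (fscale c x) X = c * Poly_Mapping.lookup x X"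
  by transfer simp

interpretation free: vector_space "fscale :: 'k::field \<Rightarrow> ('a \<Rightarrow>\<^sub>0 'k) \<Rightarrow> ('a \<Rightarrow>\<^sub>0 'k)"
  by unfold_locales (rule poly_mapping_eqI, simp add: lookup_add algebra_simps)+

text \<open>
  The first family of relators identifies isomorphic labelled graphs.  The other two express
  \<open>(X, or) = - (X, - or)\<close> for the elementary changes of labelling that reverse the orientation:
  reversing one arrow, and switching the numbers of two vertices.  Any two labellings of a graph
  are linked by such changes.
\<close>

definition relators :: "(lgraph \<Rightarrow>\<^sub>0 'k::field) set" where
  "relators =
     {Poly_Mapping.single X 1 - Poly_Mapping.single Y 1 | X Y.
        labelled_iso (Rep_lgraph X) (Rep_lgraph Y)} \<union>
     {Poly_Mapping.single X 1 + Poly_Mapping.single Y 1 | X Y h.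
        h \<in> halves (Rep_lgraph X) \<and> Rep_lgraph Y = reverse_arrow h (Rep_lgraph X)} \<union>
     {Poly_Mapping.single X 1 + Poly_Mapping.single Y 1 | X Y i j.
        i \<in> {1..nv (Rep_lgraph X)} \<and> j \<in> {1..nv (Rep_lgraph X)} \<and> i \<noteq> j \<and>
        Rep_lgraph Y = renumber (transpose i j) (Rep_lgraph X)}"

definition graph_rel :: "(lgraph \<Rightarrow>\<^sub>0 'k::field) \<Rightarrow> (lgraph \<Rightarrow>\<^sub>0 'k) \<Rightarrow> bool" where
  "graph_rel x y \<longleftrightarrow> x - y \<in> free.span relators"

quotient_type (overloaded) 'k graph_space = "lgraph \<Rightarrow>\<^sub>0 ('k::field_char_0)" / graph_rel
  morphisms rep_graph_space abs_graph_space
proof (rule equivpI)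
  show "reflp (graph_rel :: (lgraph \<Rightarrow>\<^sub>0 'k) \<Rightarrow> _)" by (simp add: reflp_def graph_rel_def free.span_zero)
  show "symp (graph_rel :: (lgraph \<Rightarrow>\<^sub>0 'k) \<Rightarrow> _)"
  proof (rule sympI)
    fix x y :: "lgraph \<Rightarrow>\<^sub>0 'k" assume "graph_rel x y"
    then have "- (x - y) \<in> free.span relators" unfolding graph_rel_def by (rule free.span_neg)
    then show "graph_rel y x" by (simp add: graph_rel_def)
  qed
  show "transp (graph_rel :: (lgraph \<Rightarrow>\<^sub>0 'k) \<Rightarrow> _)"
  proof (rule transpI)
    fix x y z :: "lgraph \<Rightarrow>\<^sub>0 'k" assume "graph_rel x y" "graph_rel y z"
    then have "(x - y) + (y - z) \<in> free.span relators"
      unfolding graph_rel_def by (rule free.span_add)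
    then show "graph_rel x z" by (simp add: graph_rel_def)
  qed
qed

lemma graph_rel_add: "graph_rel (a + c) (b + d)" if "graph_rel a b" "graph_rel c d"
proof -
  have "(a - b) + (c - d) \<in> free.span relators"
    using that unfolding graph_rel_def by (rule free.span_add)
  then show ?thesis by (simp add: graph_rel_def algebra_simps)
qed

lemma graph_rel_scale: "graph_rel (fscale c a) (fscale c b)" if "graph_rel a b"
proof -
  have "fscale c (a - b) \<in> free.span relators"
    using that unfolding graph_rel_def by (rule free.span_scale)
  then show ?thesis by (simp add: graph_rel_def free.scale_right_diff_distrib)
qed

lemma graph_rel_minus: "graph_rel (- a) (- b)" if "graph_rel a b"
  using graph_rel_scale[OF that, of "- 1"] by simp

instantiation graph_space :: (field_char_0) ab_group_add
begin

lift_definition zero_graph_space :: "'a graph_space" is 0 .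

lift_definition plus_graph_space :: "'a graph_space \<Rightarrow> 'a graph_space \<Rightarrow> 'a graph_space" is "(+)"
  by (rule graph_rel_add)

lift_definition uminus_graph_space :: "'a graph_space \<Rightarrow> 'a graph_space" is uminus
  by (rule graph_rel_minus)

lift_definition minus_graph_space :: "'a graph_space \<Rightarrow> 'a graph_space \<Rightarrow> 'a graph_space" is "(-)"
  using graph_rel_add[OF _ graph_rel_minus] by fastforce

instance
  by standard (transfer; simp add: graph_rel_def free.span_zero algebra_simps)+

end

lift_definition gscale :: "'k::field_char_0 \<Rightarrow> 'k graph_space \<Rightarrow> 'k graph_space" (infixr "*\<^sub>G" 75)
  is fscale
  by (rule graph_rel_scale)

interpretation graph_space: vector_space "(*\<^sub>G) :: 'k::field_char_0 \<Rightarrow> 'k graph_space \<Rightarrow> 'k graph_space"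
  by unfold_locales
    (transfer; simp add: graph_rel_def free.span_zero
       free.scale_right_distrib free.scale_left_distrib)+

text \<open>The class in \<open>'k graph_space\<close> of a labelled graph; meaningless if \<open>X\<close> is not one.\<close>

definition gclass :: "graph_data \<Rightarrow> 'k::field_char_0 graph_space" where
  "gclass X = abs_graph_space (Poly_Mapping.single (Abs_lgraph X) 1)"

text \<open>Linear extension of a function defined on labelled graphs.\<close>

definition lin_ext :: "(graph_data \<Rightarrow> 'k graph_space) \<Rightarrow> (lgraph \<Rightarrow>\<^sub>0 'k::field_char_0) \<Rightarrow> 'k graph_space" where
  "lin_ext f x = (\<Sum>X\<in>Poly_Mapping.keys x. Poly_Mapping.lookup x X *\<^sub>G f (Rep_lgraph X))"

lemma lin_ext_superset:
  assumes "finite A" "Poly_Mapping.keys x \<subseteq> A"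
  shows "lin_ext f x = (\<Sum>X\<in>A. Poly_Mapping.lookup x X *\<^sub>G f (Rep_lgraph X))"
  unfolding lin_ext_def using assms
  by (intro sum.mono_neutral_left) (auto simp: in_keys_iff)

lemma lin_ext_add: "lin_ext f (x + y) = lin_ext f x + lin_ext f y"
proof -
  let ?A = "Poly_Mapping.keys x \<union> Poly_Mapping.keys y"
  have "Poly_Mapping.keys (x + y) \<subseteq> ?A" by (rule keys_add)
  then have "lin_ext f (x + y) = (\<Sum>X\<in>?A. Poly_Mapping.lookup (x + y) X *\<^sub>G f (Rep_lgraph X))"
    by (intro lin_ext_superset) auto
  also have "\<dots> = (\<Sum>X\<in>?A. Poly_Mapping.lookup x X *\<^sub>G f (Rep_lgraph X))
      + (\<Sum>X\<in>?A. Poly_Mapping.lookup y X *\<^sub>G f (Rep_lgraph X))"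
    by (simp add: lookup_add graph_space.scale_left_distrib sum.distrib)
  finally show ?thesis
    using lin_ext_superset[of ?A x f] lin_ext_superset[of ?A y f] by simp
qed

lemma lin_ext_scale: "lin_ext f (fscale c x) = c *\<^sub>G lin_ext f x"
proof -
  have "Poly_Mapping.keys (fscale c x) \<subseteq> Poly_Mapping.keys x"
    by (auto simp: in_keys_iff)
  then have "lin_ext f (fscale c x)
      = (\<Sum>X\<in>Poly_Mapping.keys x. Poly_Mapping.lookup (fscale c x) X *\<^sub>G f (Rep_lgraph X))"
    by (intro lin_ext_superset) auto
  then show ?thesis by (simp add: lin_ext_def graph_space.scale_sum_right)
qed

lemma lin_ext_diff: "lin_ext f (x - y) = lin_ext f x - lin_ext f y"
  using lin_ext_add[of f "x - y" y] by simp

lemma lin_ext_single: "lin_ext f (Poly_Mapping.single X c) = c *\<^sub>G f (Rep_lgraph X)"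
  by (cases "c = 0") (simp_all add: lin_ext_def)

lemma gclass_Rep: "gclass (Rep_lgraph X) = abs_graph_space (Poly_Mapping.single X 1)"
  by (simp add: gclass_def Rep_lgraph_inverse)

text \<open>A function on labelled graphs that is compatible with isomorphisms and changes sign with the
  orientation has a well-defined linear extension to the space of oriented graphs.\<close>

definition respects_orientation :: "(graph_data \<Rightarrow> 'k::field_char_0 graph_space) \<Rightarrow> bool" where
  "respects_orientation f \<longleftrightarrow>
     (\<forall>X Y. labelled_graph X \<longrightarrow> labelled_graph Y \<longrightarrow> labelled_iso X Y \<longrightarrow> f X = f Y) \<and>
     (\<forall>X h. labelled_graph X \<longrightarrow> h \<in> halves X \<longrightarrow> f (reverse_arrow h X) = - f X) \<and>
     (\<forall>X i j. labelled_graph X \<longrightarrow> i \<in> {1..nv X} \<longrightarrow> j \<in> {1..nv X} \<longrightarrow> i \<noteq> j \<longrightarrow>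
        f (renumber (transpose i j) X) = - f X)"

lemma labelled_graph_Rep: "labelled_graph (Rep_lgraph X)"
  using Rep_lgraph by blast

lemma lin_ext_respects:
  assumes "respects_orientation f" "graph_rel x y"
  shows "lin_ext f x = lin_ext f y"
proof -
  have gen: "lin_ext f z = 0" if "z \<in> relators" for z
  proof -
    from that consider
        X Y where "z = Poly_Mapping.single X 1 - Poly_Mapping.single Y 1"
          "labelled_iso (Rep_lgraph X) (Rep_lgraph Y)"
      | X Y h where "z = Poly_Mapping.single X 1 + Poly_Mapping.single Y 1"
          "h \<in> halves (Rep_lgraph X)" "Rep_lgraph Y = reverse_arrow h (Rep_lgraph X)"
      | X Y i j where "z = Poly_Mapping.single X 1 + Poly_Mapping.single Y 1"
          "i \<in> {1..nv (Rep_lgraph X)}" "j \<in> {1..nv (Rep_lgraph X)}" "i \<noteq> j"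
          "Rep_lgraph Y = renumber (transpose i j) (Rep_lgraph X)"
      unfolding relators_def by blast
    then show ?thesis
    proof cases
      case 1
      then have "f (Rep_lgraph X) = f (Rep_lgraph Y)"
        using assms(1) labelled_graph_Rep unfolding respects_orientation_def by blast
      then show ?thesis using 1 by (simp add: lin_ext_diff lin_ext_single)
    next
      case 2
      then have "f (Rep_lgraph Y) = - f (Rep_lgraph X)"
        using assms(1) labelled_graph_Rep unfolding respects_orientation_def by metis
      then show ?thesis using 2(1) by (simp add: lin_ext_add lin_ext_single)
    next
      case 3
      then have "f (Rep_lgraph Y) = - f (Rep_lgraph X)"
        using assms(1) labelled_graph_Rep unfolding respects_orientation_def by metis
      then show ?thesis using 3(1) by (simp add: lin_ext_add lin_ext_single)
    qed
  qed
  have "x - y \<in> free.span relators" using assms(2) by (simp add: graph_rel_def)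
  then have "lin_ext f (x - y) = 0"
  proof (induction rule: free.span_induct_alt)
    case base
    show ?case by (simp add: lin_ext_def)
  next
    case (step c z w)
    then show ?case by (simp add: lin_ext_add lin_ext_scale gen)
  qed
  then show ?thesis by (simp add: lin_ext_diff)
qed

lemma respects_gclass: "respects_orientation (gclass :: graph_data \<Rightarrow> 'k::field_char_0 graph_space)"
proof -
  have abs: "x - y \<in> free.span relators \<Longrightarrow> abs_graph_space x = abs_graph_space y"
      for x y :: "lgraph \<Rightarrow>\<^sub>0 'k"
    by (simp add: graph_space.abs_eq_iff graph_rel_def)
  have Rep: "Rep_lgraph (Abs_lgraph X) = X" if "labelled_graph X" for X
    using that by (simp add: Abs_lgraph_inverse)
  have neg: "- abs_graph_space x = abs_graph_space (- x)" for x :: "lgraph \<Rightarrow>\<^sub>0 'k"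
    by (simp add: uminus_graph_space.abs_eq)
  have iso: "gclass X = (gclass Y :: 'k graph_space)"
    if "labelled_graph X" "labelled_graph Y" "labelled_iso X Y" for X Y
  proof -
    have "Poly_Mapping.single (Abs_lgraph X) 1 - Poly_Mapping.single (Abs_lgraph Y) (1::'k) \<in> relators"
      unfolding relators_def using that(3)
      by (intro UnI1 CollectI exI[of _ "Abs_lgraph X"] exI[of _ "Abs_lgraph Y"])
        (simp add: Rep that(1,2))
    then show ?thesis unfolding gclass_def by (intro abs free.span_base)
  qed
  have rev: "gclass (reverse_arrow h X) = - (gclass X :: 'k graph_space)"
    if "labelled_graph X" "h \<in> halves X" for X h
  proof -
    have "Poly_Mapping.single (Abs_lgraph X) 1
        + Poly_Mapping.single (Abs_lgraph (reverse_arrow h X)) (1::'k) \<in> relators"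
      unfolding relators_def
      by (intro UnI1 UnI2 CollectI exI[of _ "Abs_lgraph X"] exI[of _ "Abs_lgraph (reverse_arrow h X)"]
          exI[of _ h]) (simp add: Rep that labelled_graph_reverse[OF that])
    then show ?thesis unfolding gclass_def neg
      by (intro abs free.span_base) (simp add: add.commute)
  qed
  have ren: "gclass (renumber (transpose i j) X) = - (gclass X :: 'k graph_space)"
    if "labelled_graph X" "i \<in> {1..nv X}" "j \<in> {1..nv X}" "i \<noteq> j" for X i j
  proof -
    have "Poly_Mapping.single (Abs_lgraph X) 1
        + Poly_Mapping.single (Abs_lgraph (renumber (transpose i j) X)) (1::'k) \<in> relators"
      unfolding relators_def
      using that labelled_graph_renumber[OF that(1) permutes_swap_id[OF that(2,3)]]
      by (intro UnI2 CollectI exI[of _ "Abs_lgraph X"]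
          exI[of _ "Abs_lgraph (renumber (transpose i j) X)"] exI[of _ i] exI[of _ j])
        (simp add: Rep)
    then show ?thesis unfolding gclass_def neg
      by (intro abs free.span_base) (simp add: add.commute)
  qed
  show ?thesis unfolding respects_orientation_def using iso rev ren by blast
qed


text \<open>
  \<open>collapse_class X h\<close> is \<open>X\<^sub>e\<close> for the edge \<open>e\<close> with initial half-edge \<open>h\<close>, and \<open>hk_term X h k\<close> is
  \<open>X\<^sub>h\<^sub>k\<close>.  In \<open>cut_glue X h k\<close> the half-edge \<open>h\<close> is the initial half of the new edge \<open>h \<union> k\<close>.
\<close>

definition collapse_class :: "graph_data \<Rightarrow> nat \<Rightarrow> 'k::field_char_0 graph_space" where
  "collapse_class X h = of_int (collapse_sign X h) *\<^sub>G gclass (collapse X h)"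

definition hk_term :: "graph_data \<Rightarrow> nat \<Rightarrow> nat \<Rightarrow> 'k::field_char_0 graph_space" where
  "hk_term X h k =
     (if vtx X h \<noteq> vtx X k then of_int (arrow_sign X h k) *\<^sub>G collapse_class (cut_glue X h k) h
      else 0)"

text \<open>
  The sum over unordered pairs of half-edges is written as a sum over the pairs with \<open>h < k\<close>; the
  choice of the order is immaterial by \<open>hk_term_commute\<close> below.
\<close>

definition half_edge_pairs :: "graph_data \<Rightarrow> (nat \<times> nat) set" where
  "half_edge_pairs X = {(h, k). h \<in> halves X \<and> k \<in> halves X \<and> h < k \<and> k \<noteq> opp X h}"

definition boundary_gen :: "graph_data \<Rightarrow> 'k::field_char_0 graph_space" where
  "boundary_gen X = (\<Sum>(h, k)\<in>half_edge_pairs X. hk_term X h k)"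

definition mult_gen :: "graph_data \<Rightarrow> graph_data \<Rightarrow> 'k::field_char_0 graph_space" where
  "mult_gen X Y = gclass (disjoint_union X Y)"

subsection \<open>Compatibility with changes of the labelling\<close>

text \<open>
  \<open>f\<close> and \<open>p\<close> form an isomorphism of the underlying graphs of \<open>X\<close> and \<open>Y\<close>; \<open>iso_sign f p X Y\<close>
  tells whether it preserves the orientations.
\<close>

definition graph_iso :: "(nat \<Rightarrow> nat) \<Rightarrow> (nat \<Rightarrow> nat) \<Rightarrow> graph_data \<Rightarrow> graph_data \<Rightarrow> bool" where
  "graph_iso f p X Y \<longleftrightarrow> nv X = nv Y \<and> p permutes {1..nv X} \<and>
     bij_betw f (halves X) (halves Y) \<and>
     (\<forall>h\<in>halves X. vtx Y (f h) = p (vtx X h) \<and> opp Y (f h) = f (opp X h))"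

definition iso_arrow_sign :: "(nat \<Rightarrow> nat) \<Rightarrow> graph_data \<Rightarrow> graph_data \<Rightarrow> int" where
  "iso_arrow_sign f X Y = (\<Prod>h\<in>ini X. if f h \<in> ini Y then 1 else - 1)"

definition iso_sign :: "(nat \<Rightarrow> nat) \<Rightarrow> (nat \<Rightarrow> nat) \<Rightarrow> graph_data \<Rightarrow> graph_data \<Rightarrow> int" where
  "iso_sign f p X Y = sign p * iso_arrow_sign f X Y"

lemma sign_square [simp]: "(of_int (sign p) :: 'k::ring_1) * of_int (sign p) = 1"
  by (metis of_int_1 of_int_mult sign_idempotent)

lemma sign_mult_left [simp]: "(of_int (sign p) :: 'k::comm_ring_1) * (of_int (sign p) * c) = c"
  by (metis mult.assoc mult_1 sign_square)

lemma graph_isoD: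
  assumes "graph_iso f p X Y"
  shows "nv X = nv Y" "p permutes {1..nv X}" "bij_betw f (halves X) (halves Y)"
    "\<And>h. h \<in> halves X \<Longrightarrow> vtx Y (f h) = p (vtx X h)"
    "\<And>h. h \<in> halves X \<Longrightarrow> opp Y (f h) = f (opp X h)"
    "\<And>h. h \<in> halves X \<Longrightarrow> f h \<in> halves Y"
    "\<And>h k. h \<in> halves X \<Longrightarrow> k \<in> halves X \<Longrightarrow> f h = f k \<longleftrightarrow> h = k"
proof -
  show b: "bij_betw f (halves X) (halves Y)"
    using assms by (simp add: graph_iso_def)
  show "nv X = nv Y" "p permutes {1..nv X}"
    "\<And>h. h \<in> halves X \<Longrightarrow> vtx Y (f h) = p (vtx X h)"
    "\<And>h. h \<in> halves X \<Longrightarrow> opp Y (f h) = f (opp X h)"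
    using assms unfolding graph_iso_def by blast+
  show "\<And>h. h \<in> halves X \<Longrightarrow> f h \<in> halves Y"
    using b by (rule bij_betwE[rule_format])
  show "\<And>h k. h \<in> halves X \<Longrightarrow> k \<in> halves X \<Longrightarrow> f h = f k \<longleftrightarrow> h = k"
    using b by (meson bij_betw_def inj_on_eq_iff)
qed

lemma gclass_renumber:
  assumes "labelled_graph X" "p permutes {1..nv X}"
  shows "gclass (renumber p X) = of_int (sign p) *\<^sub>G (gclass X :: 'k::field_char_0 graph_space)"
  using assms(2) finite_atLeastAtMost[of 1 "nv X"]
proof (induction rule: permutes_induct)
  case id
  have "renumber id X = X" by (simp only: renumber_def id_comp) simp
  then show ?case by (simp add: id_def)
next
  case (swap a b p)
  have l: "labelled_graph (renumber p X)" using assms(1) swap.hyps(4) by (rule labelled_graph_renumber)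
  have "renumber (transpose a b \<circ> p) X = renumber (transpose a b) (renumber p X)"
    by (simp add: renumber_def o_assoc)
  moreover have "gclass (renumber (transpose a b) (renumber p X))
      = - (gclass (renumber p X) :: 'k graph_space)"
    using respects_gclass l swap(1-3) unfolding respects_orientation_def
    by (metis (no_types, lifting) graph_data.select_convs(1) graph_data.surjective graph_data.update_convs(3) renumber_def)
  moreover have "sign (transpose a b \<circ> p) = - sign p"
    using swap by (subst sign_compose)
      (auto simp: sign_swap_id permutation_swap_id intro: permutes_imp_permutation[of "{1..nv X}"])
  ultimately show ?case by (simp only: swap.IH) simp
qed

lemma gclass_arrows:
  assumes "labelled_graph X" "labelled_graph Y" "graph_iso f id X Y"
  shows "gclass X = of_int (iso_arrow_sign f X Y) *\<^sub>G (gclass Y :: 'k::field_char_0 graph_space)"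
  using assms
proof (induction "card {h \<in> ini X. f h \<notin> ini Y}" arbitrary: X)
  case 0
  note D = labelled_graphD[OF 0(2)] and E = labelled_graphD[OF 0(3)] and I = graph_isoD[OF 0(4)]
  have fin: "finite (ini X)" using D(1,6) by (rule rev_finite_subset)
  then have all: "f h \<in> ini Y" if "h \<in> ini X" for h using 0(1) that by auto
  have "f h \<in> ini Y \<longleftrightarrow> h \<in> ini X" if h: "h \<in> halves X" for h
    using all[of h] all[of "opp X h"] D(7)[OF h] E(7)[OF I(6)[OF h]] I(5)[OF h] by auto
  then have "labelled_iso X Y"
    unfolding labelled_iso_def using I by (auto intro!: exI[of _ f])
  then have "gclass X = (gclass Y :: 'k graph_space)"
    using respects_gclass 0(2,3) unfolding respects_orientation_def by blast
  moreover have "iso_arrow_sign f X Y = 1"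
    unfolding iso_arrow_sign_def using all by (intro prod.neutral) simp
  ultimately show ?case by simp
next
  case (Suc n)
  note D = labelled_graphD[OF Suc(3)] and E = labelled_graphD[OF Suc(4)] and I = graph_isoD[OF Suc(5)]
  have fin: "finite (ini X)" using D(1,6) by (rule rev_finite_subset)
  obtain h where h: "h \<in> ini X" "f h \<notin> ini Y"
    using Suc(2) by (metis (mono_tags, lifting) card.empty emptyE equals0I mem_Collect_eq nat.distinct(1))
  have hX: "h \<in> halves X" using h D(6) by auto
  have oh: "opp X h \<notin> ini X" "f (opp X h) \<in> ini Y"
    using D(7)[OF hX] h E(7)[OF I(6)[OF hX]] I(5)[OF hX] by auto
  let ?X = "reverse_arrow h X"
  have ini: "ini ?X = insert (opp X h) (ini X - {h})"
    using h(1) oh(1) by (auto simp: reverse_arrow_def)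
  have iso: "graph_iso f id ?X Y"
    using Suc(5) by (simp add: graph_iso_def reverse_arrow_def)
  have "{x \<in> ini ?X. f x \<notin> ini Y} = {x \<in> ini X. f x \<notin> ini Y} - {h}"
    unfolding ini using oh by auto
  then have "card {x \<in> ini ?X. f x \<notin> ini Y} = n"
    using Suc(2) h fin by simp
  then have IH: "gclass ?X = of_int (iso_arrow_sign f ?X Y) *\<^sub>G (gclass Y :: 'k graph_space)"
    using Suc(1)[of ?X] labelled_graph_reverse[OF Suc(3) hX] Suc(4) iso by simp
  have "gclass ?X = - (gclass X :: 'k graph_space)"
    using respects_gclass Suc(3) hX unfolding respects_orientation_def by blast
  moreover have "iso_arrow_sign f ?X Y = - iso_arrow_sign f X Y"
    unfolding iso_arrow_sign_def ini using fin h oh by (simp add: prod.remove[of "ini X" h])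
  ultimately show ?case using IH by (metis graph_space.scale_minus_left minus_equation_iff of_int_minus)
qed

lemma gclass_graph_iso:
  assumes "labelled_graph X" "labelled_graph Y" "graph_iso f p X Y"
  shows "gclass X = of_int (iso_sign f p X Y) *\<^sub>G (gclass Y :: 'k::field_char_0 graph_space)"
proof -
  note I = graph_isoD[OF assms(3)]
  have "graph_iso f id (renumber p X) Y"
    using I by (simp add: graph_iso_def renumber_def permutes_id)
  then have "gclass (renumber p X)
      = of_int (iso_arrow_sign f (renumber p X) Y) *\<^sub>G (gclass Y :: 'k graph_space)"
    using labelled_graph_renumber[OF assms(1) I(2)] assms(2) by (intro gclass_arrows)
  moreover have "iso_arrow_sign f (renumber p X) Y = iso_arrow_sign f X Y"
    by (simp add: iso_arrow_sign_def renumber_def)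
  ultimately have "of_int (sign p) *\<^sub>G (gclass X :: 'k graph_space)
      = of_int (iso_arrow_sign f X Y) *\<^sub>G gclass Y"
    using gclass_renumber[OF assms(1) I(2), where ?'k = 'k] by simp
  then have "of_int (sign p) *\<^sub>G of_int (sign p) *\<^sub>G (gclass X :: 'k graph_space)
      = of_int (sign p) *\<^sub>G of_int (iso_arrow_sign f X Y) *\<^sub>G gclass Y"
    by simp
  then show ?thesis by (simp add: iso_sign_def)
qed

definition merge :: "nat \<Rightarrow> nat" where
  "merge i = (if i \<le> 2 then 1 else i - 1)"

lemma merge_permutes:
  assumes "p permutes {3..n}"
  shows "\<exists>q. q permutes {1..n - 1} \<and> sign q = sign p \<and> (\<forall>i. merge (p i) = q (merge i))"
  using assms finite_atLeastAtMost[of 3 n]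
proof (induction rule: permutes_induct)
  case id
  show ?case by (intro exI[of _ id] conjI allI permutes_id) simp_all
next
  case (swap a b p)
  then obtain q where q: "q permutes {1..n - 1}" "sign q = sign p" "\<And>i. merge (p i) = q (merge i)"
    by blast
  let ?q = "transpose (a - 1) (b - 1) \<circ> q"
  have "?q permutes {1..n - 1}"
    using q(1) swap(1,2) by (intro permutes_compose permutes_swap_id) auto
  moreover have "sign ?q = sign (transpose a b \<circ> p)"
    using swap.hyps q(1,2)
    by (subst (1 2) sign_compose)
      (auto simp: sign_swap_id permutation_swap_id
        intro: permutes_imp_permutation[of "{1..n - 1}"] permutes_imp_permutation[of "{3..n}"])
  moreover have "merge (transpose a b j) = transpose (a - 1) (b - 1) (merge j)" for j
    using swap(1,2) by (auto simp: merge_def transpose_def)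
  then have "merge ((transpose a b \<circ> p) i) = ?q (merge i)" for i using q(3) by simp
  ultimately show ?case by blast
qed

lemma collapse_sel:
  "nv (collapse X h) = nv X - 1"
  "halves (collapse X h) = halves X - {h, opp X h}"
  "vtx (collapse X h) x = merge (to_front (vtx X h) (vtx X (opp X h)) (vtx X x))"
  "opp (collapse X h) = opp X"
  "ini (collapse X h) = ini X - {h}"
  by (simp_all add: collapse_def merge_def Let_def)

lemma collapse_class_iso:
  assumes X: "labelled_graph X" and Y: "labelled_graph Y" and iso: "graph_iso f p X Y"
    and h: "h \<in> ini X" and k: "k \<in> ini Y" "k = f h \<or> k = f (opp X h)"
    and ne: "vtx X h \<noteq> vtx X (opp X h)"
  shows "collapse_class X h
    = of_int (iso_sign f p X Y) *\<^sub>G (collapse_class Y k :: 'k::field_char_0 graph_space)"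
proof -
  note D = labelled_graphD[OF X] and E = labelled_graphD[OF Y] and I = graph_isoD[OF iso]
  have hX: "h \<in> halves X" and kY: "k \<in> halves Y" using h k D(6) E(6) by auto
  note oh = D(3)[OF hX]
  define t where "t = (if k = f h then id else transpose 1 (2::nat))"
  define a where "a = vtx X h"
  define b where "b = vtx X (opp X h)"
  define q where "q = to_front a b"
  define q' where "q' = to_front (vtx Y k) (vtx Y (opp Y k))"
  let ?n = "nv X"
  have ab: "a \<in> {1..?n}" "b \<in> {1..?n}" "a \<noteq> b"
    using D(2)[OF hX] D(2)[OF oh] ne by (auto simp: a_def b_def)
  have fo: "opp Y (f (opp X h)) = f h" using I(5)[OF oh] D(5)[OF hX] by simp
  have foh: "f (opp X h) \<noteq> f h" using I(7)[OF oh hX] D(4)[OF hX] by simp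
  have kv: "vtx Y k = p (if k = f h then a else b)" "vtx Y (opp Y k) = p (if k = f h then b else a)"
    using k(2) foh I(4)[OF hX] I(4)[OF oh] I(5)[OF hX] fo by (auto simp: a_def b_def)
  have pab: "p a \<in> {1..?n}" "p b \<in> {1..?n}" "p a \<noteq> p b"
    using ab permutes_in_image[OF I(2)] permutes_inj[OF I(2)] by (auto dest: injD)
  have q: "q permutes {1..?n}" unfolding q_def by (rule to_front_permutes) (use ab in auto)
  have q': "q' permutes {1..?n}" unfolding q'_def kv
    by (rule to_front_permutes) (use pab in auto)
  have n2: "?n \<ge> 2" using ab by auto
  have t: "t permutes {1..?n}" unfolding t_def using n2
    by (auto intro!: permutes_swap_id permutes_id)
  have qv: "q a = 1" "q b = 2" unfolding q_def using to_front[of a b] ab by auto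
  have qv': "q' (p a) = t 1" "q' (p b) = t 2"
    unfolding q'_def kv using to_front[of "p a" "p b"] to_front[of "p b" "p a"] pab
    by (auto simp: t_def)
  define r where "r = q' \<circ> p \<circ> inv q \<circ> t"
  have r: "r permutes {1..?n}"
    unfolding r_def using q q' t I(2) by (intro permutes_compose permutes_inv)
  have iq: "inv q 1 = a" "inv q 2 = b"
    using qv permutes_inv_eq[OF q] by auto
  have r12: "r 1 = 1" "r 2 = 2"
    unfolding r_def using iq qv' by (auto simp: t_def)
  have "r permutes {3..?n}"
  proof (rule permutes_superset[OF r])
    fix x assume "x \<in> {1..?n} - {3..?n}"
    then have "x = 1 \<or> x = 2" by auto
    then show "r x = x" using r12 by auto
  qed
  then obtain s where s: "s permutes {1..?n - 1}" "sign s = sign r" "\<And>i. merge (r i) = s (merge i)"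
    using merge_permutes by blast
  have perm: "permutation q" "permutation q'" "permutation t" "permutation p" "permutation (inv q)"
    using q q' t I(2) permutes_inv[OF q] by (auto intro: permutes_imp_permutation[OF finite_atLeastAtMost])
  have sr: "sign s = sign q' * sign p * sign q * sign t"
    unfolding s(2) r_def using perm
    by (simp add: sign_compose permutation_compose sign_inverse)
  have tt: "t (t x) = x" "merge (t x) = merge x" for x
    by (auto simp: t_def merge_def transpose_def)
  have mer: "merge (q' (p v)) = s (merge (q v))" for v
  proof -
    have "q' (p v) = r (t (q v))"
      unfolding r_def by (simp add: tt permutes_inverses(2)[OF q])
    then show ?thesis using s(3) tt by simp
  qed
  have kk: "{k, opp Y k} = {f h, f (opp X h)}"
    using k(2) I(5)[OF hX] fo by auto
  have "halves (collapse Y k) = halves Y - f ` {h, opp X h}"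
    using kk by (simp add: collapse_sel)
  moreover have "bij_betw f (halves X - {h, opp X h}) (halves Y - f ` {h, opp X h})"
    using I(3) hX oh by (intro bij_betw_DiffI) (auto simp: bij_betw_def inj_on_def I(7))
  ultimately have "bij_betw f (halves (collapse X h)) (halves (collapse Y k))"
    by (simp add: collapse_sel)
  then have iso': "graph_iso f s (collapse X h) (collapse Y k)"
    unfolding graph_iso_def using s(1) I mer
    by (simp add: collapse_sel q_def q'_def a_def b_def)
  have lab: "labelled_graph (collapse X h)" using X h ne by (rule labelled_graph_collapse)
  have "vtx Y k \<noteq> vtx Y (opp Y k)" using kv pab by auto
  then have lab': "labelled_graph (collapse Y k)" using Y k(1) by (intro labelled_graph_collapse)
  have fh: "f h \<in> ini Y \<longleftrightarrow> k = f h"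
    using k E(7)[OF I(6)[OF hX]] I(5)[OF hX] foh by auto
  have eq: "f x \<in> ini Y - {k} \<longleftrightarrow> f x \<in> ini Y" if "x \<in> ini X - {h}" for x
  proof -
    have x: "x \<in> halves X" "x \<noteq> h" "x \<noteq> opp X h"
      using that D(6) D(7)[OF hX] h by auto
    then have "f x \<noteq> k" using k(2) I(7)[OF x(1) hX] I(7)[OF x(1) oh] by auto
    then show ?thesis by simp
  qed
  have "finite (ini X)" using D(1,6) by (rule rev_finite_subset)
  then have "iso_arrow_sign f X Y
      = (if k = f h then 1 else - 1) * (\<Prod>x\<in>ini X - {h}. if f x \<in> ini Y then 1 else - 1)"
    unfolding iso_arrow_sign_def using h fh by (subst prod.remove[of _ h]) auto
  also have "(\<Prod>x\<in>ini X - {h}. if f x \<in> ini Y then 1 else - 1)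
      = iso_arrow_sign f (collapse X h) (collapse Y k)"
    unfolding iso_arrow_sign_def collapse_sel by (intro prod.cong) (simp_all only: eq)
  finally have as: "iso_arrow_sign f X Y = sign t * iso_arrow_sign f (collapse X h) (collapse Y k)"
    by (simp add: t_def sign_swap_id)
  have tsq: "sign t * (sign t * z) = z" for z by simp
  have "sign q * iso_sign f s (collapse X h) (collapse Y k) = iso_sign f p X Y * sign q'"
    unfolding iso_sign_def as sr by (simp add: ac_simps)
  moreover have "collapse_sign X h = sign q" "collapse_sign Y k = sign q'"
    by (simp_all add: collapse_sign_def q_def q'_def a_def b_def)
  ultimately have "collapse_sign X h * iso_sign f s (collapse X h) (collapse Y k)
      = iso_sign f p X Y * collapse_sign Y k" by simp
  then have "(of_int (collapse_sign X h) :: 'k) * of_int (iso_sign f s (collapse X h) (collapse Y k))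
      = of_int (iso_sign f p X Y) * of_int (collapse_sign Y k)"
    by (metis of_int_mult)
  then show ?thesis
    unfolding collapse_class_def
    by (subst gclass_graph_iso[OF lab lab' iso']) (simp only: graph_space.scale_scale)
qed


lemma ini_disj:
  assumes "labelled_graph X" "h \<in> halves X"
  shows "h \<in> ini X \<and> opp X h \<notin> ini X \<or> h \<notin> ini X \<and> opp X h \<in> ini X"
  using labelled_graphD(7)[OF assms] by blast

lemma cut_glue_sel:
  "nv (cut_glue X h k) = nv X" "halves (cut_glue X h k) = halves X" "vtx (cut_glue X h k) = vtx X"
  "ini (cut_glue X h k) = (ini X - {h, opp X h, k, opp X k}) \<union> {h, opp X k}"
  "opp (cut_glue X h k) = (opp X)(h := k, k := h, opp X h := opp X k, opp X k := opp X h)"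
  by (simp_all add: cut_glue_def)

lemma opp_ne:
  assumes "labelled_graph X" "h \<in> halves X" "k \<in> halves X" "h \<noteq> k" "k \<noteq> opp X h"
  shows "opp X h \<noteq> h" "opp X k \<noteq> k" "opp X h \<noteq> opp X k" "opp X k \<noteq> h"
    "opp X h \<in> halves X" "opp X k \<in> halves X" "opp X (opp X h) = h" "opp X (opp X k) = k"
proof -
  note D = labelled_graphD[OF assms(1)]
  show oo: "opp X (opp X h) = h" "opp X (opp X k) = k" using D(5) assms(2,3) by auto
  show "opp X h \<noteq> h" "opp X k \<noteq> k" using D(4) assms(2,3) by auto
  show "opp X h \<in> halves X" "opp X k \<in> halves X" using D(3) assms(2,3) by auto
  show "opp X h \<noteq> opp X k" using oo assms(4) by metis
  show "opp X k \<noteq> h" using oo(2) assms(5) by metis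
qed

lemma iso_arrow_sign_split:
  assumes X: "labelled_graph X" and Y: "labelled_graph Y" and iso: "graph_iso f p X Y"
    and h: "h \<in> halves X" "k \<in> halves X" "h \<noteq> k" "k \<noteq> opp X h"
  shows "iso_arrow_sign f X Y * arrow_sign Y (f h) (f k) = arrow_sign X h k *
    (\<Prod>x\<in>ini X - {h, opp X h, k, opp X k}. if f x \<in> ini Y then 1 else - 1)"
proof -
  note D = labelled_graphD[OF X] and E = labelled_graphD[OF Y] and I = graph_isoD[OF iso]
  note ne = opp_ne[OF X h]
  define g :: "nat \<Rightarrow> int" where "g x = (if f x \<in> ini Y then 1 else - 1)" for x
  let ?R = "ini X - {h, opp X h, k, opp X k}"
  have fin: "finite (ini X)" using D(1,6) by (rule rev_finite_subset)
  have go: "g (opp X x) = - g x" if "x \<in> halves X" for x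
    using E(7)[OF I(6)[OF that]] I(5)[OF that] by (simp add: g_def)
  have gg: "g x * g x = 1" for x by (simp add: g_def)
  define h' where "h' = (if h \<in> ini X then h else opp X h)"
  define k' where "k' = (if k \<in> ini X then k else opp X k)"
  have "ini X = insert h' (insert k' ?R)"
    using ini_disj[OF X h(1)] ini_disj[OF X h(2)] by (auto simp: h'_def k'_def)
  moreover have "h' \<noteq> k'" "h' \<notin> ?R" "k' \<notin> ?R"
    using ne h(3,4) by (auto simp: h'_def k'_def)
  ultimately have "prod g (ini X) = g h' * (g k' * prod g ?R)"
    using fin by (metis finite_Diff finite_insert insert_iff prod.insert)
  moreover have "g h' = (if h \<in> ini X then 1 else - 1) * g h" "g k' = (if k \<in> ini X then 1 else - 1) * g k"
    using go[OF h(1)] go[OF h(2)] by (auto simp: h'_def k'_def)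
  moreover have "arrow_sign Y (f h) (f k) = - g h * g k"
    by (auto simp: arrow_sign_def g_def)
  moreover have "arrow_sign X h k = - (if h \<in> ini X then 1 else - 1) * (if k \<in> ini X then 1 else - 1)"
    by (auto simp: arrow_sign_def)
  ultimately have "prod g (ini X) * arrow_sign Y (f h) (f k)
      = arrow_sign X h k * prod g ?R * (g h * g h) * (g k * g k)"
    by (simp only: ac_simps mult_minus_left mult_minus_right)
  then show ?thesis by (simp add: gg iso_arrow_sign_def g_def)
qed

lemma cut_glue_iso:
  assumes X: "labelled_graph X" and Y: "labelled_graph Y" and iso: "graph_iso f p X Y"
    and h: "h \<in> halves X" "k \<in> halves X" "h \<noteq> k" "k \<noteq> opp X h"
  shows "graph_iso f p (cut_glue X h k) (cut_glue Y (f h) (f k))"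
    and "iso_arrow_sign f X Y * arrow_sign Y (f h) (f k)
      = arrow_sign X h k * iso_arrow_sign f (cut_glue X h k) (cut_glue Y (f h) (f k))"
proof -
  note D = labelled_graphD[OF X] and E = labelled_graphD[OF Y] and I = graph_isoD[OF iso]
  note ne = opp_ne[OF X h]
  have fo: "opp Y (f h) = f (opp X h)" "opp Y (f k) = f (opp X k)"
    using I(5) h by auto
  have op: "opp (cut_glue Y (f h) (f k)) (f x) = f (opp (cut_glue X h k) x)" if x: "x \<in> halves X" for x
    unfolding cut_glue_sel fo using x h ne I(5)[OF x]
    by (simp add: I(7) fun_upd_def)
  then show "graph_iso f p (cut_glue X h k) (cut_glue Y (f h) (f k))"
    unfolding graph_iso_def using I by (simp add: cut_glue_sel(1-3))
  let ?R = "ini X - {h, opp X h, k, opp X k}"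
  let ?Y = "cut_glue Y (f h) (f k)"
  have fin: "finite ?R" using D(1,6) by (meson finite_Diff rev_finite_subset)
  have mem: "f x \<in> ini ?Y \<longleftrightarrow> f x \<in> ini Y" if "x \<in> ?R" for x
  proof -
    have x: "x \<in> halves X" "x \<noteq> h" "x \<noteq> k" "x \<noteq> opp X h" "x \<noteq> opp X k"
      using that D(6) by auto
    show ?thesis unfolding cut_glue_sel fo using x ne h by (simp add: I(7))
  qed
  have "f h \<in> ini ?Y" "f (opp X k) \<in> ini ?Y" unfolding cut_glue_sel fo by auto
  moreover have "ini (cut_glue X h k) = insert h (insert (opp X k) ?R)"
    unfolding cut_glue_sel by auto
  moreover have "h \<noteq> opp X k" "h \<notin> ?R" "opp X k \<notin> ?R" using ne by auto
  ultimately have "iso_arrow_sign f (cut_glue X h k) ?Y = (\<Prod>x\<in>?R. if f x \<in> ini ?Y then 1 else - 1)"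
    unfolding iso_arrow_sign_def using fin by simp
  also have "\<dots> = (\<Prod>x\<in>?R. if f x \<in> ini Y then 1 else - 1)"
    by (intro prod.cong refl) (simp only: mem)
  finally show "iso_arrow_sign f X Y * arrow_sign Y (f h) (f k)
      = arrow_sign X h k * iso_arrow_sign f (cut_glue X h k) ?Y"
    using iso_arrow_sign_split[OF X Y iso h] by simp
qed

lemma hk_term_iso:
  assumes X: "labelled_graph X" and Y: "labelled_graph Y" and iso: "graph_iso f p X Y"
    and h: "h \<in> halves X" "k \<in> halves X" "h \<noteq> k" "k \<noteq> opp X h"
  shows "hk_term X h k
    = of_int (iso_sign f p X Y) *\<^sub>G (hk_term Y (f h) (f k) :: 'k::field_char_0 graph_space)"
proof -
  note I = graph_isoD[OF iso]
  have v: "vtx Y (f h) = vtx Y (f k) \<longleftrightarrow> vtx X h = vtx X k"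
    using I(4) h(1,2) permutes_inj[OF I(2)] by (auto dest: injD)
  show ?thesis
  proof (cases "vtx X h = vtx X k")
    case True
    then show ?thesis using v by (simp add: hk_term_def)
  next
    case False
    let ?X = "cut_glue X h k" and ?Y = "cut_glue Y (f h) (f k)"
    have fk: "f h \<in> halves Y" "f k \<in> halves Y" "f h \<noteq> f k" "f k \<noteq> opp Y (f h)"
      using I(5,6,7) h opp_ne[OF X h] by auto
    have lX: "labelled_graph ?X" and lY: "labelled_graph ?Y"
      using labelled_graph_cut_glue[OF X h] labelled_graph_cut_glue[OF Y fk] by auto
    have "collapse_class ?X h
        = of_int (iso_sign f p ?X ?Y) *\<^sub>G (collapse_class ?Y (f h) :: 'k graph_space)"
    proof (rule collapse_class_iso[OF lX lY cut_glue_iso(1)[OF X Y iso h]])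
      show "h \<in> ini ?X" "f h \<in> ini ?Y" by (simp_all add: cut_glue_sel)
      show "vtx ?X h \<noteq> vtx ?X (opp ?X h)"
        using False opp_ne[OF X h] h by (simp add: cut_glue_sel)
    qed simp
    moreover have "arrow_sign X h k * iso_sign f p ?X ?Y = iso_sign f p X Y * arrow_sign Y (f h) (f k)"
      using cut_glue_iso(2)[OF X Y iso h] by (simp add: iso_sign_def ac_simps)
    then have "(of_int (arrow_sign X h k) :: 'k) * of_int (iso_sign f p ?X ?Y)
        = of_int (iso_sign f p X Y) * of_int (arrow_sign Y (f h) (f k))"
      by (metis of_int_mult)
    ultimately show ?thesis using False v by (simp add: hk_term_def)
  qed
qed

lemma hk_term_commute:
  assumes X: "labelled_graph X" and h: "h \<in> halves X" "k \<in> halves X" "h \<noteq> k" "k \<noteq> opp X h"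
  shows "hk_term X h k = (hk_term X k h :: 'k::field_char_0 graph_space)"
proof (cases "vtx X h = vtx X k")
  case True
  then show ?thesis by (simp add: hk_term_def)
next
  case False
  note ne = opp_ne[OF X h] and D = labelled_graphD[OF X]
  have h': "k \<in> halves X" "h \<in> halves X" "k \<noteq> h" "h \<noteq> opp X k" using h ne by auto
  let ?X = "cut_glue X h k" and ?Y = "cut_glue X k h"
  have lX: "labelled_graph ?X" and lY: "labelled_graph ?Y"
    using labelled_graph_cut_glue[OF X h] labelled_graph_cut_glue[OF X h'] by auto
  have "opp ?X x = opp ?Y x" for x
    using h ne by (auto simp: cut_glue_sel)
  then have iso: "graph_iso id id ?X ?Y"
    by (simp add: graph_iso_def cut_glue_sel(1-3) permutes_id)
  let ?R = "ini X - {h, opp X h, k, opp X k}"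
  have fin: "finite ?R" using D(1,6) by (meson finite_Diff rev_finite_subset)
  have "h \<notin> ini ?Y" "opp X k \<notin> ini ?Y" using ne h by (auto simp: cut_glue_sel)
  moreover have "ini ?X = insert h (insert (opp X k) ?R)"
    unfolding cut_glue_sel by auto
  moreover have "h \<noteq> opp X k" "h \<notin> ?R" "opp X k \<notin> ?R" using ne by auto
  ultimately have "iso_arrow_sign id ?X ?Y = (\<Prod>x\<in>?R. if x \<in> ini ?Y then 1 else - 1)"
    unfolding iso_arrow_sign_def using fin by simp
  also have "\<dots> = 1" by (intro prod.neutral) (auto simp: cut_glue_sel)
  finally have sgn: "iso_sign id id ?X ?Y = 1" by (simp add: iso_sign_def)
  have "collapse_class ?X h
      = of_int (iso_sign id id ?X ?Y) *\<^sub>G (collapse_class ?Y k :: 'k graph_space)"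
  proof (rule collapse_class_iso[OF lX lY iso])
    show "h \<in> ini ?X" "k \<in> ini ?Y" by (simp_all add: cut_glue_sel)
    show "k = id h \<or> k = id (opp ?X h)" using ne h by (simp add: cut_glue_sel)
    show "vtx ?X h \<noteq> vtx ?X (opp ?X h)"
      using False ne h by (simp add: cut_glue_sel)
  qed
  moreover have "arrow_sign X h k = arrow_sign X k h" by (simp add: arrow_sign_def)
  ultimately show ?thesis using False sgn by (simp add: hk_term_def)
qed

lemma boundary_gen_iso:
  assumes X: "labelled_graph X" and Y: "labelled_graph Y" and iso: "graph_iso f p X Y"
  shows "boundary_gen X
    = of_int (iso_sign f p X Y) *\<^sub>G (boundary_gen Y :: 'k::field_char_0 graph_space)"
proof -
  note D = labelled_graphD[OF X] and I = graph_isoD[OF iso]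
  note E = labelled_graphD[OF Y]
  define g where "g = the_inv_into (halves X) f"
  have gf: "g (f x) = x" if "x \<in> halves X" for x
    unfolding g_def using that I(3) by (simp add: bij_betw_def the_inv_into_f_f)
  have fg: "f (g y) = y" "g y \<in> halves X" if "y \<in> halves Y" for y
  proof -
    have "y \<in> f ` halves X" using that bij_betw_imp_surj_on[OF I(3)] by simp
    then obtain x where "x \<in> halves X" "y = f x" by blast
    then show "f (g y) = y" "g y \<in> halves X" using gf by auto
  qed
  have go: "g (opp Y y) = opp X (g y)" if "y \<in> halves Y" for y
    using I(5)[OF fg(2)[OF that]] fg(1)[OF that] gf[OF D(3)[OF fg(2)[OF that]]] by simp
  define F where "F = (\<lambda>(h, k). if f h < f k then (f h, f k) else (f k, f h))"
  define G where "G = (\<lambda>(h, k). if g h < g k then (g h, g k) else (g k, g h))"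
  have c: "c *\<^sub>G (\<Sum>x\<in>A. u x) = (\<Sum>x\<in>A. c *\<^sub>G u x)" for c and A and u :: "nat \<times> nat \<Rightarrow> 'k graph_space"
    by (rule graph_space.scale_sum_right)
  have pX: "h \<in> halves X" "k \<in> halves X" "h < k" "h \<noteq> k" "k \<noteq> opp X h" "h \<noteq> opp X k"
      if "(h, k) \<in> half_edge_pairs X" for h k
    using that D(5) by (auto simp: half_edge_pairs_def)
  have pY: "h \<in> halves Y" "k \<in> halves Y" "h < k" "h \<noteq> k" "k \<noteq> opp Y h" "h \<noteq> opp Y k"
      if "(h, k) \<in> half_edge_pairs Y" for h k
    using that E(5) by (auto simp: half_edge_pairs_def)
  show ?thesis unfolding boundary_gen_def c
  proof (rule sum.reindex_bij_witness[of _ G F])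
    fix a assume a: "a \<in> half_edge_pairs X"
    then obtain h k where hk: "a = (h, k)" "(h, k) \<in> half_edge_pairs X" by (cases a) auto
    note p = pX[OF hk(2)]
    have fn: "f h \<noteq> f k" "f k \<noteq> opp Y (f h)" "f h \<noteq> opp Y (f k)"
      using p I(5,7) D(3) by auto
    have fk: "f h \<in> halves Y" "f k \<in> halves Y" using p I(6) by auto
    show "F a \<in> half_edge_pairs Y"
      using hk(1) fn fk by (auto simp: F_def half_edge_pairs_def)
    show "G (F a) = a"
      using hk(1) fn p by (auto simp: F_def G_def gf)
    have "hk_term X h k = of_int (iso_sign f p X Y) *\<^sub>G (hk_term Y (f h) (f k) :: 'k graph_space)"
      using p by (intro hk_term_iso[OF X Y iso])
    moreover have "hk_term Y (f h) (f k) = (hk_term Y (f k) (f h) :: 'k graph_space)"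
      using fn fk by (intro hk_term_commute[OF Y])
    ultimately show "of_int (iso_sign f p X Y) *\<^sub>G (case F a of (h, k) \<Rightarrow> hk_term Y h k)
        = ((case a of (h, k) \<Rightarrow> hk_term X h k) :: 'k graph_space)"
      using hk(1) by (simp add: F_def)
  next
    fix b assume b: "b \<in> half_edge_pairs Y"
    then obtain h k where hk: "b = (h, k)" "(h, k) \<in> half_edge_pairs Y" by (cases b) auto
    note p = pY[OF hk(2)]
    have gn: "g h \<noteq> g k" "g k \<noteq> opp X (g h)" "g h \<noteq> opp X (g k)"
      using fg(1)[OF p(1)] fg(1)[OF p(2)] fg(1)[OF E(3)[OF p(1)]] fg(1)[OF E(3)[OF p(2)]]
        go[OF p(1)] go[OF p(2)] p(4-6) by metis+
    have gk: "g h \<in> halves X" "g k \<in> halves X" using p fg(2) by auto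
    show "G b \<in> half_edge_pairs X"
      using hk(1) gn gk by (auto simp: G_def half_edge_pairs_def)
    show "F (G b) = b"
      using hk(1) gn p by (auto simp: F_def G_def fg(1))
  qed
qed

text \<open>Compatibility with isomorphisms of this form covers all generating changes of labelling.\<close>

lemma respects_orientationI:
  fixes F :: "graph_data \<Rightarrow> 'k::field_char_0 graph_space"
  assumes "\<And>X Y f p. labelled_graph X \<Longrightarrow> labelled_graph Y \<Longrightarrow> graph_iso f p X Y \<Longrightarrow>
      p = id \<or> (\<exists>i\<in>{1..nv X}. \<exists>j\<in>{1..nv X}. p = transpose i j) \<Longrightarrow>
      F X = of_int (iso_sign f p X Y) *\<^sub>G F Y"
  shows "respects_orientation F"
proof -
  have iso: "F X = F Y" if "labelled_graph X" "labelled_graph Y" "labelled_iso X Y" for X Y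
  proof -
    obtain f where f: "bij_betw f (halves X) (halves Y)" "nv X = nv Y"
        "\<And>h. h \<in> halves X \<Longrightarrow> vtx Y (f h) = vtx X h \<and> opp Y (f h) = f (opp X h)
          \<and> (f h \<in> ini Y \<longleftrightarrow> h \<in> ini X)"
      using \<open>labelled_iso X Y\<close> unfolding labelled_iso_def by blast
    have "graph_iso f id X Y" using f by (simp add: graph_iso_def permutes_id)
    moreover have "iso_arrow_sign f X Y = 1"
      unfolding iso_arrow_sign_def using f(3) labelled_graphD(6)[OF that(1)]
      by (intro prod.neutral) auto
    ultimately show ?thesis using assms[OF that(1,2), of f id] by (simp add: iso_sign_def)
  qed
  have rev: "F (reverse_arrow h X) = - F X" if X: "labelled_graph X" and h: "h \<in> halves X" for X h
  proof -
    note D = labelled_graphD[OF X]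
    let ?Y = "reverse_arrow h X"
    define h' where "h' = (if h \<in> ini X then h else opp X h)"
    have r: "x \<in> ini ?Y" if "x \<in> ini X - {h'}" for x
      using ini_disj[OF X h] that by (auto simp: h'_def reverse_arrow_def split: if_splits)
    have h': "h' \<in> ini X" "h' \<notin> ini ?Y"
      using ini_disj[OF X h] by (auto simp: h'_def reverse_arrow_def)
    have iso: "graph_iso id id X ?Y" by (simp add: graph_iso_def permutes_id reverse_arrow_def)
    have "finite (ini X)" using D(1,6) by (rule rev_finite_subset)
    then have "iso_arrow_sign id X ?Y = - (\<Prod>x\<in>ini X - {h'}. if x \<in> ini ?Y then 1 else - 1)"
      unfolding iso_arrow_sign_def using h' by (subst prod.remove[of _ h']) auto
    also have "(\<Prod>x\<in>ini X - {h'}. if x \<in> ini ?Y then 1 else - 1) = (1::int)"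
      using r by (intro prod.neutral) auto
    finally have "iso_sign id id X ?Y = - 1" by (simp only: iso_sign_def sign_id mult_1)
    then have "F X = - F ?Y"
      using assms[OF X labelled_graph_reverse[OF X h] iso] by simp
    then show ?thesis by simp
  qed
  have ren: "F (renumber (transpose i j) X) = - F X"
    if X: "labelled_graph X" and i: "i \<in> {1..nv X}" "j \<in> {1..nv X}" "i \<noteq> j" for X i j
  proof -
    let ?Y = "renumber (transpose i j) X"
    have p: "transpose i j permutes {1..nv X}" using i by (intro permutes_swap_id)
    have iso: "graph_iso id (transpose i j) X ?Y"
      using p by (simp add: graph_iso_def renumber_def)
    have "iso_arrow_sign id X ?Y = 1"
      unfolding iso_arrow_sign_def by (intro prod.neutral) (simp add: renumber_def)
    then have "iso_sign id (transpose i j) X ?Y = - 1"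
      using i by (simp add: iso_sign_def sign_swap_id)
    then have "F X = - F ?Y"
      using assms[OF X labelled_graph_renumber[OF X p] iso] i(1,2) by force
    then show ?thesis by simp
  qed
  show ?thesis unfolding respects_orientation_def using iso rev ren by blast
qed

lemma respects_boundary_gen: "respects_orientation boundary_gen"
  by (rule respects_orientationI) (rule boundary_gen_iso)

lemma iso_arrow_sign_union:
  assumes "labelled_graph X" "labelled_graph Y"
    and "\<And>h. h \<in> halves X \<Longrightarrow> F (2 * h) = 2 * f h"
    and "\<And>h. h \<in> halves Y \<Longrightarrow> F (Suc (2 * h)) = Suc (2 * g h)"
  shows "iso_arrow_sign F (disjoint_union X Y) (disjoint_union X' Y')
    = iso_arrow_sign f X X' * iso_arrow_sign g Y Y'"
proof -
  note D = labelled_graphD[OF assms(1)] and E = labelled_graphD[OF assms(2)]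
  have fin: "finite (ini X)" "finite (ini Y)"
    using D(1,6) E(1,6) by (auto intro: rev_finite_subset)
  have "(\<lambda>h. 2 * h) ` ini X \<inter> (\<lambda>h. Suc (2 * h)) ` ini Y = {}" by auto presburger
  then have "iso_arrow_sign F (disjoint_union X Y) (disjoint_union X' Y')
    = (\<Prod>h\<in>(\<lambda>h. 2 * h) ` ini X. if F h \<in> ini (disjoint_union X' Y') then 1 else - 1) *
      (\<Prod>h\<in>(\<lambda>h. Suc (2 * h)) ` ini Y. if F h \<in> ini (disjoint_union X' Y') then 1 else - 1)"
    unfolding iso_arrow_sign_def halves_disjoint_union(2)[of X Y] using fin
    by (intro prod.union_disjoint) auto
  also have "\<dots> = (\<Prod>h\<in>ini X. if F (2 * h) \<in> ini (disjoint_union X' Y') then 1 else - 1) *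
      (\<Prod>h\<in>ini Y. if F (Suc (2 * h)) \<in> ini (disjoint_union X' Y') then 1 else - 1)"
    by (subst (1 2) prod.reindex) (auto simp: inj_on_def)
  also have "\<dots> = iso_arrow_sign f X X' * iso_arrow_sign g Y Y'"
  proof -
    have "F (2 * h) = 2 * f h" if "h \<in> ini X" for h using that assms(3) D(6) by auto
    moreover have "F (Suc (2 * h)) = Suc (2 * g h)" if "h \<in> ini Y" for h using that assms(4) E(6) by auto
    ultimately show ?thesis unfolding iso_arrow_sign_def by (auto intro!: arg_cong2[of _ _ _ _ "(*)"] prod.cong)
  qed
  finally show ?thesis .
qed

lemma graph_iso_union:
  assumes X: "labelled_graph X" "labelled_graph X'" "graph_iso f p X X'"
    and Y: "labelled_graph Y" "labelled_graph Y'" "graph_iso g q Y Y'"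
    and r: "r permutes {1..nv X + nv Y}"
      "\<And>i. i \<in> {1..nv X} \<Longrightarrow> r i = p i"
      "\<And>i. i \<in> {1..nv Y} \<Longrightarrow> r (nv X + i) = nv X + q i"
  shows "graph_iso (\<lambda>h. if even h then 2 * f (h div 2) else Suc (2 * g (h div 2))) r
    (disjoint_union X Y) (disjoint_union X' Y')" (is "graph_iso ?F _ ?U ?U'")
proof -
  note D = labelled_graphD[OF X(1)] and E = labelled_graphD[OF Y(1)]
  note I = graph_isoD[OF X(3)] and J = graph_isoD[OF Y(3)]
  have bij: "bij_betw ?F (halves ?U) (halves ?U')"
  proof (rule bij_betwI')
    fix x y assume xy: "x \<in> halves ?U" "y \<in> halves ?U"
    have par: "2 * a \<noteq> Suc (2 * b)" "Suc (2 * b) \<noteq> 2 * a" for a b :: nat by presburger+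
    from xy show "?F x = ?F y \<longleftrightarrow> x = y"
      by (elim halves_disjoint_unionE) (simp_all add: I(7) J(7) par)
  next
    fix x assume "x \<in> halves ?U"
    then show "?F x \<in> halves ?U'"
      by (cases rule: halves_disjoint_unionE) (simp_all add: I(6) J(6))
  next
    fix y assume "y \<in> halves ?U'"
    then show "\<exists>x\<in>halves ?U. y = ?F x"
    proof (cases rule: halves_disjoint_unionE)
      case (1 a)
      then obtain b where "b \<in> halves X" "a = f b" using bij_betw_imp_surj_on[OF I(3)] by blast
      then show ?thesis using 1 by (intro bexI[of _ "2 * b"]) simp_all
    next
      case (2 a)
      then obtain b where "b \<in> halves Y" "a = g b" using bij_betw_imp_surj_on[OF J(3)] by blast
      then show ?thesis using 2 by (intro bexI[of _ "Suc (2 * b)"]) simp_all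
    qed
  qed
  have "vtx ?U' (?F h) = r (vtx ?U h) \<and> opp ?U' (?F h) = ?F (opp ?U h)" if "h \<in> halves ?U" for h
    using that
  proof (cases rule: halves_disjoint_unionE)
    case (1 a)
    then show ?thesis using D(2)[of a] I(4,5)[of a] r(2) by simp
  next
    case (2 b)
    then show ?thesis using E(2)[of b] J(4,5)[of b] r(3) I(1) by simp
  qed
  then show ?thesis unfolding graph_iso_def using bij r(1) I(1) J(1) by simp
qed

lemma mult_gen_left:
  assumes X: "labelled_graph X" "labelled_graph X'" "graph_iso f p X X'" and Y: "labelled_graph Y"
  shows "mult_gen X Y = of_int (iso_sign f p X X') *\<^sub>G (mult_gen X' Y :: 'k::field_char_0 graph_space)"
proof -
  note I = graph_isoD[OF X(3)]
  let ?F = "\<lambda>h. if even h then 2 * f (h div 2) else Suc (2 * id (h div 2))"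
  have iso: "graph_iso ?F p (disjoint_union X Y) (disjoint_union X' Y)"
  proof (rule graph_iso_union[OF X Y Y])
    show "graph_iso id id Y Y" by (simp add: graph_iso_def permutes_id)
    show "p permutes {1..nv X + nv Y}" using I(2) by (rule permutes_subset) auto
    show "p (nv X + i) = nv X + id i" if "i \<in> {1..nv Y}" for i
      using permutes_not_in[OF I(2), of "nv X + i"] that by simp
  qed simp
  have "iso_arrow_sign ?F (disjoint_union X Y) (disjoint_union X' Y)
      = iso_arrow_sign f X X' * iso_arrow_sign id Y Y"
    by (rule iso_arrow_sign_union[OF X(1) Y]) simp_all
  also have "iso_arrow_sign id Y Y = 1" by (simp add: iso_arrow_sign_def)
  finally have "iso_sign ?F p (disjoint_union X Y) (disjoint_union X' Y) = iso_sign f p X X'"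
    by (simp add: iso_sign_def)
  then show ?thesis unfolding mult_gen_def
    using gclass_graph_iso[OF labelled_graph_union[OF X(1) Y] labelled_graph_union[OF X(2) Y] iso]
    by simp
qed

lemma mult_gen_right:
  assumes X: "labelled_graph X" and Y: "labelled_graph Y" "labelled_graph Y'" "graph_iso f p Y Y'"
    and p: "p = id \<or> (\<exists>i\<in>{1..nv Y}. \<exists>j\<in>{1..nv Y}. p = transpose i j)"
  shows "mult_gen X Y = of_int (iso_sign f p Y Y') *\<^sub>G (mult_gen X Y' :: 'k::field_char_0 graph_space)"
proof -
  obtain r where r: "r permutes {1..nv X + nv Y}" "sign r = sign p"
      "\<And>i. i \<in> {1..nv X} \<Longrightarrow> r i = id i"
      "\<And>i. i \<in> {1..nv Y} \<Longrightarrow> r (nv X + i) = nv X + p i"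
  proof (cases "p = id")
    case True
    then show ?thesis by (intro that[of id] permutes_id) simp_all
  next
    case False
    then obtain i j where ij: "i \<in> {1..nv Y}" "j \<in> {1..nv Y}" "p = transpose i j" using p by blast
    show ?thesis
    proof (rule that[of "transpose (nv X + i) (nv X + j)"])
      show "transpose (nv X + i) (nv X + j) permutes {1..nv X + nv Y}"
        using ij by (intro permutes_swap_id) auto
    qed (use ij in \<open>auto simp: sign_swap_id transpose_def\<close>)
  qed
  let ?F = "\<lambda>h. if even h then 2 * id (h div 2) else Suc (2 * f (h div 2))"
  have iso: "graph_iso ?F r (disjoint_union X Y) (disjoint_union X Y')"
  proof (rule graph_iso_union[OF X X _ Y])
    show "graph_iso id id X X" by (simp add: graph_iso_def permutes_id)
  qed (use r in auto)
  have "iso_arrow_sign ?F (disjoint_union X Y) (disjoint_union X Y')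
      = iso_arrow_sign id X X * iso_arrow_sign f Y Y'"
    by (rule iso_arrow_sign_union[OF X Y(1)]) simp_all
  also have "iso_arrow_sign id X X = 1" by (simp add: iso_arrow_sign_def)
  finally have "iso_sign ?F r (disjoint_union X Y) (disjoint_union X Y') = iso_sign f p Y Y'"
    by (simp add: iso_sign_def r(2))
  then show ?thesis unfolding mult_gen_def
    using gclass_graph_iso[OF labelled_graph_union[OF X Y(1)] labelled_graph_union[OF X Y(2)] iso]
    by simp
qed

lemma lin_ext_cong_scale:
  assumes "\<And>X. labelled_graph X \<Longrightarrow> f X = c *\<^sub>G g X"
  shows "lin_ext f x = c *\<^sub>G lin_ext g x"
  unfolding lin_ext_def graph_space.scale_sum_right
  by (intro sum.cong refl) (simp add: assms labelled_graph_Rep mult.commute)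

lemma respects_mult_gen_right:
  assumes "labelled_graph X"
  shows "respects_orientation (mult_gen X)"
  by (rule respects_orientationI) (rule mult_gen_right[OF assms])

lemma respects_mult_gen_left: "respects_orientation (\<lambda>X. lin_ext (mult_gen X) y)"
  by (rule respects_orientationI, rule lin_ext_cong_scale, rule mult_gen_left)

subsection \<open>The operator and the product\<close>

lift_definition boundary_H :: "'k::field_char_0 graph_space \<Rightarrow> 'k graph_space"
  is "lin_ext boundary_gen"
  by (rule lin_ext_respects[OF respects_boundary_gen])

lift_definition graph_mult ::
  "'k::field_char_0 graph_space \<Rightarrow> 'k graph_space \<Rightarrow> 'k graph_space"
  is "\<lambda>x y. lin_ext (\<lambda>X. lin_ext (mult_gen X) y) x"
proof -
  fix x x' y y' :: "lgraph \<Rightarrow>\<^sub>0 'k"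
  assume "graph_rel x x'" "graph_rel y y'"
  have "lin_ext (\<lambda>X. lin_ext (mult_gen X) y) x = 1 *\<^sub>G lin_ext (\<lambda>X. lin_ext (mult_gen X) y') x"
    using lin_ext_respects[OF respects_mult_gen_right \<open>graph_rel y y'\<close>]
    by (intro lin_ext_cong_scale) simp
  also have "\<dots> = lin_ext (\<lambda>X. lin_ext (mult_gen X) y') x'"
    using lin_ext_respects[OF respects_mult_gen_left \<open>graph_rel x x'\<close>] by simp
  finally show "lin_ext (\<lambda>X. lin_ext (mult_gen X) y) x = lin_ext (\<lambda>X. lin_ext (mult_gen X) y') x'" .
qed

lemma boundary_H_gclass:
  assumes "labelled_graph X"
  shows "boundary_H (gclass X) = boundary_gen X"
  using assms by (simp add: gclass_def boundary_H.abs_eq lin_ext_single Abs_lgraph_inverse)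

lemma graph_mult_gclass:
  assumes "labelled_graph X" "labelled_graph Y"
  shows "graph_mult (gclass X) (gclass Y) = gclass (disjoint_union X Y)"
  using assms by (simp add: gclass_def graph_mult.abs_eq lin_ext_single Abs_lgraph_inverse mult_gen_def)

text \<open>\<open>graph_grade p\<close> is spanned by the graphs \<open>X\<close> with \<open>|X| = p\<close>; the type \<open>bit\<close> is the field with
  two elements.\<close>

definition graph_grade :: "bit \<Rightarrow> 'k::field_char_0 graph_space set" where
  "graph_grade p = graph_space.span {gclass X | X. labelled_graph X \<and> of_nat (nv X) = p}"

section \<open>Batalin-Vilkovisky algebras\<close>

text \<open>The sign \<open>(- 1)\<^sup>p\<close> for \<open>p\<close> in \<open>\<int>/2\<close>.\<close>

definition parity_sign :: "bit \<Rightarrow> 'k::ring_1" where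
  "parity_sign p = (if p = 0 then 1 else - 1)"

locale super_algebra = vector_space scale
  for scale :: "'k::field \<Rightarrow> 'a::ab_group_add \<Rightarrow> 'a" (infixr "*s" 75) +
  fixes mult :: "'a \<Rightarrow> 'a \<Rightarrow> 'a" (infixl "\<cdot>" 70)
    and unit :: 'a
    and grade :: "bit \<Rightarrow> 'a set"
  assumes mult_add_left: "(u + v) \<cdot> w = u \<cdot> w + v \<cdot> w"
    and mult_add_right: "u \<cdot> (v + w) = u \<cdot> v + u \<cdot> w"
    and mult_scale_left: "(c *s u) \<cdot> v = c *s (u \<cdot> v)"
    and mult_scale_right: "u \<cdot> (c *s v) = c *s (u \<cdot> v)"
    and mult_assoc: "(u \<cdot> v) \<cdot> w = u \<cdot> (v \<cdot> w)"
    and unit_left: "unit \<cdot> u = u"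
    and unit_right: "u \<cdot> unit = u"
    and subspace_grade: "subspace (grade p)"
    and grade_disjoint: "grade 0 \<inter> grade 1 = {0}"
    and grade_sum: "\<exists>v\<in>grade 0. \<exists>w\<in>grade 1. u = v + w"
    and unit_grade: "unit \<in> grade 0"
    and mult_grade: "u \<in> grade p \<Longrightarrow> v \<in> grade q \<Longrightarrow> u \<cdot> v \<in> grade (p + q)"

locale graded_commutative_super_algebra = super_algebra +
  assumes mult_commute: "u \<in> grade p \<Longrightarrow> v \<in> grade q \<Longrightarrow> u \<cdot> v = parity_sign (p * q) *s (v \<cdot> u)"

locale BV_algebra = graded_commutative_super_algebra +
  fixes \<Delta> :: "'b \<Rightarrow> 'b"
  assumes Delta_add: "\<Delta> (u + v) = \<Delta> u + \<Delta> v"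
    and Delta_scale: "\<Delta> (c *s u) = c *s \<Delta> u"
    and Delta_odd: "u \<in> grade p \<Longrightarrow> \<Delta> u \<in> grade (p + 1)"
    and Delta_square: "\<Delta> (\<Delta> u) = 0"
    and Delta_second_order: "u \<in> grade p \<Longrightarrow> v \<in> grade q \<Longrightarrow> w \<in> grade r \<Longrightarrow>
      \<Delta> (u \<cdot> v \<cdot> w) =
        \<Delta> (u \<cdot> v) \<cdot> w
        + parity_sign p *s (u \<cdot> \<Delta> (v \<cdot> w))
        + parity_sign ((p - 1) * q) *s (v \<cdot> \<Delta> (u \<cdot> w))
        - \<Delta> u \<cdot> v \<cdot> w
        - parity_sign p *s (u \<cdot> \<Delta> v \<cdot> w)
        - parity_sign (p + q) *s (u \<cdot> v \<cdot> \<Delta> w)"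

end

theory Submission
  imports Defs
begin

text \<open>
  A term of \<open>\<partial>\<^sub>H\<^sup>2 X\<close> is given by two ordered pairs of half-edges \<open>(h, k)\<close> and \<open>(l, m)\<close>, processed
  in this order.  The two orders give the same graph and the arrows agree in sign, but the numberings
  of the vertices differ by an odd change, since the merging of two vertices is an odd operation;
  hence the terms cancel in pairs.  In the product of three graphs a pair of half-edges meets at most
  two factors, so that the second order identity is inclusion-exclusion over the sets of half-edges
  of the factors; its signs come from moving factors past each other.  All sums are taken over
  ordered pairs, which doubles them and is harmless in characteristic 0.
\<close>

section \<open>Merging two pairs of vertices\<close>

text \<open>The second pair of half-edges lives on the graph produced by the first, while a
  cancellation needs a symmetric description of the quadruples \<open>(h, k, l, m)\<close> in terms
  of \<open>X\<close> alone. This is possible because the only pair that newly becomes an edge is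
  that of the complementary halves, and \<open>{l, m} = {opp X h, opp X k}\<close> is symmetric in
  the two pairs. The sign of two successive mergings is awkward to read off \<open>to_front\<close>,
  which depends on the actual numbers. It is replaced by an arbitrary renumbering that moves the two
  end points to 1 and 2; this reduces the sign to five positions of at most four vertices, where it
  is computed. For the second order identity only surgery inside the left factor of a union is
  treated directly, since there the collapse agrees with the numbering without any sign. All other
  positions are brought there by permuting factors, so that every sign of the identity comes from
  block transpositions.\<close>

lemma permutes_prefix_exists:
  fixes xs :: "nat list"
  assumes "distinct xs" "set xs \<subseteq> {1..n}"
  shows "\<exists>q. q permutes {1..n} \<and> (\<forall>i<length xs. q (xs ! i) = Suc i)"
  using assms
proof (induction xs rule: rev_induct)
  case Nil
  show ?case by (intro exI[of _ id] conjI permutes_id) simp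
next
  case (snoc x xs)
  then obtain q where q: "q permutes {1..n}" "\<And>i. i < length xs \<Longrightarrow> q (xs ! i) = Suc i" by auto
  let ?k = "Suc (length xs)"
  \<comment> \<open>Exchanging the value \<open>q x\<close> with the next free number leaves the
    entries of \<open>xs\<close> alone: their values lie below \<open>?k\<close> and differ from
    \<open>q x\<close>.\<close>
  let ?q = "transpose ?k (q x) \<circ> q"
  have len: "?k \<le> n"
    using snoc.prems distinct_card[of "xs @ [x]"] card_mono[of "{1..n}" "set (xs @ [x])"] by simp
  have qx: "q x \<in> {1..n}" using snoc.prems permutes_in_image[OF q(1)] by simp
  have "?q permutes {1..n}" using q(1) len qx by (intro permutes_compose permutes_swap_id) auto
  moreover have "?q ((xs @ [x]) ! i) = Suc i" if "i < length (xs @ [x])" for i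
  proof (cases "i < length xs")
    case True
    then have "xs ! i \<noteq> x" using snoc.prems by (auto simp: in_set_conv_nth)
    then have "q x \<noteq> Suc i" using q(2)[OF True] permutes_inj[OF q(1)] by (metis injD)
    then show ?thesis using True q(2) by (simp add: nth_append)
  next
    case False
    then show ?thesis using that by (simp add: nth_append less_Suc_eq)
  qed
  ultimately show ?case by blast
qed

text \<open>The effect of a collapse on the vertex numbers depends only on the end points
  \<open>a\<close>, \<open>b\<close>. Isolating it turns the orientation of an iterated collapse
  into a statement about numbers, without half-edges.\<close>

definition contract :: "nat \<Rightarrow> nat \<Rightarrow> nat \<Rightarrow> nat" where
  "contract a b i = merge (to_front a b i)"

abbreviation contract_sign :: "nat \<Rightarrow> nat \<Rightarrow> int" where
  "contract_sign a b \<equiv> sign (to_front a b)"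

lemma merge_range:
  assumes "i \<in> {1..n}" "2 \<le> n"
  shows "merge i \<in> {1..n - 1}"
  using assms by (auto simp: merge_def)

lemma contract_range:
  assumes "a \<in> {1..n}" "b \<in> {1..n}" "a \<noteq> b" "i \<in> {1..n}"
  shows "contract a b i \<in> {1..n - 1}"
  unfolding contract_def
  using assms permutes_in_image[OF to_front_permutes[OF assms(1-3)], of i] by (intro merge_range) auto

text \<open>Among positive numbers \<open>merge\<close> identifies only 1 and 2, and these are the
  images of \<open>a\<close> and \<open>b\<close> under the bijection
  \<open>to_front a b\<close>.\<close>

lemma contract_eq_iff:
  assumes "a \<in> {1..n}" "b \<in> {1..n}" "a \<noteq> b" "i \<in> {1..n}" "j \<in> {1..n}"
  shows "contract a b i = contract a b j \<longleftrightarrow> i = j \<or> {i, j} = {a, b}"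
proof -
  let ?q = "to_front a b"
  have inj: "?q x = ?q y \<longleftrightarrow> x = y" for x y
    using permutes_inj[OF to_front_permutes[OF assms(1-3)]] by (auto dest: injD)
  have ab: "?q a = 1" "?q b = 2" using assms to_front[of a b] by auto
  have r: "?q i \<ge> 1" "?q j \<ge> 1"
    using assms permutes_in_image[OF to_front_permutes[OF assms(1-3)]] by auto
  have one: "?q x = Suc 0 \<longleftrightarrow> x = a" "?q x = 2 \<longleftrightarrow> x = b" for x using inj[of x a] inj[of x b] ab by auto
  have "merge (?q i) = merge (?q j) \<longleftrightarrow> ?q i = ?q j \<or> ?q i \<le> 2 \<and> ?q j \<le> 2"
    using r by (auto simp: merge_def)
  also have "\<dots> \<longleftrightarrow> ?q i = ?q j \<or> (?q i = 1 \<and> ?q j = 2) \<or> (?q i = 2 \<and> ?q j = 1)"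
    using r by (auto simp: le_Suc_eq numeral_2_eq_2)
  finally show ?thesis by (auto simp: contract_def inj one doubleton_eq_iff)
qed

text \<open>\<open>to_front a b\<close> is just one renumbering that moves \<open>a\<close>,
  \<open>b\<close> to 1, 2. Two such choices differ by a permutation of \<open>{3..n}\<close>, which
  passes through \<open>merge\<close> with its sign; signs are their own inverses, so the product is
  the sign of the quotient.\<close>

lemma merge_comp_unique:
  assumes q: "q permutes {1..n}" "q a = 1" "q b = 2" and q': "q' permutes {1..n}" "q' a = 1" "q' b = 2"
  shows "\<exists>s. s permutes {1..n - 1} \<and> sign s = sign q' * sign q \<and> (\<forall>i. merge (q' i) = s (merge (q i)))"
proof -
  define r where "r = q' \<circ> inv q"
  have r: "r permutes {1..n}" unfolding r_def using q q' by (intro permutes_compose permutes_inv)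
  have "inv q 1 = a" "inv q 2 = b" using q permutes_inv_eq[OF q(1)] by auto
  then have r12: "r 1 = 1" "r 2 = 2" unfolding r_def using q' by auto
  have "r permutes {3..n}"
  proof (rule permutes_superset[OF r])
    fix x assume "x \<in> {1..n} - {3..n}"
    then have "x = 1 \<or> x = 2" by auto
    then show "r x = x" using r12 by auto
  qed
  then obtain s where s: "s permutes {1..n - 1}" "sign s = sign r" "\<And>i. merge (r i) = s (merge i)"
    using merge_permutes by blast
  have "permutation q" "permutation q'"
    using q(1) q'(1) by (auto intro: permutes_imp_permutation[OF finite_atLeastAtMost])
  then have "sign r = sign q' * sign q" unfolding r_def by (simp add: sign_compose sign_inverse permutation_inverse)
  moreover have "merge (q' i) = s (merge (q i))" for i
    using s(3)[of "q i"] by (simp add: r_def permutes_inverses(2)[OF q(1)])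
  ultimately show ?thesis using s by auto
qed

text \<open>Frees both collapses from \<open>to_front\<close>: the renumberings \<open>q\<close> and
  \<open>t\<close> may be chosen at will, and the four signs record the price. Two orders can then
  be compared in one common numbering.\<close>

lemma contract_twice_normal:
  assumes a: "a \<in> {1..n}" "b \<in> {1..n}" "a \<noteq> b" "c \<in> {1..n}" "d \<in> {1..n}"
    and ne: "contract a b c \<noteq> contract a b d"
    and q: "q permutes {1..n}" "q a = 1" "q b = 2"
    and t: "t permutes {1..n - 1}" "t (merge (q c)) = 1" "t (merge (q d)) = 2"
  shows "\<exists>s. s permutes {1..n - 1 - 1} \<and>
    sign s = contract_sign a b * contract_sign (contract a b c) (contract a b d) * sign q * sign t \<and>
    (\<forall>i. contract (contract a b c) (contract a b d) (contract a b i) = s (merge (t (merge (q i)))))"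
proof -
  let ?c = "contract a b c" and ?d = "contract a b d"
  have ab: "to_front a b permutes {1..n}" "to_front a b a = 1" "to_front a b b = 2"
    using to_front_permutes[OF a(1-3)] to_front[of a b] a by auto
  obtain r where r: "r permutes {1..n - 1}" "sign r = contract_sign a b * sign q"
      "\<And>i. contract a b i = r (merge (q i))"
    using merge_comp_unique[OF q ab] unfolding contract_def by blast
  have cd: "?c \<in> {1..n - 1}" "?d \<in> {1..n - 1}" using a contract_range by auto
  have "to_front ?c ?d permutes {1..n - 1}" using to_front_permutes[OF cd ne] .
  \<comment> \<open>The correction \<open>r\<close> left by the first collapse is absorbed into the
    second one: the composite moves the same two numbers to 1 and 2 as \<open>t\<close> does, so
    uniqueness applies again.\<close>
  then have T: "to_front ?c ?d \<circ> r permutes {1..n - 1}" using r(1) by (intro permutes_compose)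
  have T12: "(to_front ?c ?d \<circ> r) (merge (q c)) = 1" "(to_front ?c ?d \<circ> r) (merge (q d)) = 2"
    using to_front[OF ne] cd r(3) by auto
  obtain s where s: "s permutes {1..n - 1 - 1}" "sign s = sign (to_front ?c ?d \<circ> r) * sign t"
      "\<And>i. merge ((to_front ?c ?d \<circ> r) i) = s (merge (t i))"
    using merge_comp_unique[OF t T T12] by blast
  have "permutation (to_front ?c ?d)" "permutation r"
    using to_front_permutes[OF cd ne] r(1) by (auto intro: permutes_imp_permutation[OF finite_atLeastAtMost])
  then have "sign s = contract_sign a b * contract_sign ?c ?d * sign q * sign t"
    by (simp add: s(2) sign_compose r(2) ac_simps)
  moreover have "contract ?c ?d (contract a b i) = s (merge (t (merge (q i))))" for i
    using s(3)[of "merge (q i)"] r(3)[of i] by (simp add: contract_def[of ?c ?d])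
  ultimately show ?thesis using s(1) by blast
qed

text \<open>These are the pairs that occur in the five positions treated below: as
  \<open>(c, d)\<close>, as its image under \<open>merge\<close>, and as the image of 1, 2 under
  \<open>contract c d\<close>.\<close>

lemma contract_sign_small:
  "contract_sign (Suc 0) 2 = 1" "contract_sign 2 (Suc 0) = - 1" "contract_sign (Suc 0) 3 = - 1"
  "contract_sign 3 (Suc 0) = 1" "contract_sign 2 3 = 1" "contract_sign 3 2 = - 1" "contract_sign 3 4 = 1"
  by (simp_all add: to_front_def sign_compose permutation_swap_id sign_swap_id)

lemma contract_small:
  assumes "i \<ge> 1"
  shows "contract (Suc 0) 2 i = merge i" "contract 2 (Suc 0) i = merge i"
    and "contract (Suc 0) 3 i = (if i = 3 then 1 else if i = 1 then 1 else if i = 2 then 2 else i - 1)"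
    and "contract 3 (Suc 0) i = (if i = 3 then 1 else if i = 1 then 1 else if i = 2 then 2 else i - 1)"
    and "contract 2 3 i = (if i = 3 then 1 else if i = 1 then 2 else if i = 2 then 1 else i - 1)"
    and "contract 3 2 i = (if i = 3 then 1 else if i = 1 then 2 else if i = 2 then 1 else i - 1)"
    and "contract 3 4 i = (if i = 3 \<or> i = 4 then 1 else if i = 1 then 2 else if i = 2 then 3 else i - 1)"
  using assms by (simp_all add: contract_def to_front_def merge_def transpose_def le_Suc_eq numeral_2_eq_2)

text \<open>The vertices have been renumbered such that the first contraction merges 1 and 2, and the
  second one merges \<open>c\<close> and \<open>d\<close>.\<close>

lemma contract_commute_normal:
  assumes "(c, d) \<in> {(3, 4), (1, 3), (2, 3), (3, 1), (3, 2)}" "{c, d} \<subseteq> {1..n}"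
  defines "e \<equiv> contract c d"
  obtains w where "w permutes {1..n - 1 - 1}"
    "sign w * contract_sign c d * contract_sign (e 1) (e 2) * contract_sign (merge c) (merge d) = - 1"
    "\<And>i. i \<ge> 1 \<Longrightarrow> contract (e 1) (e 2) (e i) = w (contract (merge c) (merge d) (merge i))"
    "e 1 \<noteq> e 2"
proof -
  \<comment> \<open>The vertex merged last receives the number 1. For disjoint pairs the two orders
    therefore number the two merged vertices oppositely; if the pairs share a vertex, all three
    vertices become the vertex 1 in either order.\<close>
  let ?w = "if c = 3 \<and> d = 4 then transpose 1 2 else (id :: nat \<Rightarrow> nat)"
  have m: "merge (Suc 0) = 1" "merge 2 = 1" "merge 3 = 2" "merge 4 = 3" by (simp_all add: merge_def)
  consider "c = 3" "d = 4" | "c = 1" "d = 3" | "c = 2" "d = 3" | "c = 3" "d = 1" | "c = 3" "d = 2"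
    using assms(1) by blast
  note cases = this
  show thesis
  proof (rule that[of ?w])
    show "?w permutes {1..n - 1 - 1}"
      using assms(2) by (auto intro: permutes_swap_id simp: permutes_id)
    show "sign ?w * contract_sign c d * contract_sign (e 1) (e 2) * contract_sign (merge c) (merge d) = - 1"
      by (cases rule: cases) (simp_all add: e_def contract_small contract_sign_small m sign_swap_id)
    show "e 1 \<noteq> e 2"
      by (cases rule: cases) (simp_all add: e_def contract_small)
    show "contract (e 1) (e 2) (e i) = ?w (contract (merge c) (merge d) (merge i))" if i: "i \<ge> 1" for i
    proof -
      have "merge i \<ge> 1" using i by (auto simp: merge_def)
      note ms = contract_small[OF this]
      have "i = 1 \<or> i = 2 \<or> i = 3 \<or> i = 4 \<or> i > 4" using i by linarith
      then show ?thesis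
        by (cases rule: cases)
          (elim disjE; simp add: e_def contract_small ms m; simp add: merge_def transpose_def)+
    qed
  qed
qed

text \<open>The sign does not depend on the numbering, so \<open>q\<close> places \<open>a\<close>,
  \<open>b\<close> at 1, 2 and the remaining end points at 3, 4. By \<open>ne\<close> the pairs
  \<open>{a, b}\<close> and \<open>{c, d}\<close> share at most one vertex, which leaves the five
  positions above.\<close>

lemma contract_commute:
  assumes a: "a \<in> {1..n}" "b \<in> {1..n}" "a \<noteq> b" and c: "c \<in> {1..n}" "d \<in> {1..n}" "c \<noteq> d"
    and ne: "contract a b c \<noteq> contract a b d"
  obtains p where "p permutes {1..n - 1 - 1}"
    "sign p * contract_sign a b * contract_sign (contract a b c) (contract a b d)
      * contract_sign c d * contract_sign (contract c d a) (contract c d b) = - 1"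
    "\<And>i. i \<in> {1..n} \<Longrightarrow> contract (contract c d a) (contract c d b) (contract c d i)
      = p (contract (contract a b c) (contract a b d) (contract a b i))"
proof -
  have nab: "{c, d} \<noteq> {a, b}" using ne contract_eq_iff[OF a c(1,2)] by blast
  then have ne': "contract c d a \<noteq> contract c d b" using contract_eq_iff[OF c a(1,2)] a(3) by blast
  obtain q where q: "q permutes {1..n}" "q a = 1" "q b = 2"
      "(q c, q d) \<in> {(3, 4), (1, 3), (2, 3), (3, 1), (3, 2)}"
  proof (cases "c \<in> {a, b}")
    case True
    then have "d \<notin> {a, b}" using c(3) nab by auto
    then obtain q where "q permutes {1..n}" "\<forall>i<length [a, b, d]. q ([a, b, d] ! i) = Suc i"
      using permutes_prefix_exists[of "[a, b, d]" n] a c by auto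
    then show ?thesis using True by (intro that[of q]) (auto simp: All_less_Suc numeral_eq_Suc)
  next
    case False
    show ?thesis
    proof (cases "d \<in> {a, b}")
      case True
      obtain q where "q permutes {1..n}" "\<forall>i<length [a, b, c]. q ([a, b, c] ! i) = Suc i"
        using permutes_prefix_exists[of "[a, b, c]" n] a c False by auto
      then show ?thesis using True by (intro that[of q]) (auto simp: All_less_Suc numeral_eq_Suc)
    next
      case d: False
      obtain q where "q permutes {1..n}" "\<forall>i<length [a, b, c, d]. q ([a, b, c, d] ! i) = Suc i"
        using permutes_prefix_exists[of "[a, b, c, d]" n] a c False d by auto
      then show ?thesis by (intro that[of q]) (auto simp: All_less_Suc numeral_eq_Suc)
    qed
  qed
  have qr: "q i \<in> {1..n}" if "i \<in> {1..n}" for i using that permutes_in_image[OF q(1)] by simp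
  then have qcd: "q c \<in> {1..n}" "q d \<in> {1..n}" "q c \<noteq> q d" using c permutes_inj[OF q(1)] by (auto dest: injD)
  have n2: "2 \<le> n" using a by auto
  define e where "e = contract (q c) (q d)"
  obtain w where w: "w permutes {1..n - 1 - 1}"
    "sign w * contract_sign (q c) (q d) * contract_sign (e 1) (e 2) * contract_sign (merge (q c)) (merge (q d)) = - 1"
    "\<And>i. i \<ge> 1 \<Longrightarrow> contract (e 1) (e 2) (e i) = w (contract (merge (q c)) (merge (q d)) (merge i))"
    "e 1 \<noteq> e 2"
    using contract_commute_normal[OF q(4), of n] qcd unfolding e_def by blast
  define t where "t = to_front (merge (q c)) (merge (q d))"
  have mne: "merge (q c) \<noteq> merge (q d)" using q(4) by (auto simp: merge_def)
  have mr: "merge (q c) \<in> {1..n - 1}" "merge (q d) \<in> {1..n - 1}" using merge_range[OF _ n2] qcd by auto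
  have t: "t permutes {1..n - 1}" "t (merge (q c)) = 1" "t (merge (q d)) = 2"
    unfolding t_def using to_front_permutes[OF mr mne] to_front[OF mne] mr by auto
  obtain s where s: "s permutes {1..n - 1 - 1}"
    "sign s = contract_sign a b * contract_sign (contract a b c) (contract a b d) * sign q * sign t"
    "\<And>i. contract (contract a b c) (contract a b d) (contract a b i) = s (merge (t (merge (q i))))"
    using contract_twice_normal[OF a c(1,2) ne q(1-3) t] by blast
  \<comment> \<open>The order that starts with \<open>c\<close>, \<open>d\<close> is computed on top
    of the same \<open>q\<close>, so that \<open>sign q\<close> enters both orders and
    cancels.\<close>
  define q' where "q' = to_front (q c) (q d) \<circ> q"
  have Q: "to_front (q c) (q d) permutes {1..n}" using to_front_permutes[OF qcd] .
  have q': "q' permutes {1..n}" "q' c = 1" "q' d = 2"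
    unfolding q'_def using q(1) Q to_front[OF qcd(3)] qcd by (auto intro: permutes_compose)
  have mq': "merge (q' i) = e (q i)" for i by (simp add: q'_def e_def contract_def)
  have er: "e 1 \<in> {1..n - 1}" "e 2 \<in> {1..n - 1}" unfolding e_def using contract_range[OF qcd] n2 by auto
  define t' where "t' = to_front (e 1) (e 2)"
  have t': "t' permutes {1..n - 1}" "t' (merge (q' a)) = 1" "t' (merge (q' b)) = 2"
    unfolding t'_def mq' q(2,3) using to_front_permutes[OF er w(4)] to_front[OF w(4)] er by auto
  obtain s' where s': "s' permutes {1..n - 1 - 1}"
    "sign s' = contract_sign c d * contract_sign (contract c d a) (contract c d b) * sign q' * sign t'"
    "\<And>i. contract (contract c d a) (contract c d b) (contract c d i) = s' (merge (t' (merge (q' i))))"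
    using contract_twice_normal[OF c a(1,2) ne' q' t'] by blast
  have perm: "permutation s" "permutation s'" "permutation w" "permutation q" "permutation (to_front (q c) (q d))"
    using s(1) s'(1) w(1) q(1) Q by (auto intro: permutes_imp_permutation[OF finite_atLeastAtMost])
  \<comment> \<open>From the result of one order to the normal position by \<open>inv s\<close>,
    across by \<open>w\<close>, and on to the result of the other order by
    \<open>s'\<close>.\<close>
  define p where "p = s' \<circ> w \<circ> inv s"
  show ?thesis
  proof (rule that[of p])
    show "p permutes {1..n - 1 - 1}"
      unfolding p_def using s(1) s'(1) w(1) by (intro permutes_compose permutes_inv)
    have "sign q' = contract_sign (q c) (q d) * sign q" unfolding q'_def using perm by (simp add: sign_compose)
    moreover have "sign p = sign s' * sign w * sign s"
      unfolding p_def using perm by (simp add: sign_compose permutation_compose sign_inverse permutation_inverse)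
    moreover have sq: "sign x * (sign x * z) = z" for x :: "nat \<Rightarrow> nat" and z by simp
    ultimately show "sign p * contract_sign a b * contract_sign (contract a b c) (contract a b d)
        * contract_sign c d * contract_sign (contract c d a) (contract c d b) = - 1"
      using w(2) unfolding s(2) s'(2) t_def t'_def by (simp add: ac_simps sq)
    show "contract (contract c d a) (contract c d b) (contract c d i)
        = p (contract (contract a b c) (contract a b d) (contract a b i))" if i: "i \<in> {1..n}" for i
    proof -
      have "q i \<ge> 1" using qr[OF i] by simp
      then have "merge (t' (merge (q' i))) = w (merge (t (merge (q i))))"
        using w(3)[of "q i"] unfolding mq' t_def t'_def contract_def[of "e 1"] contract_def[of "merge (q c)"] by simp
      then show ?thesis unfolding p_def s(3) s'(3) by (simp add: permutes_inverses(2)[OF s(1)])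
    qed
  qed
qed

section \<open>The square of the operator\<close>

definition hk_graph :: "graph_data \<Rightarrow> nat \<Rightarrow> nat \<Rightarrow> graph_data" where
  "hk_graph X h k = collapse (cut_glue X h k) h"

text \<open>After the regluing the collapsed edge joins \<open>vtx X h\<close> to
  \<open>vtx X k\<close>, so the sign of the collapse can be stated in \<open>X\<close>. Arrows and
  numbering are kept as separate factors because they are compared separately.\<close>

definition hk_sign :: "graph_data \<Rightarrow> nat \<Rightarrow> nat \<Rightarrow> int" where
  "hk_sign X h k = arrow_sign X h k * contract_sign (vtx X h) (vtx X k)"

lemma
  assumes "h \<noteq> k" "opp X h \<noteq> h" "opp X k \<noteq> h"
  shows hk_graph_sel: "nv (hk_graph X h k) = nv X - 1"
    "halves (hk_graph X h k) = halves X - {h, k}"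
    "vtx (hk_graph X h k) x = contract (vtx X h) (vtx X k) (vtx X x)"
    "opp (hk_graph X h k) = (opp X)(h := k, k := h, opp X h := opp X k, opp X k := opp X h)"
    "ini (hk_graph X h k) = (ini X - {h, opp X h, k, opp X k}) \<union> ({opp X k} - {h})"
    and hk_term_eq: "hk_term X h k =
      (if vtx X h \<noteq> vtx X k then of_int (hk_sign X h k) *\<^sub>G gclass (hk_graph X h k) else 0 :: 'k::field_char_0 graph_space)"
  using assms by (auto simp: hk_graph_def hk_term_def hk_sign_def collapse_sel cut_glue_sel
      contract_def collapse_class_def collapse_sign_def)

lemma labelled_graph_hk:
  assumes X: "labelled_graph X" and h: "h \<in> halves X" "k \<in> halves X" "k \<noteq> opp X h"
    and ne: "vtx X h \<noteq> vtx X k"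
  shows "labelled_graph (hk_graph X h k)"
proof -
  have hk: "h \<noteq> k" using ne by blast
  show ?thesis unfolding hk_graph_def
    using labelled_graph_cut_glue[OF X h(1,2) hk h(3)] opp_ne[OF X h(1,2) hk h(3)] ne
    by (intro labelled_graph_collapse) (auto simp: cut_glue_sel)
qed

text \<open>Comparing arrows becomes finding the half-edges that are initial in the first graph
  only; in the application below there is at most one.\<close>

lemma iso_arrow_sign_id:
  assumes "finite (ini X)"
  shows "iso_arrow_sign id X Y = (- 1) ^ card (ini X - ini Y)"
proof -
  have "iso_arrow_sign id X Y = (\<Prod>x\<in>ini X - ini Y. - 1) * (\<Prod>x\<in>ini X \<inter> ini Y. 1)"
    unfolding iso_arrow_sign_def
    using assms by (subst prod.Int_Diff[of _ _ "ini Y"]) (auto intro!: arg_cong2[of _ _ _ _ "(*)"] prod.cong)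
  then show ?thesis by simp
qed

text \<open>The second pair may use a half-edge just reglued by the first: if
  \<open>l = opp X h\<close>, the edge formed by \<open>opp X h\<close> and \<open>opp X k\<close>
  is cut again. Both orders then join \<open>opp X k\<close> to \<open>opp X m\<close>, possibly
  with opposite arrows, and the arrow signs compensate. If \<open>{l, m}\<close> were
  \<open>{opp X h, opp X k}\<close>, the second pair would form an edge after the first
  step.\<close>

lemma hk_swap_arrows:
  assumes X: "labelled_graph X" and H: "{h, k, l, m} \<subseteq> halves X" "distinct [h, k, l, m]"
    and ne: "k \<noteq> opp X h" "m \<noteq> opp X l" "{l, m} \<noteq> {opp X h, opp X k}"
  defines "Y \<equiv> hk_graph X h k" and "Z \<equiv> hk_graph X l m"
  shows "m \<noteq> opp Y l"
    and "x \<in> halves X - {h, k, l, m} \<Longrightarrow> opp (hk_graph Y l m) x = opp (hk_graph Z h k) x"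
    and "iso_arrow_sign id (hk_graph Y l m) (hk_graph Z h k) * arrow_sign X h k * arrow_sign Y l m
      = arrow_sign X l m * arrow_sign Z h k"
proof -
  note D = labelled_graphD[OF X]
  have hs: "h \<in> halves X" "k \<in> halves X" "l \<in> halves X" "m \<in> halves X" using H by auto
  have o: "opp X h \<noteq> h" "opp X k \<noteq> k" "opp X l \<noteq> l" "opp X m \<noteq> m"
    "opp X (opp X h) = h" "opp X (opp X k) = k" "opp X (opp X l) = l" "opp X (opp X m) = m"
    "opp X k \<noteq> h" "opp X m \<noteq> l"
    using D(4,5) hs ne by auto
  have i: "opp X h \<in> ini X \<longleftrightarrow> h \<notin> ini X" "opp X k \<in> ini X \<longleftrightarrow> k \<notin> ini X"
    "opp X l \<in> ini X \<longleftrightarrow> l \<notin> ini X" "opp X m \<in> ini X \<longleftrightarrow> m \<notin> ini X"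
    using D(7) hs by auto
  have d: "h \<noteq> k" "h \<noteq> l" "h \<noteq> m" "k \<noteq> l" "k \<noteq> m" "l \<noteq> m" using H(2) by auto
  have oinj: "opp X x = opp X y \<longleftrightarrow> x = y" if "x \<in> halves X" "y \<in> halves X" for x y
    using D(5) that by metis
  have on: "opp X h \<noteq> opp X k" "opp X h \<noteq> opp X l" "opp X h \<noteq> opp X m" "opp X k \<noteq> opp X l"
    "opp X k \<noteq> opp X m" "opp X l \<noteq> opp X m"
    using d by (simp_all add: oinj hs)
  note Ysel = hk_graph_sel[of h k X, OF d(1) o(1,9), folded Y_def]
  note Zsel = hk_graph_sel[of l m X, OF d(6) o(3,10), folded Z_def]
  show mY: "m \<noteq> opp Y l"
    using ne d on o by (auto simp: Ysel fun_upd_def)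
  have oY: "opp Y l \<noteq> l" "opp Y m \<noteq> l" and oZ: "opp Z h \<noteq> h" "opp Z k \<noteq> h"
    using ne d on o by (auto simp: Ysel Zsel fun_upd_def)
  note Asel = hk_graph_sel[of l m Y, OF d(6) oY]
  note Bsel = hk_graph_sel[of h k Z, OF d(1) oZ]
  have fin: "finite (ini (hk_graph Y l m))"
    using D(1) rev_finite_subset[OF D(1,6)] by (simp add: Asel Ysel)
  \<comment> \<open>At most one of \<open>l\<close>, \<open>m\<close> lies on the edge formed by
    \<open>opp X h\<close> and \<open>opp X k\<close>.\<close>
  consider "{l, m} \<inter> {opp X h, opp X k} = {}" | "l = opp X h" "m \<noteq> opp X k" | "l = opp X k" "m \<noteq> opp X h"
    | "m = opp X h" "l \<noteq> opp X k" | "m = opp X k" "l \<noteq> opp X h"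
    by (cases "l = opp X h"; cases "l = opp X k"; cases "m = opp X h"; cases "m = opp X k")
      (use ne(3) on d in auto)
  note cases = this
  have oc: "opp X y = z \<longleftrightarrow> y = opp X z" if "y \<in> halves X" "z \<in> halves X" for y z
    using that D(5) by metis
  show "opp (hk_graph Y l m) x = opp (hk_graph Z h k) x" if x: "x \<in> halves X - {h, k, l, m}"
  proof (cases rule: cases)
    case 1
    then have "l \<noteq> opp X h" "l \<noteq> opp X k" "m \<noteq> opp X h" "m \<noteq> opp X k" by auto
    moreover from this have "opp X l \<noteq> h" "opp X l \<noteq> k" "opp X m \<noteq> h" "opp X m \<noteq> k"
      using oc hs by auto
    ultimately show ?thesis using x d on o ne
      unfolding Asel(4) Bsel(4) Ysel(4) Zsel(4) by (simp add: fun_upd_def)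
  next
    case 2
    then have "opp X m \<noteq> h" "opp X m \<noteq> k" using oc hs d by auto
    with 2 x d on o ne show ?thesis
      unfolding Asel(4) Bsel(4) Ysel(4) Zsel(4) by (simp add: fun_upd_def)
  next
    case 3
    then have "opp X m \<noteq> h" "opp X m \<noteq> k" using oc hs d by auto
    with 3 x d on o ne show ?thesis
      unfolding Asel(4) Bsel(4) Ysel(4) Zsel(4) by (simp add: fun_upd_def)
  next
    case 4
    then have "opp X l \<noteq> h" "opp X l \<noteq> k" using oc hs d by auto
    with 4 x d on o ne show ?thesis
      unfolding Asel(4) Bsel(4) Ysel(4) Zsel(4) by (simp add: fun_upd_def)
  next
    case 5
    then have "opp X l \<noteq> h" "opp X l \<noteq> k" using oc hs d by auto
    with 5 x d on o ne show ?thesis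
      unfolding Asel(4) Bsel(4) Ysel(4) Zsel(4) by (simp add: fun_upd_def)
  qed
  show "iso_arrow_sign id (hk_graph Y l m) (hk_graph Z h k) * arrow_sign X h k * arrow_sign Y l m
      = arrow_sign X l m * arrow_sign Z h k"
  proof (cases rule: cases)
    case 1
    then have n: "l \<noteq> opp X h" "l \<noteq> opp X k" "m \<noteq> opp X h" "m \<noteq> opp X k" by auto
    moreover from n have "opp X l \<noteq> h" "opp X l \<noteq> k" "opp X m \<noteq> h" "opp X m \<noteq> k"
      using oc hs by auto
    ultimately have e: "ini (hk_graph Y l m) - ini (hk_graph Z h k) = {}"
      using d on o unfolding Asel(5) Bsel(5) Ysel(4,5) Zsel(4,5) by (auto simp: fun_upd_def)
    have "opp X l \<noteq> h" "opp X l \<noteq> k" "opp X m \<noteq> h" "opp X m \<noteq> k" using n oc hs by auto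
    then show ?thesis unfolding iso_arrow_sign_id[OF fin] e arrow_sign_def Ysel(5) Zsel(5)
      using n d on o by simp
  next
    case 2
    then have n: "opp X m \<noteq> h" "opp X m \<noteq> k" using oc hs d by auto
    \<comment> \<open>The edge of \<open>opp X k\<close> and \<open>opp X m\<close> starts at
      \<open>opp X m\<close> in one order and at \<open>opp X k\<close> in the other. This reversal
      is balanced by \<open>h\<close> and \<open>l\<close> having opposite arrows in
      \<open>X\<close>.\<close>
    have e: "ini (hk_graph Y l m) - ini (hk_graph Z h k) = {opp X m}"
      using 2 n d on o unfolding Asel(5) Bsel(5) Ysel(4,5) Zsel(4,5) by (auto simp: fun_upd_def)
    show ?thesis unfolding iso_arrow_sign_id[OF fin] e arrow_sign_def Ysel(5) Zsel(5)
      using 2 n d on o i by simp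
  next
    case 3
    then have n: "opp X m \<noteq> h" "opp X m \<noteq> k" using oc hs d by auto
    have e: "ini (hk_graph Y l m) - ini (hk_graph Z h k) = {}"
      using 3 n d on o unfolding Asel(5) Bsel(5) Ysel(4,5) Zsel(4,5) by (auto simp: fun_upd_def)
    show ?thesis unfolding iso_arrow_sign_id[OF fin] e arrow_sign_def Ysel(5) Zsel(5)
      using 3 n d on o i by simp
  next
    case 4
    then have n: "opp X l \<noteq> h" "opp X l \<noteq> k" using oc hs d by auto
    have e: "ini (hk_graph Y l m) - ini (hk_graph Z h k) = {}"
      using 4 n d on o unfolding Asel(5) Bsel(5) Ysel(4,5) Zsel(4,5) by (auto simp: fun_upd_def)
    show ?thesis unfolding iso_arrow_sign_id[OF fin] e arrow_sign_def Ysel(5) Zsel(5)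
      using 4 n d on o i by simp
  next
    case 5
    then have n: "opp X l \<noteq> h" "opp X l \<noteq> k" using oc hs d by auto
    have e: "ini (hk_graph Y l m) - ini (hk_graph Z h k) = {opp X h}"
      using 5 n d on o unfolding Asel(5) Bsel(5) Ysel(4,5) Zsel(4,5) by (auto simp: fun_upd_def)
    show ?thesis unfolding iso_arrow_sign_id[OF fin] e arrow_sign_def Ysel(5) Zsel(5)
      using 5 n d on o i by simp
  qed
qed

text \<open>Both orders leave the same half-edges with the same \<open>opp\<close>, so the identity
  on half-edges together with the permutation from \<open>contract_commute\<close> compares them;
  that permutation is the source of the minus sign.\<close>

lemma hk_term_swap:
  assumes X: "labelled_graph X" and H: "{h, k, l, m} \<subseteq> halves X" "distinct [h, k, l, m]"
    and ne: "k \<noteq> opp X h" "m \<noteq> opp X l" "{l, m} \<noteq> {opp X h, opp X k}"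
    and v: "vtx X h \<noteq> vtx X k" "vtx X l \<noteq> vtx X m"
  shows "of_int (hk_sign X h k) *\<^sub>G hk_term (hk_graph X h k) l m
    = - (of_int (hk_sign X l m) *\<^sub>G (hk_term (hk_graph X l m) h k :: 'k::field_char_0 graph_space))"
proof -
  note D = labelled_graphD[OF X]
  have hs: "h \<in> halves X" "k \<in> halves X" "l \<in> halves X" "m \<in> halves X" using H by auto
  have d: "h \<noteq> k" "h \<noteq> l" "h \<noteq> m" "k \<noteq> l" "k \<noteq> m" "l \<noteq> m" using H(2) by auto
  define Y where "Y = hk_graph X h k"
  define Z where "Z = hk_graph X l m"
  have H': "{l, m, h, k} \<subseteq> halves X" "distinct [l, m, h, k]" using H by auto
  have ne': "{h, k} \<noteq> {opp X l, opp X m}"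
  proof
    assume "{h, k} = {opp X l, opp X m}"
    then have "opp X ` {h, k} = opp X ` {opp X l, opp X m}" by simp
    then show False using ne(3) D(5)[OF hs(3)] D(5)[OF hs(4)] by simp
  qed
  note sX = hk_swap_arrows[OF X H ne, folded Y_def Z_def]
  note sX' = hk_swap_arrows[OF X H' ne(2,1) ne', folded Y_def Z_def]
  have LY: "labelled_graph Y" and LZ: "labelled_graph Z"
    unfolding Y_def Z_def using X hs ne v by (auto intro!: labelled_graph_hk)
  note oX = opp_ne[OF X hs(1,2) d(1) ne(1)] and oX' = opp_ne[OF X hs(3,4) d(6) ne(2)]
  note Ysel = hk_graph_sel[OF d(1) oX(1,4), folded Y_def] and Zsel = hk_graph_sel[OF d(6) oX'(1,4), folded Z_def]
  have inY: "l \<in> halves Y" "m \<in> halves Y" and inZ: "h \<in> halves Z" "k \<in> halves Z"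
    using hs d by (auto simp: Ysel Zsel)
  note oY = opp_ne[OF LY inY d(6) sX(1)] and oZ = opp_ne[OF LZ inZ d(1) sX'(1)]
  let ?A = "hk_graph Y l m" and ?B = "hk_graph Z h k"
  note Asel = hk_graph_sel[OF d(6) oY(1,4)] and Bsel = hk_graph_sel[OF d(1) oZ(1,4)]
  have vr: "vtx X h \<in> {1..nv X}" "vtx X k \<in> {1..nv X}" "vtx X l \<in> {1..nv X}" "vtx X m \<in> {1..nv X}"
    using D(2) hs by auto
  have tY: "hk_term Y l m = (if vtx Y l \<noteq> vtx Y m then of_int (hk_sign Y l m) *\<^sub>G gclass ?A else 0 :: 'k graph_space)"
    and tZ: "hk_term Z h k = (if vtx Z h \<noteq> vtx Z k then of_int (hk_sign Z h k) *\<^sub>G gclass ?B else 0 :: 'k graph_space)"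
    using hk_term_eq[OF d(6) oY(1,4)] hk_term_eq[OF d(1) oZ(1,4)] by auto
  \<comment> \<open>Both sides say that \<open>h\<close>, \<open>k\<close> and \<open>l\<close>,
    \<open>m\<close> sit at the same two vertices of \<open>X\<close>: whichever pair is collapsed
    first, the other one then has a single vertex.\<close>
  have same: "vtx Y l = vtx Y m \<longleftrightarrow> vtx Z h = vtx Z k"
    unfolding Ysel Zsel contract_eq_iff[OF vr(1,2) v(1) vr(3,4)] contract_eq_iff[OF vr(3,4) v(2) vr(1,2)]
    using v by auto
  show ?thesis
  proof (cases "vtx Y l = vtx Y m")
    case True
    then show ?thesis using tY tZ same by (simp add: Y_def Z_def)
  next
    case False
    obtain p where p: "p permutes {1..nv X - 1 - 1}"
      "sign p * contract_sign (vtx X h) (vtx X k) * contract_sign (vtx Y l) (vtx Y m)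
        * contract_sign (vtx X l) (vtx X m) * contract_sign (vtx Z h) (vtx Z k) = - 1"
      "\<And>i. i \<in> {1..nv X} \<Longrightarrow> contract (vtx Z h) (vtx Z k) (contract (vtx X l) (vtx X m) i)
        = p (contract (vtx Y l) (vtx Y m) (contract (vtx X h) (vtx X k) i))"
      using contract_commute[OF vr(1,2) v(1) vr(3,4) v(2)] False unfolding Ysel Zsel by blast
    have LA: "labelled_graph ?A" and LB: "labelled_graph ?B"
      using LY LZ inY inZ sX(1) sX'(1) False same by (auto intro!: labelled_graph_hk)
    have hA: "halves ?A = halves X - {h, k, l, m}" "halves ?B = halves X - {h, k, l, m}"
      by (auto simp: Asel(2) Bsel(2) Ysel(2) Zsel(2))
    have iso: "graph_iso id p ?A ?B"
      unfolding graph_iso_def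
    proof (intro conjI ballI)
      show "nv ?A = nv ?B" by (simp add: Asel Bsel Ysel Zsel)
      show "p permutes {1..nv ?A}" using p(1) by (simp add: Asel(1) Ysel(1))
      show "bij_betw id (halves ?A) (halves ?B)" unfolding hA by simp
      fix x assume x: "x \<in> halves ?A"
      then show "opp ?B (id x) = id (opp ?A x)" using sX(2)[of x] unfolding hA by simp
      have "vtx X x \<in> {1..nv X}" using x D(2) unfolding hA by auto
      from p(3)[OF this] show "vtx ?B (id x) = p (vtx ?A x)"
        by (simp add: Asel(3) Bsel(3) Ysel(3)[of x] Zsel(3)[of x])
    qed
    have "gclass ?A = of_int (iso_sign id p ?A ?B) *\<^sub>G (gclass ?B :: 'k graph_space)"
      by (rule gclass_graph_iso[OF LA LB iso])
    moreover have "hk_sign X h k * (hk_sign Y l m * iso_sign id p ?A ?B) = - (hk_sign X l m * hk_sign Z h k)"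
    proof -
      define c where "c = contract_sign (vtx X h) (vtx X k) * contract_sign (vtx Y l) (vtx Y m)"
      define e where "e = contract_sign (vtx X l) (vtx X m) * contract_sign (vtx Z h) (vtx Z k)"
      have "(sign p * c) * e = - 1" using p(2) by (simp add: c_def e_def ac_simps)
      moreover have "e * e = 1" unfolding e_def by (simp add: sign_def)
      ultimately have ce: "sign p * c = - e" by (metis mult.assoc mult.right_neutral mult_minus1)
      have "hk_sign X h k * (hk_sign Y l m * iso_sign id p ?A ?B)
          = (iso_arrow_sign id ?A ?B * arrow_sign X h k * arrow_sign Y l m) * (sign p * c)"
        by (simp add: hk_sign_def iso_sign_def c_def ac_simps)
      also have "\<dots> = - (hk_sign X l m * hk_sign Z h k)"
        unfolding sX(3) ce by (simp add: hk_sign_def e_def ac_simps)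
      finally show ?thesis .
    qed
    then have "(of_int (hk_sign X h k) * (of_int (hk_sign Y l m) * of_int (iso_sign id p ?A ?B)) :: 'k)
        = - (of_int (hk_sign X l m) * of_int (hk_sign Z h k))"
      by (metis of_int_minus of_int_mult)
    ultimately show ?thesis using False same tY tZ by (simp add: Y_def[symmetric] Z_def[symmetric])
  qed
qed

section \<open>The operator as a sum over ordered pairs\<close>

lemma boundary_H_add: "boundary_H (u + v) = boundary_H u + boundary_H v"
  by transfer (simp add: lin_ext_add)

lemma boundary_H_scale: "boundary_H (c *\<^sub>G u) = c *\<^sub>G boundary_H u"
  by transfer (simp add: lin_ext_scale)

lemma boundary_H_zero [simp]: "boundary_H 0 = 0"
  using boundary_H_scale[of 0 0] by simp

lemma boundary_H_sum: "boundary_H (\<Sum>x\<in>A. f x) = (\<Sum>x\<in>A. boundary_H (f x))"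
  by (induction A rule: infinite_finite_induct) (simp_all add: boundary_H_add)

text \<open>The value 0 on complementary half-edges, together with the vanishing of
  \<open>hk_term\<close> for \<open>h = k\<close>, lets the sums run over full squares
  \<open>A \<times> A\<close>.\<close>

definition glue_term :: "graph_data \<Rightarrow> nat \<Rightarrow> nat \<Rightarrow> 'k::field_char_0 graph_space" where
  "glue_term X h k = (if k = opp X h then 0 else hk_term X h k)"

text \<open>Restricting to a set of half-edges isolates the contributions of the factors of a
  disjoint union. As a function of \<open>A\<close> the sum is quadratic.\<close>

definition pair_sum :: "graph_data \<Rightarrow> nat set \<Rightarrow> 'k::field_char_0 graph_space" where
  "pair_sum X A = (\<Sum>(h, k)\<in>A \<times> A. glue_term X h k)"

lemma glue_term_commute:
  assumes "labelled_graph X" "h \<in> halves X" "k \<in> halves X"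
  shows "glue_term X h k = (glue_term X k h :: 'k::field_char_0 graph_space)"
proof -
  have "k = opp X h \<longleftrightarrow> h = opp X k" using labelled_graphD(5)[OF assms(1)] assms(2,3) by metis
  then show ?thesis using hk_term_commute[OF assms] by (cases "h = k") (auto simp: glue_term_def)
qed

lemma pair_sum_halves:
  assumes X: "labelled_graph X"
  shows "pair_sum X (halves X) = boundary_gen X + (boundary_gen X :: 'k::field_char_0 graph_space)"
proof -
  let ?H = "halves X" and ?g = "\<lambda>(h, k). glue_term X h k :: 'k graph_space"
  let ?U = "{(h, k) \<in> ?H \<times> ?H. h < k}" and ?L = "{(h, k) \<in> ?H \<times> ?H. k < h}"
  have fin: "finite (?H \<times> ?H)" using labelled_graphD(1)[OF X] by simp
  have "pair_sum X ?H = sum ?g (?U \<union> ?L)"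
    unfolding pair_sum_def
  proof (rule sum.mono_neutral_right[OF fin])
    show "\<forall>x\<in>?H \<times> ?H - (?U \<union> ?L). ?g x = 0"
    proof
      fix x assume x: "x \<in> ?H \<times> ?H - (?U \<union> ?L)"
      then have "fst x = snd x" by (cases x) auto
      then show "?g x = 0" by (cases x) (simp add: glue_term_def hk_term_def)
    qed
  qed auto
  also have "\<dots> = sum ?g ?U + sum ?g ?L"
    using fin by (intro sum.union_disjoint) (auto intro: finite_subset[OF _ fin])
  also have "sum ?g ?L = sum ?g ?U"
    by (rule sum.reindex_bij_witness[of _ prod.swap prod.swap]) (auto intro: glue_term_commute[OF X])
  also have "sum ?g ?U = boundary_gen X"
    unfolding boundary_gen_def
    by (rule sum.mono_neutral_cong_right)
      (auto simp: half_edge_pairs_def glue_term_def intro: finite_subset[OF _ fin])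
  finally show ?thesis .
qed

lemma double_eq_0_iff: "u + u = 0 \<longleftrightarrow> u = (0 :: 'k::field_char_0 graph_space)"
proof -
  have "u + u = (2 :: 'k) *\<^sub>G u"
    by (metis graph_space.scale_left_distrib graph_space.scale_one one_add_one)
  then show ?thesis by simp
qed

lemma boundary_H_boundary_gen:
  assumes X: "labelled_graph X"
  shows "boundary_H (boundary_gen X) = (0 :: 'k::field_char_0 graph_space)"
proof -
  let ?H = "halves X" and ?g = "\<lambda>(h, k). glue_term X h k :: 'k graph_space"
  note D = labelled_graphD[OF X]
  \<comment> \<open>Stated in \<open>X\<close> alone and symmetric under exchange of the two pairs.
    The quadruples left out either do not occur in the iterated sum or contribute 0.\<close>
  define adm where "adm h k l m \<longleftrightarrow> distinct [h, k, l, m] \<and> k \<noteq> opp X h \<and> m \<noteq> opp X l \<and>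
    {l, m} \<noteq> {opp X h, opp X k} \<and> vtx X h \<noteq> vtx X k \<and> vtx X l \<noteq> vtx X m" for h k l m
  define T :: "nat \<times> nat \<Rightarrow> nat \<times> nat \<Rightarrow> 'k graph_space" where "T = (\<lambda>(h, k) (l, m).
    if adm h k l m then of_int (hk_sign X h k) *\<^sub>G hk_term (hk_graph X h k) l m else 0)"
  have adm_sym: "adm l m h k" if "adm h k l m" "h \<in> ?H" "k \<in> ?H" "l \<in> ?H" "m \<in> ?H" for h k l m
  proof -
    have "{h, k} \<noteq> {opp X l, opp X m}"
    proof
      assume "{h, k} = {opp X l, opp X m}"
      then have "opp X ` {h, k} = opp X ` {opp X l, opp X m}" by simp
      then show False using that D(5)[OF that(4)] D(5)[OF that(5)] by (simp add: adm_def)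
    qed
    then show ?thesis using that by (auto simp: adm_def)
  qed
  have T_swap: "T x y = - T y x" if xy: "x \<in> ?H \<times> ?H" "y \<in> ?H \<times> ?H" for x y
  proof -
    obtain h k l m where e: "x = (h, k)" "y = (l, m)" by (cases x, cases y) auto
    have s: "h \<in> ?H" "k \<in> ?H" "l \<in> ?H" "m \<in> ?H" using xy e by auto
    show ?thesis
    proof (cases "adm h k l m")
      case True
      then have "adm l m h k" using adm_sym s by blast
      moreover have "of_int (hk_sign X h k) *\<^sub>G hk_term (hk_graph X h k) l m
        = - (of_int (hk_sign X l m) *\<^sub>G (hk_term (hk_graph X l m) h k :: 'k graph_space))"
        using True s unfolding adm_def by (intro hk_term_swap[OF X]) auto
      ultimately show ?thesis using True by (simp add: T_def e)
    next
      case False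
      then have "\<not> adm l m h k" using adm_sym s by blast
      then show ?thesis using False by (simp add: T_def e)
    qed
  qed
  have row: "boundary_H (?g x) + boundary_H (?g x) = (\<Sum>y\<in>?H \<times> ?H. T x y)" if x: "x \<in> ?H \<times> ?H" for x
  proof -
    obtain h k where e: "x = (h, k)" "h \<in> ?H" "k \<in> ?H" using x by auto
    show ?thesis
    proof (cases "k \<noteq> opp X h \<and> vtx X h \<noteq> vtx X k")
      case False
      then have "?g x = 0" "\<And>y. T x y = 0" by (auto simp: e glue_term_def hk_term_def T_def adm_def)
      then show ?thesis by simp
    next
      case True
      then have hk: "h \<noteq> k" by blast
      let ?Y = "hk_graph X h k"
      note o = opp_ne[OF X e(2,3) hk conjunct1[OF True]]
      note Ysel = hk_graph_sel[OF hk o(1,4)]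
      have LY: "labelled_graph ?Y" using True e by (intro labelled_graph_hk[OF X]) auto
      have "?g x = of_int (hk_sign X h k) *\<^sub>G gclass ?Y"
        using True hk_term_eq[OF hk o(1,4)] by (simp add: e glue_term_def)
      then have "boundary_H (?g x) + boundary_H (?g x)
          = of_int (hk_sign X h k) *\<^sub>G (boundary_gen ?Y + boundary_gen ?Y)"
        by (simp add: boundary_H_scale boundary_H_gclass[OF LY] graph_space.scale_right_distrib)
      also have "\<dots> = of_int (hk_sign X h k) *\<^sub>G pair_sum ?Y (?H - {h, k})"
        using pair_sum_halves[OF LY, where ?'k = 'k] by (simp add: Ysel(2))
      also have "\<dots> = (\<Sum>(l, m)\<in>(?H - {h, k}) \<times> (?H - {h, k}). of_int (hk_sign X h k) *\<^sub>G glue_term ?Y l m)"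
        unfolding pair_sum_def graph_space.scale_sum_right by (intro sum.cong) auto
      also have "\<dots> = (\<Sum>y\<in>?H \<times> ?H. T x y)"
      proof (rule sum.mono_neutral_cong_left)
        show "finite (?H \<times> ?H)" using D(1) by simp
        show "\<forall>y\<in>?H \<times> ?H - (?H - {h, k}) \<times> (?H - {h, k}). T x y = 0"
          by (auto simp: T_def e adm_def)
        fix y assume "y \<in> (?H - {h, k}) \<times> (?H - {h, k})"
        then obtain l m where y: "y = (l, m)" "l \<in> ?H" "m \<in> ?H" "l \<notin> {h, k}" "m \<notin> {h, k}" by auto
        have "glue_term ?Y l m = (if adm h k l m then hk_term ?Y l m else 0 :: 'k graph_space)"
        proof (cases "vtx X l = vtx X m")
          case True
          then have "hk_term ?Y l m = (0 :: 'k graph_space)" by (simp add: hk_term_def Ysel)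
          then show ?thesis by (simp add: glue_term_def)
        next
          case False
          \<comment> \<open>In \<open>?Y\<close> the half-edges \<open>l\<close>, \<open>m\<close>
            form an edge either because they did so in \<open>X\<close> or because they are the
            complementary halves glued by the first step.\<close>
          have "m = opp ?Y l \<longleftrightarrow> m = opp X l \<or> {l, m} = {opp X h, opp X k}"
            using y(4,5) o by (auto simp: Ysel doubleton_eq_iff)
          then show ?thesis using True False y hk by (auto simp: glue_term_def adm_def)
        qed
        then show "(case y of (l, m) \<Rightarrow> of_int (hk_sign X h k) *\<^sub>G glue_term ?Y l m) = T x y"
          by (simp add: y T_def e)
      qed auto
      finally show ?thesis .
    qed
  qed
  \<comment> \<open>\<open>S\<close> is four times the square, each of its two sums being doubled by
    the passage to ordered pairs.\<close>
  define S where "S = (\<Sum>x\<in>?H \<times> ?H. \<Sum>y\<in>?H \<times> ?H. T x y)"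
  have "S = (\<Sum>x\<in>?H \<times> ?H. \<Sum>y\<in>?H \<times> ?H. - T y x)"
    unfolding S_def by (intro sum.cong refl) (rule T_swap)
  also have "\<dots> = - S" unfolding S_def sum_negf by (subst sum.swap) simp
  finally have "S = 0" by (metis double_eq_0_iff add.right_inverse)
  moreover have "boundary_H (boundary_gen X + boundary_gen X) + boundary_H (boundary_gen X + boundary_gen X) = S"
    unfolding pair_sum_halves[OF X, symmetric] pair_sum_def boundary_H_sum S_def sum.distrib[symmetric]
    by (intro sum.cong refl) (rule row)
  ultimately show ?thesis by (simp add: boundary_H_add double_eq_0_iff)
qed

section \<open>The graded algebra\<close>

declare add_bit_eq_xor [simp del] mult_bit_eq_and [simp del]

lemma of_nat_bit: "(of_nat n :: bit) = (if even n then 0 else 1)"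
  by (induction n) auto

lemma bit_cases_eq: "p = 0 \<or> p = (1::bit)"
  by (cases p) auto

lemma parity_sign_of_nat: "parity_sign (of_nat n) = ((- 1) ^ n :: 'k::ring_1)"
  by (simp add: parity_sign_def of_nat_bit)

text \<open>Reduces a statement linear in \<open>u\<close> to classes of graphs: a representative is
  the finite sum of its coefficients times basis elements.\<close>

lemma graph_space_induct [case_names zero add]:
  fixes u :: "'k::field_char_0 graph_space"
  assumes "P 0" and step: "\<And>c X u. labelled_graph X \<Longrightarrow> P u \<Longrightarrow> P (c *\<^sub>G gclass X + u)"
  shows "P u"
proof -
  obtain x where u: "u = abs_graph_space x" by (induction u) blast
  let ?s = "\<lambda>X. fscale (Poly_Mapping.lookup x X) (Poly_Mapping.single X 1)"
  have "P (abs_graph_space (\<Sum>X\<in>A. ?s X))" if "finite A" for A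
    using that
  proof (induction A)
    case empty
    then show ?case using assms(1) by (simp add: zero_graph_space.abs_eq)
  next
    case (insert X A)
    have "abs_graph_space (\<Sum>X\<in>insert X A. ?s X)
      = Poly_Mapping.lookup x X *\<^sub>G gclass (Rep_lgraph X) + abs_graph_space (\<Sum>X\<in>A. ?s X)"
      using insert(1,2) by (simp add: gclass_Rep plus_graph_space.abs_eq gscale.abs_eq)
    then show ?case using step[OF labelled_graph_Rep insert(3)] by simp
  qed
  moreover have "x = (\<Sum>X\<in>Poly_Mapping.keys x. ?s X)"
    by (rule poly_mapping_eqI) (simp add: lookup_sum lookup_single when_def in_keys_iff if_distrib[of "(*) _"] cong: if_cong)
  ultimately show ?thesis using u by (metis finite_keys)
qed

section \<open>The grading by parity of the number of vertices\<close>

lemma graph_grade_gclass: "labelled_graph X \<Longrightarrow> of_nat (nv X) = p \<Longrightarrow> gclass X \<in> graph_grade p"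
  unfolding graph_grade_def by (intro graph_space.span_base) blast

lemma subspace_graph_grade: "graph_space.subspace (graph_grade p)"
  unfolding graph_grade_def by (rule graph_space.subspace_span)

lemma graph_grade_induct [consumes 1, case_names zero add]:
  assumes "u \<in> graph_grade p" "P 0"
    and "\<And>c X u. labelled_graph X \<Longrightarrow> of_nat (nv X) = p \<Longrightarrow> P u \<Longrightarrow> P (c *\<^sub>G gclass X + u)"
  shows "P u"
  using assms(1) unfolding graph_grade_def
  by (induction rule: graph_space.span_induct_alt) (auto intro: assms(2,3))

text \<open>The description of the grades as spans does not show that they meet only in 0; this
  projection does. It descends to the quotient because isomorphisms preserve the number of
  vertices.\<close>

lift_definition grade_part :: "bit \<Rightarrow> 'k::field_char_0 graph_space \<Rightarrow> 'k graph_space"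
  is "\<lambda>p. lin_ext (\<lambda>X. if of_nat (nv X) = p then gclass X else 0)"
proof (rule lin_ext_respects)
  show "respects_orientation (\<lambda>X. if of_nat (nv X) = p then gclass X else (0 :: 'k graph_space))" for p :: bit
    using gclass_graph_iso by (intro respects_orientationI) (auto dest: graph_isoD(1))
qed

lemma grade_part_grade:
  fixes u :: "'k::field_char_0 graph_space"
  assumes "u \<in> graph_grade p"
  shows "grade_part q u = (if p = q then u else 0)"
  using assms
proof (induction rule: graph_grade_induct)
  case zero
  show ?case by (simp add: zero_graph_space.abs_eq grade_part.abs_eq) (simp add: lin_ext_def zero_graph_space.abs_eq)
next
  case (add c X u)
  have lin: "grade_part q (c *\<^sub>G v + w) = c *\<^sub>G grade_part q v + grade_part q w" for v w :: "'k graph_space"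
    by transfer (simp add: lin_ext_add lin_ext_scale)
  have "grade_part q (gclass X) = (if p = q then gclass X else 0 :: 'k graph_space)"
    using add(1,2) by (simp add: gclass_def grade_part.abs_eq lin_ext_single Abs_lgraph_inverse)
  then show ?case using add(3) by (simp add: lin)
qed

section \<open>Bilinearity of the product\<close>

lemma graph_mult_add_left: "graph_mult (u + v) w = graph_mult u w + graph_mult v w"
  by transfer (simp add: lin_ext_add)

lemma graph_mult_scale_left: "graph_mult (c *\<^sub>G u) w = c *\<^sub>G graph_mult u w"
  by transfer (simp add: lin_ext_scale)

lemma graph_mult_add_right: "graph_mult u (v + w) = graph_mult u v + graph_mult u w"
proof transfer
  fix x y z :: "lgraph \<Rightarrow>\<^sub>0 'a"
  have "lin_ext (\<lambda>X. f X + g X) x = lin_ext f x + lin_ext g x" for f g :: "graph_data \<Rightarrow> 'a graph_space"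
    by (simp add: lin_ext_def graph_space.scale_right_distrib sum.distrib)
  then show "lin_ext (\<lambda>X. lin_ext (mult_gen X) (y + z)) x
      = lin_ext (\<lambda>X. lin_ext (mult_gen X) y) x + lin_ext (\<lambda>X. lin_ext (mult_gen X) z) x"
    by (simp add: lin_ext_add)
qed

lemma graph_mult_scale_right: "graph_mult u (c *\<^sub>G v) = c *\<^sub>G graph_mult u v"
proof transfer
  fix x y :: "lgraph \<Rightarrow>\<^sub>0 'a" and c
  show "lin_ext (\<lambda>X. lin_ext (mult_gen X) (fscale c y)) x = c *\<^sub>G lin_ext (\<lambda>X. lin_ext (mult_gen X) y) x"
    by (rule lin_ext_cong_scale) (rule lin_ext_scale)
qed

lemma graph_mult_zero [simp]: "graph_mult 0 v = 0" "graph_mult u 0 = 0"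
  using graph_mult_scale_left[of 0 0 v] graph_mult_scale_right[of u 0 0] by simp_all

lemma graph_mult_sum_left: "graph_mult (\<Sum>x\<in>A. f x) v = (\<Sum>x\<in>A. graph_mult (f x) v)"
  by (induction A rule: infinite_finite_induct) (simp_all add: graph_mult_add_left)

text \<open>Block transpositions are powers of a long cycle.\<close>

definition block_swap :: "nat \<Rightarrow> nat \<Rightarrow> nat \<Rightarrow> nat" where
  "block_swap m n i = (if i \<in> {1..m} then i + n else if i \<in> {m + 1..m + n} then i - m else i)"

lemma block_swap_apply:
  "i \<in> {1..m} \<Longrightarrow> block_swap m n i = n + i" "i \<in> {1..n} \<Longrightarrow> block_swap m n (m + i) = i"
  by (auto simp: block_swap_def)

text \<open>This is the long cycle, sending \<open>i\<close> to \<open>i + 1\<close> and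
  \<open>n + 1\<close> to 1. Each further vertex costs one transposition.\<close>

lemma block_swap_one:
  "block_swap n 1 permutes {1..Suc n} \<and> sign (block_swap n 1) = (- 1) ^ n"
proof (induction n)
  case 0
  have "block_swap 0 1 = id" by (auto simp: block_swap_def)
  then have "block_swap 0 1 permutes {1..Suc 0}" "sign (block_swap 0 1) = 1" by (simp_all only: permutes_id sign_id)
  then show ?case unfolding power_0 by blast
next
  case (Suc n)
  have eq: "block_swap (Suc n) 1 = transpose 1 (n + 2) \<circ> block_swap n 1"
    by (rule ext) (auto simp: block_swap_def transpose_def)
  have "block_swap n 1 permutes {1..Suc (Suc n)}"
    using Suc permutes_subset[of _ "{1..Suc n}" "{1..Suc (Suc n)}"] by auto
  moreover have "transpose 1 (n + 2) permutes {1..Suc (Suc n)}" by (intro permutes_swap_id) auto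
  moreover have "permutation (block_swap n 1)"
    using Suc by (auto intro: permutes_imp_permutation[OF finite_atLeastAtMost])
  ultimately show ?case unfolding eq
  proof (intro conjI permutes_compose)
    show "sign (transpose 1 (n + 2) \<circ> block_swap n 1) = (- 1) ^ Suc n" if "permutation (block_swap n 1)"
      using Suc by (subst sign_compose[OF permutation_swap_id that]) (simp add: sign_swap_id)
  qed
qed

text \<open>Rotating \<open>n + 1\<close> points by \<open>k\<close> places exchanges the block of
  the first \<open>n + 1 - k\<close> points with that of the last \<open>k\<close>.\<close>

lemma block_swap_power:
  assumes "k \<le> Suc n"
  shows "block_swap n 1 ^^ k = block_swap (Suc n - k) k"
  using assms
proof (induction k)
  case 0
  show ?case by (auto simp: block_swap_def)
next
  case (Suc k)
  obtain d where n: "n = k + d" using le_Suc_ex[of k n] Suc.prems by auto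
  have "block_swap (k + d) 1 (block_swap (Suc d) k i) = block_swap d (Suc k) i" for i
    by (simp add: block_swap_def) arith
  then have step: "block_swap n 1 \<circ> block_swap (Suc d) k = block_swap d (Suc k)"
    by (simp add: n fun_eq_iff)
  have d: "Suc n - k = Suc d" "Suc n - Suc k = d" using n by auto
  show ?case unfolding funpow.simps Suc.IH[OF Suc_leD[OF Suc.prems]] d by (rule step)
qed

lemma
  shows block_swap_permutes: "block_swap m n permutes {1..m + n}"
    and sign_block_swap: "sign (block_swap m n) = (- 1) ^ (m * n)"
proof -
  have "block_swap m n permutes {1..m + n} \<and> sign (block_swap m n) = (- 1) ^ (m * n)"
  proof (cases "m + n")
    case 0
    then have "block_swap m n = id" by (auto simp: block_swap_def)
    then show ?thesis using 0 by (simp add: permutes_id)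
  next
    case (Suc N)
    have pw: "(block_swap N 1 ^^ k) permutes {1..Suc N} \<and> sign (block_swap N 1 ^^ k) = (- 1) ^ (N * k)" for k
    proof (induction k)
      case 0
      then show ?case using permutes_id[of "{1..Suc N}"] by (simp add: id_def)
    next
      case (Suc k)
      note b = block_swap_one[of N]
      have "permutation (block_swap N 1)" "permutation (block_swap N 1 ^^ k)"
        using b Suc by (auto intro: permutes_imp_permutation[OF finite_atLeastAtMost])
      then have "sign (block_swap N 1 \<circ> (block_swap N 1 ^^ k)) = (- 1) ^ (N * Suc k)"
        using b Suc by (simp only: sign_compose) (simp add: power_add)
      moreover have "(block_swap N 1 \<circ> (block_swap N 1 ^^ k)) permutes {1..Suc N}"
        using b Suc by (intro permutes_compose) auto
      ultimately show ?case by (simp only: funpow.simps)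
    qed
    have "block_swap m n = block_swap N 1 ^^ n"
      using Suc by (subst block_swap_power) (auto simp flip: Suc)
    \<comment> \<open>Here \<open>N = m + n - 1\<close>, so the exponents differ by the even number
      \<open>n * (n - 1)\<close>.\<close>
    moreover have "(- 1 :: int) ^ (N * n) = (- 1) ^ (m * n)"
    proof -
      have "even (N * n) \<longleftrightarrow> even (m * n)" using arg_cong[OF Suc, of even] by auto
      then show ?thesis by (simp add: uminus_power_if)
    qed
    ultimately show ?thesis using pw[of n] Suc by simp
  qed
  then show "block_swap m n permutes {1..m + n}" "sign (block_swap m n) = (- 1) ^ (m * n)" by auto
qed

text \<open>Opaque names for the two tags of \<open>disjoint_union\<close>. With them, maps between
  iterated unions are defined and simplified by cases on the tags, without parity
  arithmetic.\<close>

definition inl_half :: "nat \<Rightarrow> nat" where "inl_half h = 2 * h"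

definition inr_half :: "nat \<Rightarrow> nat" where "inr_half h = Suc (2 * h)"

definition case_half :: "(nat \<Rightarrow> nat) \<Rightarrow> (nat \<Rightarrow> nat) \<Rightarrow> nat \<Rightarrow> nat" where
  "case_half f g h = (if even h then f (h div 2) else g (h div 2))"

lemma case_half_simps [simp]: "case_half f g (inl_half h) = f h" "case_half f g (inr_half h) = g h"
  by (simp_all add: case_half_def inl_half_def inr_half_def)

lemma half_eq_simps [simp]:
  "inl_half a = inl_half b \<longleftrightarrow> a = b" "inr_half a = inr_half b \<longleftrightarrow> a = b"
  "inl_half a \<noteq> inr_half b" "inr_half b \<noteq> inl_half a"
  by (simp_all add: inl_half_def inr_half_def) presburger+

lemma union_half_simps [simp]:
  "vtx (disjoint_union X Y) (inl_half h) = vtx X h"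
  "vtx (disjoint_union X Y) (inr_half h) = nv X + vtx Y h"
  "opp (disjoint_union X Y) (inl_half h) = inl_half (opp X h)"
  "opp (disjoint_union X Y) (inr_half h) = inr_half (opp Y h)"
  "inl_half h \<in> halves (disjoint_union X Y) \<longleftrightarrow> h \<in> halves X"
  "inr_half h \<in> halves (disjoint_union X Y) \<longleftrightarrow> h \<in> halves Y"
  "inl_half h \<in> ini (disjoint_union X Y) \<longleftrightarrow> h \<in> ini X"
  "inr_half h \<in> ini (disjoint_union X Y) \<longleftrightarrow> h \<in> ini Y"
  by (simp_all add: inl_half_def inr_half_def)

lemma halves_union:
  "halves (disjoint_union X Y) = inl_half ` halves X \<union> inr_half ` halves Y"
  "ini (disjoint_union X Y) = inl_half ` ini X \<union> inr_half ` ini Y"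
  by (auto simp: halves_disjoint_union inl_half_def inr_half_def)

lemma graph_isoI:
  assumes "nv X = nv Y" "p permutes {1..nv X}"
    and "\<And>h. h \<in> halves X \<Longrightarrow> f h \<in> halves Y \<and> g (f h) = h"
    and "\<And>h. h \<in> halves Y \<Longrightarrow> g h \<in> halves X \<and> f (g h) = h"
    and "\<And>h. h \<in> halves X \<Longrightarrow> vtx Y (f h) = p (vtx X h) \<and> opp Y (f h) = f (opp X h)"
  shows "graph_iso f p X Y"
proof -
  have "bij_betw f (halves X) (halves Y)"
    by (rule bij_betw_byWitness[of _ g]) (use assms(3,4) in auto)
  then show ?thesis using assms unfolding graph_iso_def by blast
qed

lemma iso_sign_preserving:
  assumes "\<And>h. h \<in> ini X \<Longrightarrow> f h \<in> ini Y"
  shows "iso_sign f p X Y = sign p"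
proof -
  have "iso_arrow_sign f X Y = 1"
    unfolding iso_arrow_sign_def using assms by (intro prod.neutral) simp
  then show ?thesis by (simp add: iso_sign_def)
qed

text \<open>Arrows are carried along unchanged, so only the block transposition of the vertex
  numbers contributes. This is the origin of the sign in graded commutativity.\<close>

lemma graph_iso_union_commute:
  assumes X: "labelled_graph X" and Y: "labelled_graph Y"
  shows "graph_iso (case_half inr_half inl_half) (block_swap (nv X) (nv Y))
      (disjoint_union X Y) (disjoint_union Y X)"
    and "iso_sign (case_half inr_half inl_half) (block_swap (nv X) (nv Y))
      (disjoint_union X Y) (disjoint_union Y X) = (- 1) ^ (nv X * nv Y)"
proof -
  have "block_swap (nv X) (nv Y) (vtx X h) = nv Y + vtx X h" if "h \<in> halves X" for h
    using labelled_graphD(2)[OF X that] by (rule block_swap_apply)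
  moreover have "block_swap (nv X) (nv Y) (nv X + vtx Y h) = vtx Y h" if "h \<in> halves Y" for h
    using labelled_graphD(2)[OF Y that] by (rule block_swap_apply)
  ultimately show "graph_iso (case_half inr_half inl_half) (block_swap (nv X) (nv Y))
      (disjoint_union X Y) (disjoint_union Y X)"
    using block_swap_permutes[of "nv X" "nv Y"]
    by (intro graph_isoI[where g = "case_half inr_half inl_half"]) (auto simp: halves_union)
  show "iso_sign (case_half inr_half inl_half) (block_swap (nv X) (nv Y))
      (disjoint_union X Y) (disjoint_union Y X) = (- 1) ^ (nv X * nv Y)"
    by (subst iso_sign_preserving) (auto simp: halves_union sign_block_swap)
qed

definition assoc_half :: "nat \<Rightarrow> nat" where
  "assoc_half = case_half (case_half inl_half (inr_half \<circ> inl_half)) (inr_half \<circ> inr_half)"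

lemma assoc_half_simps [simp]:
  "assoc_half (inl_half (inl_half h)) = inl_half h"
  "assoc_half (inl_half (inr_half h)) = inr_half (inl_half h)"
  "assoc_half (inr_half h) = inr_half (inr_half h)"
  by (simp_all add: assoc_half_def)

text \<open>Both bracketings shift the vertex numbers by the same amounts and differ only in the
  tags of the half-edges; hence \<open>id\<close> on vertices and no sign.\<close>

lemma graph_iso_union_assoc:
  shows "graph_iso assoc_half id (disjoint_union (disjoint_union X Y) Z) (disjoint_union X (disjoint_union Y Z))"
    and "iso_sign assoc_half id (disjoint_union (disjoint_union X Y) Z) (disjoint_union X (disjoint_union Y Z)) = 1"
proof -
  show "graph_iso assoc_half id (disjoint_union (disjoint_union X Y) Z) (disjoint_union X (disjoint_union Y Z))"
    by (rule graph_isoI[where g = "case_half (inl_half \<circ> inl_half) (case_half (inl_half \<circ> inr_half) inr_half)"])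
      (auto simp: halves_union permutes_id)
  show "iso_sign assoc_half id (disjoint_union (disjoint_union X Y) Z) (disjoint_union X (disjoint_union Y Z)) = 1"
    by (subst iso_sign_preserving) (auto simp: halves_union)
qed

section \<open>The laws of the graded commutative algebra\<close>

lemma graph_mult_commute:
  fixes u v :: "'k::field_char_0 graph_space"
  assumes "u \<in> graph_grade p" "v \<in> graph_grade q"
  shows "graph_mult u v = parity_sign (p * q) *\<^sub>G graph_mult v u"
  using assms(1)
proof (induction rule: graph_grade_induct)
  case (add c X u)
  note X = add(1,2)
  have "graph_mult (gclass X) v = parity_sign (p * q) *\<^sub>G graph_mult v (gclass X)"
    using assms(2)
  proof (induction rule: graph_grade_induct)
    case (add d Y v)
    have sgn: "(parity_sign (p * q) :: 'k) = of_int ((- 1) ^ (nv X * nv Y))"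
      by (simp add: parity_sign_of_nat flip: X(2) add(2) of_nat_mult)
    have "gclass (disjoint_union X Y) = parity_sign (p * q) *\<^sub>G (gclass (disjoint_union Y X) :: 'k graph_space)"
      using gclass_graph_iso[OF labelled_graph_union[OF X(1) add(1)] labelled_graph_union[OF add(1) X(1)]
          graph_iso_union_commute(1)[OF X(1) add(1)], where ?'k = 'k]
      unfolding graph_iso_union_commute(2)[OF X(1) add(1)] sgn .
    then show ?case using X(1) add
      by (simp add: graph_mult_add_left graph_mult_add_right graph_mult_scale_left graph_mult_scale_right
          graph_mult_gclass graph_space.scale_right_distrib mult.commute)
  qed simp
  then show ?case using add(3)
    by (simp add: graph_mult_add_left graph_mult_add_right graph_mult_scale_left graph_mult_scale_right
        graph_space.scale_right_distrib mult.commute)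
qed simp

lemma graph_mult_assoc: "graph_mult (graph_mult u v) w = graph_mult u (graph_mult v w)"
proof (induction u rule: graph_space_induct)
  case (add c X u)
  have "graph_mult (graph_mult (gclass X) v) w = graph_mult (gclass X) (graph_mult v w)"
  proof (induction v rule: graph_space_induct)
    case (add d Y v)
    note Y = add(1)
    have "graph_mult (graph_mult (gclass X) (gclass Y)) w = graph_mult (gclass X) (graph_mult (gclass Y) w)"
    proof (induction w rule: graph_space_induct)
      case (add e Z w)
      have "gclass (disjoint_union (disjoint_union X Y) Z)
          = (gclass (disjoint_union X (disjoint_union Y Z)) :: 'a graph_space)"
        using gclass_graph_iso[OF _ _ graph_iso_union_assoc(1)[of X Y Z], where ?'k = 'a] \<open>labelled_graph X\<close> Y add(1)
        by (simp add: labelled_graph_union graph_iso_union_assoc(2))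
      then show ?case using \<open>labelled_graph X\<close> Y add
        by (simp add: graph_mult_add_right graph_mult_scale_right graph_mult_gclass labelled_graph_union)
    qed simp
    then show ?case using add(2)
      by (simp add: graph_mult_add_left graph_mult_add_right graph_mult_scale_left graph_mult_scale_right)
  qed simp
  then show ?case using add(2) by (simp add: graph_mult_add_left graph_mult_scale_left)
qed simp

lemma gclass_empty_union:
  assumes "labelled_graph X"
  shows "gclass (disjoint_union empty_graph X) = gclass X"
proof -
  let ?f = "case_half id id"
  have h: "halves empty_graph = {}" "ini empty_graph = {}" "nv empty_graph = 0"
    by (simp_all add: empty_graph_def)
  have "graph_iso ?f id (disjoint_union empty_graph X) X"
    by (rule graph_isoI[where g = inr_half]) (auto simp: halves_union h permutes_id)
  moreover have "iso_sign ?f id (disjoint_union empty_graph X) X = 1"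
    by (subst iso_sign_preserving) (auto simp: halves_union h)
  ultimately show ?thesis
    using gclass_graph_iso[OF labelled_graph_union[OF labelled_graph_empty assms] assms] by fastforce
qed

lemma graph_mult_empty_left: "graph_mult (gclass empty_graph) u = u"
  by (induction u rule: graph_space_induct)
    (simp_all add: graph_mult_add_right graph_mult_scale_right graph_mult_gclass labelled_graph_empty gclass_empty_union)

lemma graph_grade_mult:
  fixes u v :: "'k::field_char_0 graph_space"
  assumes "u \<in> graph_grade p" "v \<in> graph_grade q"
  shows "graph_mult u v \<in> graph_grade (p + q)"
  using assms(1)
proof (induction rule: graph_grade_induct)
  case zero
  show ?case by (simp add: graph_space.subspace_0[OF subspace_graph_grade])
next
  case (add c X u)
  note X = add(1,2)
  have "graph_mult (gclass X) v \<in> graph_grade (p + q)"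
    using assms(2)
  proof (induction rule: graph_grade_induct)
    case zero
    show ?case by (simp add: graph_space.subspace_0[OF subspace_graph_grade])
  next
    case (add c Y v)
    then have "graph_mult (gclass X) (gclass Y :: 'k graph_space) \<in> graph_grade (p + q)"
      using X by (auto simp: graph_mult_gclass intro!: graph_grade_gclass labelled_graph_union)
    then show ?case using add(3)
      by (simp add: graph_mult_add_right graph_mult_scale_right graph_space.subspace_add[OF subspace_graph_grade]
          graph_space.subspace_scale[OF subspace_graph_grade])
  qed
  then show ?case using add(3)
    by (simp add: graph_mult_add_left graph_mult_scale_left graph_space.subspace_add[OF subspace_graph_grade]
        graph_space.subspace_scale[OF subspace_graph_grade])
qed

section \<open>The second order identity\<close>

text \<open>Moves a partial sum to whichever arrangement of a disjoint union is convenient. Over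
  ordered pairs the reindexing by \<open>f\<close> needs no comparison of \<open>f h\<close> with
  \<open>f k\<close>.\<close>

lemma pair_sum_iso:
  assumes X: "labelled_graph X" and Y: "labelled_graph Y" and iso: "graph_iso f p X Y" and A: "A \<subseteq> halves X"
  shows "pair_sum X A = of_int (iso_sign f p X Y) *\<^sub>G (pair_sum Y (f ` A) :: 'k::field_char_0 graph_space)"
proof -
  note I = graph_isoD[OF iso]
  have inj: "inj_on f A" using A I(7) by (auto simp: inj_on_def)
  have "map_prod f f ` (A \<times> A) = f ` A \<times> f ` A" by force
  then have "pair_sum Y (f ` A) = (\<Sum>(h, k)\<in>map_prod f f ` (A \<times> A). glue_term Y h k :: 'k graph_space)"
    by (simp add: pair_sum_def)
  also have "\<dots> = (\<Sum>(h, k)\<in>A \<times> A. glue_term Y (f h) (f k))"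
    by (subst sum.reindex) (auto simp: map_prod_inj_on inj intro!: sum.cong)
  finally have "of_int (iso_sign f p X Y) *\<^sub>G pair_sum Y (f ` A)
      = (\<Sum>(h, k)\<in>A \<times> A. of_int (iso_sign f p X Y) *\<^sub>G (glue_term Y (f h) (f k) :: 'k graph_space))"
    by (simp add: graph_space.scale_sum_right split_beta)
  also have "\<dots> = pair_sum X A"
    unfolding pair_sum_def
  proof (intro sum.cong refl, clarify)
    fix h k assume "h \<in> A" "k \<in> A"
    then have hk: "h \<in> halves X" "k \<in> halves X" using A by auto
    show "of_int (iso_sign f p X Y) *\<^sub>G glue_term Y (f h) (f k) = (glue_term X h k :: 'k graph_space)"
    proof (cases "h = k \<or> k = opp X h")
      case True
      then show ?thesis using hk I(5) by (auto simp: glue_term_def hk_term_def)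
    next
      case False
      then have "f k \<noteq> opp Y (f h)" using hk I(5,7) labelled_graphD(3)[OF X] by simp
      then show ?thesis using False hk_term_iso[OF X Y iso hk, where ?'k = 'k] by (simp add: glue_term_def)
    qed
  qed
  finally show ?thesis by simp
qed

text \<open>\<open>to_front\<close> permutes the vertices of \<open>X\<close> only, and
  \<open>merge\<close> lowers the numbers of \<open>Y\<close> by one, exactly the shift required by
  the smaller left factor; hence no sign. In the right factor the merged vertex would have to move
  past \<open>X\<close>, so that case is derived by exchanging factors.\<close>

lemma hk_term_union:
  assumes X: "labelled_graph X" and Y: "labelled_graph Y"
    and h: "h \<in> halves X" "k \<in> halves X" "h \<noteq> k" "k \<noteq> opp X h"
  shows "hk_term (disjoint_union X Y) (inl_half h) (inl_half k)
    = graph_mult (hk_term X h k) (gclass Y :: 'k::field_char_0 graph_space)"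
proof (cases "vtx X h = vtx X k")
  case True
  then show ?thesis by (simp add: hk_term_def)
next
  case ne: False
  let ?U = "disjoint_union X Y" and ?G = "hk_graph X h k"
  let ?V = "hk_graph ?U (inl_half h) (inl_half k)"
  note D = labelled_graphD[OF X] and o = opp_ne[OF X h]
  have LU: "labelled_graph ?U" using X Y by (rule labelled_graph_union)
  have sel: "inl_half h \<noteq> inl_half k" "opp ?U (inl_half h) \<noteq> inl_half h" "opp ?U (inl_half k) \<noteq> inl_half h"
    using h o by auto
  note Gsel = hk_graph_sel[OF h(3) o(1,4)] and Vsel = hk_graph_sel[OF sel]
  have LG: "labelled_graph ?G" using X h(1,2,4) ne by (rule labelled_graph_hk)
  have LV: "labelled_graph ?V" using LU h ne by (intro labelled_graph_hk) auto
  have v: "vtx X h \<in> {1..nv X}" "vtx X k \<in> {1..nv X}" using D(2) h by auto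
  have vY: "contract (vtx X h) (vtx X k) (nv X + vtx Y x) = nv X - 1 + vtx Y x" if "x \<in> halves Y" for x
  proof -
    have "vtx Y x \<ge> 1" "nv X \<ge> 2" using labelled_graphD(2)[OF Y that] v ne by auto
    moreover have "to_front (vtx X h) (vtx X k) (nv X + vtx Y x) = nv X + vtx Y x"
      using permutes_not_in[OF to_front_permutes[OF v ne]] \<open>vtx Y x \<ge> 1\<close> by auto
    ultimately show ?thesis by (simp add: contract_def merge_def)
  qed
  have hV: "halves ?V = halves (disjoint_union ?G Y)"
    by (auto simp: halves_union Vsel(2) Gsel(2))
  have "graph_iso id id ?V (disjoint_union ?G Y)"
    unfolding graph_iso_def
  proof (intro conjI ballI permutes_id)
    show "nv ?V = nv (disjoint_union ?G Y)" using v by (auto simp: Vsel(1) Gsel(1))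
    show "bij_betw id (halves ?V) (halves (disjoint_union ?G Y))" using hV by simp
    fix x assume "x \<in> halves ?V"
    then have "x \<in> inl_half ` (halves X - {h, k}) \<union> inr_half ` halves Y"
      by (auto simp: halves_union Vsel(2))
    then show "vtx (disjoint_union ?G Y) (id x) = id (vtx ?V x)"
      "opp (disjoint_union ?G Y) (id x) = id (opp ?V x)"
      by (auto simp: Vsel(3,4) Gsel(1,3,4) vY)
  qed
  moreover have "iso_sign id id ?V (disjoint_union ?G Y) = 1"
    by (subst iso_sign_preserving) (auto simp: halves_union(2) Vsel(5) Gsel(5))
  ultimately have "gclass ?V = graph_mult (gclass ?G) (gclass Y :: 'k graph_space)"
    using gclass_graph_iso[OF LV labelled_graph_union[OF LG Y], of id id, where ?'k = 'k]
    by (simp add: graph_mult_gclass[OF LG Y])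
  moreover have "hk_sign ?U (inl_half h) (inl_half k) = hk_sign X h k"
    by (simp add: hk_sign_def arrow_sign_def)
  ultimately show ?thesis
    unfolding hk_term_eq[OF sel] hk_term_eq[OF h(3) o(1,4)] by (simp add: graph_mult_scale_left)
qed

lemma pair_sum_union_left:
  assumes X: "labelled_graph X" and Y: "labelled_graph Y" and A: "A \<subseteq> halves X"
  shows "pair_sum (disjoint_union X Y) (inl_half ` A) = graph_mult (pair_sum X A) (gclass Y :: 'k::field_char_0 graph_space)"
proof -
  let ?U = "disjoint_union X Y"
  have "map_prod inl_half inl_half ` (A \<times> A) = inl_half ` A \<times> inl_half ` A" by force
  then have "pair_sum ?U (inl_half ` A)
      = (\<Sum>(h, k)\<in>map_prod inl_half inl_half ` (A \<times> A). glue_term ?U h k :: 'k graph_space)"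
    by (simp add: pair_sum_def)
  also have "\<dots> = (\<Sum>(h, k)\<in>A \<times> A. glue_term ?U (inl_half h) (inl_half k))"
    by (subst sum.reindex) (auto simp: map_prod_inj_on inj_on_def intro!: sum.cong)
  also have "\<dots> = (\<Sum>(h, k)\<in>A \<times> A. graph_mult (glue_term X h k) (gclass Y))"
  proof (intro sum.cong refl, clarify)
    fix h k assume "h \<in> A" "k \<in> A"
    then have hk: "h \<in> halves X" "k \<in> halves X" using A by auto
    show "glue_term ?U (inl_half h) (inl_half k) = graph_mult (glue_term X h k) (gclass Y :: 'k graph_space)"
    proof (cases "h = k \<or> k = opp X h")
      case True
      then show ?thesis by (auto simp: glue_term_def hk_term_def)
    next
      case False
      then show ?thesis using hk_term_union[OF X Y hk, where ?'k = 'k] by (simp add: glue_term_def)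
    qed
  qed
  finally show ?thesis by (simp add: pair_sum_def graph_mult_sum_left split_beta)
qed

lemma boundary_gen_grade:
  fixes X :: graph_data
  assumes X: "labelled_graph X"
  shows "(boundary_gen X :: 'k::field_char_0 graph_space) \<in> graph_grade (of_nat (nv X) + 1)"
proof -
  have "hk_term X h k \<in> (graph_grade (of_nat (nv X) + 1) :: 'k graph_space set)"
    if hk: "h \<in> halves X" "k \<in> halves X" "h \<noteq> k" "k \<noteq> opp X h" for h k
  proof (cases "vtx X h = vtx X k")
    case True
    then show ?thesis by (simp add: hk_term_def graph_space.subspace_0[OF subspace_graph_grade])
  next
    case False
    note o = opp_ne[OF X hk]
    have "nv X = Suc (nv (hk_graph X h k))"
      using hk_graph_sel(1)[OF hk(3) o(1,4)] labelled_graphD(2)[OF X hk(1)] by auto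
    then have "of_nat (nv (hk_graph X h k)) = (of_nat (nv X) + 1 :: bit)" by (simp add: of_nat_bit)
    then have "gclass (hk_graph X h k) \<in> (graph_grade (of_nat (nv X) + 1) :: 'k graph_space set)"
      using labelled_graph_hk[OF X hk(1,2,4) False] by (intro graph_grade_gclass)
    then show ?thesis
      using False hk_term_eq[OF hk(3) o(1,4), where ?'k = 'k] graph_space.subspace_scale[OF subspace_graph_grade]
      by simp
  qed
  then show ?thesis unfolding boundary_gen_def
    by (intro graph_space.subspace_sum[OF subspace_graph_grade]) (auto simp: half_edge_pairs_def)
qed

lemma boundary_H_grade:
  fixes u :: "'k::field_char_0 graph_space"
  assumes "u \<in> graph_grade p"
  shows "boundary_H u \<in> graph_grade (p + 1)"
  using assms
proof (induction rule: graph_grade_induct)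
  case zero
  show ?case by (simp add: graph_space.subspace_0[OF subspace_graph_grade])
next
  case (add c X u)
  have "(boundary_gen X :: 'k graph_space) \<in> graph_grade (p + 1)" using boundary_gen_grade add(1,2) by blast
  then show ?case using add
    by (simp add: boundary_H_add boundary_H_scale boundary_H_gclass graph_space.subspace_add[OF subspace_graph_grade]
        graph_space.subspace_scale[OF subspace_graph_grade])
qed

text \<open>Exchange the factors, apply the rule for the left factor, exchange back. The operator
  changes the parity \<open>q\<close> of \<open>Y\<close>, so the exchanges cost
  \<open>p * q\<close> and \<open>(q + 1) * p\<close>, which together leave
  \<open>p\<close>.\<close>

lemma pair_sum_union_right:
  assumes X: "labelled_graph X" and Y: "labelled_graph Y" and p: "of_nat (nv X) = p"
  shows "pair_sum (disjoint_union X Y) (inr_half ` halves Y)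
    = parity_sign p *\<^sub>G graph_mult (gclass X) (pair_sum Y (halves Y) :: 'k::field_char_0 graph_space)"
proof -
  let ?q = "of_nat (nv Y) :: bit" and ?P = "pair_sum Y (halves Y) :: 'k graph_space"
  have P: "?P \<in> graph_grade (?q + 1)"
    unfolding pair_sum_halves[OF Y] using boundary_gen_grade[OF Y]
    by (intro graph_space.subspace_add[OF subspace_graph_grade])
  have sgn: "of_int ((- 1) ^ (nv X * nv Y)) = (parity_sign (p * ?q) :: 'k)"
    by (simp add: parity_sign_of_nat flip: p of_nat_mult)
  have "case_half inr_half inl_half ` inr_half ` halves Y = inl_half ` halves Y" by (simp add: image_image)
  then have "pair_sum (disjoint_union X Y) (inr_half ` halves Y)
      = parity_sign (p * ?q) *\<^sub>G (pair_sum (disjoint_union Y X) (inl_half ` halves Y) :: 'k graph_space)"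
    using pair_sum_iso[OF labelled_graph_union[OF X Y] labelled_graph_union[OF Y X] graph_iso_union_commute(1)[OF X Y],
        of "inr_half ` halves Y", where ?'k = 'k]
    unfolding graph_iso_union_commute(2)[OF X Y] sgn by (simp add: halves_union)
  also have "\<dots> = parity_sign (p * ?q) *\<^sub>G graph_mult ?P (gclass X)"
    by (simp add: pair_sum_union_left[OF Y X])
  also have "\<dots> = (parity_sign (p * ?q) * parity_sign ((?q + 1) * p)) *\<^sub>G graph_mult (gclass X) ?P"
    using graph_mult_commute[OF P graph_grade_gclass[OF X p]] by simp
  also have "parity_sign (p * ?q) * parity_sign ((?q + 1) * p) = (parity_sign p :: 'k)"
    using bit_cases_eq[of p] bit_cases_eq[of ?q] by (auto simp: parity_sign_def)
  finally show ?thesis .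
qed

text \<open>The third difference of a quadratic function vanishes: a pair inside one of the sets is
  counted twice on either side, a pair across two of them once.\<close>

lemma pair_sum_three:
  assumes "finite A" "finite B" "finite C" "A \<inter> B = {}" "A \<inter> C = {}" "B \<inter> C = {}"
  shows "pair_sum X (A \<union> B \<union> C) + pair_sum X A + pair_sum X B + pair_sum X C
    = pair_sum X (A \<union> B) + pair_sum X (B \<union> C) + pair_sum X (A \<union> C)"
proof -
  have ps: "pair_sum X S = (\<Sum>h\<in>S. \<Sum>k\<in>S. glue_term X h k)" for S
    by (simp add: pair_sum_def sum.cartesian_product)
  have un: "sum f (S \<union> T) = sum f S + sum f T"
    if "finite S" "finite T" "S \<inter> T = {}" for f :: "nat \<Rightarrow> 'a graph_space" and S T
    using that by (rule sum.union_disjoint)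
  have "(A \<union> B) \<inter> C = {}" using assms by auto
  then show ?thesis using assms unfolding ps by (simp add: un sum.distrib algebra_simps)
qed

text \<open>Brings \<open>X\<close> next to \<open>Z\<close>, as the term with \<open>y\<close> as
  outer factor demands. The block transposition fixes the numbers of \<open>Z\<close>, so the sign
  is the one for two factors.\<close>

lemma graph_iso_union_swap_left:
  assumes X: "labelled_graph X" and Y: "labelled_graph Y" and Z: "labelled_graph Z"
  defines "f \<equiv> case_half (inl_half \<circ> case_half inr_half inl_half) inr_half"
  shows "graph_iso f (block_swap (nv X) (nv Y))
      (disjoint_union (disjoint_union X Y) Z) (disjoint_union (disjoint_union Y X) Z)"
    and "iso_sign f (block_swap (nv X) (nv Y))
      (disjoint_union (disjoint_union X Y) Z) (disjoint_union (disjoint_union Y X) Z) = (- 1) ^ (nv X * nv Y)"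
proof -
  let ?b = "block_swap (nv X) (nv Y)"
  have "?b (vtx X h) = nv Y + vtx X h" if "h \<in> halves X" for h
    using labelled_graphD(2)[OF X that] by (rule block_swap_apply)
  moreover have "?b (nv X + vtx Y h) = vtx Y h" if "h \<in> halves Y" for h
    using labelled_graphD(2)[OF Y that] by (rule block_swap_apply)
  moreover have "?b (nv X + nv Y + vtx Z h) = nv X + nv Y + vtx Z h" if "h \<in> halves Z" for h
    using labelled_graphD(2)[OF Z that] by (auto simp: block_swap_def)
  moreover have "?b permutes {1..nv X + nv Y + nv Z}"
    using block_swap_permutes by (rule permutes_subset) auto
  ultimately show "graph_iso f ?b
      (disjoint_union (disjoint_union X Y) Z) (disjoint_union (disjoint_union Y X) Z)"
    unfolding f_def
    by (intro graph_isoI[where g = "case_half (inl_half \<circ> case_half inr_half inl_half) inr_half"])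
      (auto simp: halves_union add.commute)
  show "iso_sign f ?b
      (disjoint_union (disjoint_union X Y) Z) (disjoint_union (disjoint_union Y X) Z) = (- 1) ^ (nv X * nv Y)"
    by (subst iso_sign_preserving) (auto simp: f_def halves_union sign_block_swap)
qed

text \<open>The seven terms correspond to the seven nonempty unions of \<open>?A\<close>,
  \<open>?B\<close>, \<open>?C\<close>, the half-edges of the three factors. Each is half of a
  \<open>pair_sum\<close>, once the factors concerned have been made adjacent and
  rebracketed.\<close>

lemma boundary_H_second_order_gclass:
  fixes X Y Z :: graph_data
  assumes X: "labelled_graph X" "of_nat (nv X) = p" and Y: "labelled_graph Y" "of_nat (nv Y) = q"
    and Z: "labelled_graph Z"
  defines "x \<equiv> gclass X :: 'k::field_char_0 graph_space" and "y \<equiv> gclass Y :: 'k graph_space"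
    and "z \<equiv> gclass Z :: 'k graph_space"
  shows "boundary_H (graph_mult (graph_mult x y) z) =
      graph_mult (boundary_H (graph_mult x y)) z
      + parity_sign p *\<^sub>G graph_mult x (boundary_H (graph_mult y z))
      + parity_sign ((p - 1) * q) *\<^sub>G graph_mult y (boundary_H (graph_mult x z))
      - graph_mult (graph_mult (boundary_H x) y) z
      - parity_sign p *\<^sub>G graph_mult (graph_mult x (boundary_H y)) z
      - parity_sign (p + q) *\<^sub>G graph_mult (graph_mult x y) (boundary_H z)" (is "?L = ?R")
proof -
  note lu = labelled_graph_union
  let ?XY = "disjoint_union X Y" and ?U = "disjoint_union (disjoint_union X Y) Z"
  let ?A = "inl_half ` inl_half ` halves X" and ?B = "inl_half ` inr_half ` halves Y"
    and ?C = "inr_half ` halves Z"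
  note LXY = lu[OF X(1) Y(1)] and LU = lu[OF lu[OF X(1) Y(1)] Z]
  have ps: "pair_sum W (halves W) = boundary_H (gclass W) + (boundary_H (gclass W) :: 'k graph_space)"
    if "labelled_graph W" for W
    using pair_sum_halves[OF that] boundary_H_gclass[OF that] by metis
  have mult: "graph_mult (gclass V) (gclass W) = (gclass (disjoint_union V W) :: 'k graph_space)"
    if "labelled_graph V" "labelled_graph W" for V W using graph_mult_gclass[OF that] .
  note fin = labelled_graphD(1)[OF X(1)] labelled_graphD(1)[OF Y(1)] labelled_graphD(1)[OF Z]
  have three: "pair_sum ?U (?A \<union> ?B \<union> ?C) + pair_sum ?U ?A + pair_sum ?U ?B + pair_sum ?U ?C
    = pair_sum ?U (?A \<union> ?B) + pair_sum ?U (?B \<union> ?C) + (pair_sum ?U (?A \<union> ?C) :: 'k graph_space)"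
    by (rule pair_sum_three) (use fin in auto)
  have U: "pair_sum ?U (?A \<union> ?B \<union> ?C) = ?L + ?L"
    using ps[OF LU] by (simp add: halves_union image_Un x_def y_def z_def mult X Y Z LXY)
  have AB: "pair_sum ?U (?A \<union> ?B) = graph_mult (boundary_H (graph_mult x y) + boundary_H (graph_mult x y)) z"
    using pair_sum_union_left[OF LXY Z subset_refl, where ?'k = 'k] ps[OF LXY]
    by (simp add: halves_union image_Un x_def y_def z_def mult X Y)
  have A: "pair_sum ?U ?A = graph_mult (graph_mult (boundary_H x + boundary_H x) y) z"
    using pair_sum_union_left[OF LXY Z, of "inl_half ` halves X", where ?'k = 'k]
      pair_sum_union_left[OF X(1) Y(1) subset_refl, where ?'k = 'k] ps[OF X(1)]
    by (simp add: halves_union x_def y_def z_def)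
  have B: "pair_sum ?U ?B = parity_sign p *\<^sub>G graph_mult (graph_mult x (boundary_H y + boundary_H y)) z"
    using pair_sum_union_left[OF LXY Z, of "inr_half ` halves Y", where ?'k = 'k]
      pair_sum_union_right[OF X(1) Y(1) X(2), where ?'k = 'k] ps[OF Y(1)]
    by (simp add: halves_union x_def y_def z_def graph_mult_scale_left)
  have "of_nat (nv ?XY) = p + q" using X(2) Y(2) by simp
  then have C: "pair_sum ?U ?C = parity_sign (p + q) *\<^sub>G graph_mult (graph_mult x y) (boundary_H z + boundary_H z)"
    using pair_sum_union_right[OF LXY Z, where ?'k = 'k] ps[OF Z]
    by (simp add: x_def y_def z_def mult X Y)
  have BC: "pair_sum ?U (?B \<union> ?C)
      = parity_sign p *\<^sub>G graph_mult x (boundary_H (graph_mult y z) + boundary_H (graph_mult y z))"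
  proof -
    let ?V = "disjoint_union X (disjoint_union Y Z)"
    have "assoc_half ` (?B \<union> ?C) = inr_half ` halves (disjoint_union Y Z)"
      by (simp add: halves_union image_Un image_image)
    moreover have "?B \<union> ?C \<subseteq> halves ?U" by (auto simp: halves_union)
    ultimately have "pair_sum ?U (?B \<union> ?C) = (pair_sum ?V (inr_half ` halves (disjoint_union Y Z)) :: 'k graph_space)"
      using pair_sum_iso[OF LU lu[OF X(1) lu[OF Y(1) Z]] graph_iso_union_assoc(1), where ?'k = 'k]
      by (simp add: graph_iso_union_assoc(2))
    then show ?thesis
      using pair_sum_union_right[OF X(1) lu[OF Y(1) Z] X(2), where ?'k = 'k] ps[OF lu[OF Y(1) Z]]
      by (simp add: x_def y_def z_def mult Y Z)
  qed
  \<comment> \<open>\<open>X\<close> and \<open>Z\<close> are not adjacent. Exchanging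
    \<open>X\<close> and \<open>Y\<close> costs \<open>p * q\<close>, passing the operator across
    \<open>Y\<close> costs \<open>q\<close>, and the sum is \<open>(p - 1) * q\<close> in
    \<open>bit\<close>.\<close>
  have AC: "pair_sum ?U (?A \<union> ?C)
      = parity_sign ((p - 1) * q) *\<^sub>G graph_mult y (boundary_H (graph_mult x z) + boundary_H (graph_mult x z))"
  proof -
    let ?W = "disjoint_union (disjoint_union Y X) Z" and ?V = "disjoint_union Y (disjoint_union X Z)"
    let ?A' = "inl_half ` inr_half ` halves X"
    let ?f = "case_half (inl_half \<circ> case_half inr_half inl_half) inr_half"
    note LW = lu[OF lu[OF Y(1) X(1)] Z] and LV = lu[OF Y(1) lu[OF X(1) Z]]
    have sgn: "of_int ((- 1) ^ (nv X * nv Y)) = (parity_sign (p * q) :: 'k)"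
      by (simp add: parity_sign_of_nat flip: X(2) Y(2) of_nat_mult)
    have "?f ` (?A \<union> ?C) = ?A' \<union> ?C" by (simp add: image_Un image_image)
    moreover have "?A \<union> ?C \<subseteq> halves ?U" by (auto simp: halves_union)
    ultimately have "pair_sum ?U (?A \<union> ?C) = parity_sign (p * q) *\<^sub>G (pair_sum ?W (?A' \<union> ?C) :: 'k graph_space)"
      using pair_sum_iso[OF LU LW graph_iso_union_swap_left(1)[OF X(1) Y(1) Z], where ?'k = 'k]
      unfolding graph_iso_union_swap_left(2)[OF X(1) Y(1) Z] sgn by metis
    moreover have "assoc_half ` (?A' \<union> ?C) = inr_half ` halves (disjoint_union X Z)"
      by (simp add: halves_union image_Un image_image)
    moreover have "?A' \<union> ?C \<subseteq> halves ?W" by (auto simp: halves_union)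
    ultimately have "pair_sum ?U (?A \<union> ?C)
        = parity_sign (p * q) *\<^sub>G (pair_sum ?V (inr_half ` halves (disjoint_union X Z)) :: 'k graph_space)"
      using pair_sum_iso[OF LW LV graph_iso_union_assoc(1), where ?'k = 'k]
      by (simp add: graph_iso_union_assoc(2))
    also have "\<dots> = (parity_sign (p * q) * parity_sign q) *\<^sub>G
        graph_mult y (boundary_H (graph_mult x z) + boundary_H (graph_mult x z))"
      using pair_sum_union_right[OF Y(1) lu[OF X(1) Z] Y(2), where ?'k = 'k] ps[OF lu[OF X(1) Z]]
      by (simp add: x_def y_def z_def mult X Z)
    also have "parity_sign (p * q) * parity_sign q = (parity_sign ((p - 1) * q) :: 'k)"
      using bit_cases_eq[of p] bit_cases_eq[of q] by (auto simp: parity_sign_def)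
    finally show ?thesis .
  qed
  \<comment> \<open>Every \<open>pair_sum\<close> in \<open>three\<close> stands for a doubled
    boundary, so \<open>three\<close> is twice the identity.\<close>
  have "(?L - ?R) + (?L - ?R) = 0"
    using three unfolding U AB A B C BC AC
    by (simp add: graph_mult_add_left graph_mult_add_right graph_space.scale_right_distrib algebra_simps)
  then show ?thesis by (simp add: double_eq_0_iff)
qed

text \<open>The signs depend on \<open>p\<close> and \<open>q\<close> alone, so with these fixed the
  defect \<open>E\<close> is linear in each argument. Hence \<open>u\<close> and \<open>v\<close>
  run through their graded components and \<open>w\<close> through the whole space.\<close>

lemma boundary_H_second_order:
  fixes u v w :: "'k::field_char_0 graph_space"
  assumes u: "u \<in> graph_grade p" and v: "v \<in> graph_grade q"
  shows "boundary_H (graph_mult (graph_mult u v) w) =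
      graph_mult (boundary_H (graph_mult u v)) w
      + parity_sign p *\<^sub>G graph_mult u (boundary_H (graph_mult v w))
      + parity_sign ((p - 1) * q) *\<^sub>G graph_mult v (boundary_H (graph_mult u w))
      - graph_mult (graph_mult (boundary_H u) v) w
      - parity_sign p *\<^sub>G graph_mult (graph_mult u (boundary_H v)) w
      - parity_sign (p + q) *\<^sub>G graph_mult (graph_mult u v) (boundary_H w)"
proof -
  define E where "E u v w = boundary_H (graph_mult (graph_mult u v) w) -
     (graph_mult (boundary_H (graph_mult u v)) w
      + parity_sign p *\<^sub>G graph_mult u (boundary_H (graph_mult v w))
      + parity_sign ((p - 1) * q) *\<^sub>G graph_mult v (boundary_H (graph_mult u w))
      - graph_mult (graph_mult (boundary_H u) v) w
      - parity_sign p *\<^sub>G graph_mult (graph_mult u (boundary_H v)) w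
      - parity_sign (p + q) *\<^sub>G graph_mult (graph_mult u v) (boundary_H w))"
    for u v w :: "'k graph_space"
  note lin = boundary_H_add boundary_H_scale graph_mult_add_left graph_mult_add_right
    graph_mult_scale_left graph_mult_scale_right graph_space.scale_right_distrib
    graph_space.scale_right_diff_distrib graph_space.scale_left_commute algebra_simps
  have E1: "E (c *\<^sub>G a + u) v w = c *\<^sub>G E a v w + E u v w" for c a u v w
    unfolding E_def by (simp add: lin)
  have E2: "E u (c *\<^sub>G a + v) w = c *\<^sub>G E u a w + E u v w" for c a u v w
    unfolding E_def by (simp add: lin)
  have E3: "E u v (c *\<^sub>G a + w) = c *\<^sub>G E u v a + E u v w" for c a u v w
    unfolding E_def by (simp add: lin)
  have E0: "E 0 v w = 0" "E u 0 w = 0" "E u v 0 = 0" for u v w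
    by (simp_all add: E_def)
  have "E u v w = 0"
    using u
  proof (induction rule: graph_grade_induct)
    case (add c X u)
    note X = add(1,2)
    have "E (gclass X) v w = 0"
      using v
    proof (induction rule: graph_grade_induct)
      case (add d Y v)
      note Y = add(1,2)
      have "E (gclass X) (gclass Y) w = 0"
      proof (induction w rule: graph_space_induct)
        case (add e Z w)
        have "E (gclass X) (gclass Y) (gclass Z) = 0"
          unfolding E_def using boundary_H_second_order_gclass[OF X Y add(1), where ?'k = 'k] by simp
        then show ?case using add(2) by (simp add: E3)
      qed (simp add: E0)
      then show ?case using add(3) by (simp add: E2)
    qed (simp add: E0)
    then show ?case using add(3) by (simp add: E1)
  qed (simp add: E0)
  then show ?thesis by (simp add: E_def)
qed

section \<open>The axioms of a Batalin-Vilkovisky algebra\<close>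

lemma boundary_H_square: "boundary_H (boundary_H u) = 0"
  by (induction u rule: graph_space_induct)
    (simp_all add: boundary_H_add boundary_H_scale boundary_H_gclass boundary_H_boundary_gen)

lemma graph_grade_disjoint: "graph_grade 0 \<inter> graph_grade 1 = {0 :: 'k::field_char_0 graph_space}"
proof
  show "graph_grade 0 \<inter> graph_grade 1 \<subseteq> {0 :: 'k graph_space}"
  proof clarify
    fix u :: "'k graph_space" assume "u \<in> graph_grade 0" "u \<in> graph_grade 1"
    then show "u = 0" using grade_part_grade[of u 0 0] grade_part_grade[of u 1 0] by simp
  qed
qed (simp add: graph_space.subspace_0[OF subspace_graph_grade])

lemma graph_grade_sum: "\<exists>v\<in>graph_grade 0. \<exists>w\<in>graph_grade 1. u = v + (w :: 'k::field_char_0 graph_space)"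
proof (induction u rule: graph_space_induct)
  case zero
  show ?case by (intro bexI[of _ 0]) (simp_all add: graph_space.subspace_0[OF subspace_graph_grade])
next
  case (add c X u)
  then obtain v w where vw: "v \<in> graph_grade 0" "w \<in> graph_grade 1" "u = v + w" by blast
  note sub = graph_space.subspace_add[OF subspace_graph_grade] graph_space.subspace_scale[OF subspace_graph_grade]
  have g: "gclass X \<in> (graph_grade (of_nat (nv X)) :: 'k graph_space set)" using add(1) by (intro graph_grade_gclass) auto
  show ?case
  proof (cases "even (nv X)")
    case True
    then show ?thesis using g vw
      by (intro bexI[of _ "c *\<^sub>G gclass X + v"] bexI[of _ w]) (auto simp: of_nat_bit add.assoc intro!: sub)
  next
    case False
    then show ?thesis using g vw
      by (intro bexI[of _ v] bexI[of _ "c *\<^sub>G gclass X + w"]) (auto simp: of_nat_bit algebra_simps intro!: sub)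
  qed
qed

lemma gclass_empty_grade: "gclass empty_graph \<in> graph_grade 0"
  by (intro graph_grade_gclass labelled_graph_empty) (simp add: empty_graph_def)

theorem proposition4p7:
  shows "BV_algebra
    ((*\<^sub>G) :: 'k::field_char_0 \<Rightarrow> 'k graph_space \<Rightarrow> 'k graph_space)
    graph_mult (gclass empty_graph) graph_grade boundary_H"
proof unfold_locales
  fix u v w :: "'k graph_space" and c :: 'k and p q r :: bit
  show "graph_mult u (gclass empty_graph) = u"
  proof -
    \<comment> \<open>Commuting past the unit requires homogeneous elements, hence the splitting; no
      sign arises because the unit is even.\<close>
    obtain v w where "v \<in> graph_grade 0" "w \<in> graph_grade 1" "u = v + w" using graph_grade_sum by blast
    then show ?thesis
      using graph_mult_commute[of v 0, OF _ gclass_empty_grade] graph_mult_commute[of w 1, OF _ gclass_empty_grade]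
      by (simp add: graph_mult_add_left graph_mult_empty_left parity_sign_def)
  qed
qed (rule graph_mult_add_left graph_mult_add_right graph_mult_scale_left graph_mult_scale_right graph_mult_assoc
  graph_mult_empty_left subspace_graph_grade graph_grade_disjoint graph_grade_sum gclass_empty_grade
  graph_grade_mult graph_mult_commute boundary_H_add boundary_H_scale boundary_H_grade boundary_H_square
  boundary_H_second_order; assumption)+

end
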